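(* The class of $\Delta$-RAAGs is stable under finite coproducts. Precisely, let $\Gamma_1,\Gamma_2$ be two graphs, and for $i\in\{1,2\}$ let $G_{\Gamma_i}\rtimes_{\delta_{\mathbf z_i}}\langle x_{i0}\rangle$ be a $\Delta$-RAAG, where $\langle x_{i0}\rangle$ is a copy of $\Delta$, $\{x_{i1},\dots,x_{id_{\Gamma_i}}\}$ is the canonical system of generators of the pro-$2$ RAAG $G_{\Gamma_i}$ and $\mathbf z_i=(z_{i1},\dots,z_{id_{\Gamma_i}})\in G_{\Gamma_i}^{d_{\Gamma_i}}$. Let $\Gamma_0$ be the graph with one vertex and $z$ a generator of $G_{\Gamma_0}\simeq\mathbb Z_2$. Then $$\left(G_{\Gamma_1}\rtimes_{\delta_{\mathbf z_1}}\langle x_{10}\rangle\right)\coprod\left(G_{\Gamma_2}\rtimes_{\delta_{\mathbf z_2}}\langle x_{20}\rangle\right)\simeq G_{\Gamma_1\coprod\Gamma_2\coprod\Gamma_0}\rtimes_{\delta_{\mathbf z}}\langle x_{10}\rangle .$$ Through this isomorphism, $z$ is sent to $x_{10}x_{20}$. A (canonical) system of generators of the pro-$2$ RAAG $G_{\Gamma_1\coprod\Gamma_2\coprod\Gamma_0}$ is $\{x_{11},\dots,x_{1d_{\Gamma_1}},x_{21},\dots,x_{2d_{\Gamma_2}},z\}$, and the vector $\mathbf z$ is given by $$\mathbf z:=(z_{11},\dots,z_{1d_{\Gamma_1}},\,z\times z_{21},\dots,z\times z_{2d_{\Gamma_2}},\,1)\in (G_{\Gamma_1\coprod\Gamma_2\coprod\Gamma_0})^{d_{\Gamma_1}+d_{\Gamma_2}+1},$$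 where $z\times z_{2j}$ is the product of $z$ and $z_{2j}$ in this order. The vector $\mathbf z$ defines an action $\delta_{\mathbf z}:\Delta=\langle x_{10}\rangle\to\mathrm{Aut}(G_{\Gamma_1\coprod\Gamma_2\coprod\Gamma_0})$ such that $\delta_{\mathbf z}(x_{10})$ sends each canonical generator $x$ to $w^{-1}x^{-1}w$, where $w$ is the entry of $\mathbf z$ corresponding to $x$.
   Context: $\Delta:=\mathbb{Z}/2\mathbb{Z}$ is written multiplicatively with generator $x_0$ (here copies $\langle x_{10}\rangle$, $\langle x_{20}\rangle$ of $\Delta$ are used, with $x_{10}$, $x_{20}$ in the role of $x_0$). For an undirected graph $\Gamma=(\mathbf{X},\mathbf{E})$ with vertex set $\{1,\dots,d_\Gamma\}$, the pro-$2$ right angled Artin group (RAAG) $G_\Gamma$ is the pro-$2$ group with (canonical) generators $x_1,\dots,x_{d_\Gamma}$ and relations $[x_i,x_j]:=x_i^{-1}x_j^{-1}x_ix_j=1$ for $\{i,j\}\in\mathbf{E}$. If $\mathbf{z}=(z_1,\dots,z_{d_\Gamma})\in G_\Gamma^{d_\Gamma}$ is such that there is a well-defined action $\delta_{\mathbf z}:\Delta\to\mathrm{Aut}(G_\Gamma)$ with $\delta_{\mathbf z}(x_0)(x_i)=z_i^{-1}x_i^{-1}z_i$ for all $1\leq i\leq d_\Gamma$, then $G_{\mathbf z}:=G_\Gamma\rtimes_{\delta_{\mathbf z}}\Delta$ is called a $\Delta$-RAAG; the class of $\Delta$-RAAGs consists of all such pro-$2$ groups, for all graphs $\Gamma$.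 The symbol $\coprod$ denotes the coproduct (free product) of pro-$2$ groups, or the disjoint union of graphs.
   Formalization: The entries of the vector for x_{2j} are z_{2j}z^{-1} instead of z z_{2j}, since the printed ones need not define an action (e.g. one vertex, z_2=x); the empty coproduct, the trivial group, is excluded because it is not a Δ-RAAG. *)

theory Defs
  imports "HOL-Analysis.Analysis" "HOL-Algebra.Algebra"
begin

section \<open>Pro-2 groups\<close>

record 'a topgroup = "'a monoid" +
  topo :: "'a topology"

definition topological_group :: "'a topgroup \<Rightarrow> bool" where
  "topological_group G \<longleftrightarrow>
     group G \<and> topspace (topo G) = carrier G \<and>
     continuous_map (prod_topology (topo G) (topo G)) (topo G) (\<lambda>(x, y). x \<otimes>\<^bsub>G\<^esub> y) \<and>
     continuous_map (topo G) (topo G) (\<lambda>x. inv\<^bsub>G\<^esub> x)"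

text \<open>The third line makes the group profinite. In the last one the index is automatically
  finite; if it were not, \<^const>\<open>card\<close> would be \<open>0\<close>, which is not a power of \<open>2\<close>.\<close>

definition pro2_group :: "'a topgroup \<Rightarrow> bool" where
  "pro2_group G \<longleftrightarrow>
     topological_group G \<and> compact_space (topo G) \<and> Hausdorff_space (topo G) \<and>
     (\<forall>U. openin (topo G) U \<and> \<one>\<^bsub>G\<^esub> \<in> U \<longrightarrow> (\<exists>H. subgroup H G \<and> openin (topo G) H \<and> H \<subseteq> U)) \<and>
     (\<forall>N. N \<lhd> G \<and> openin (topo G) N \<longrightarrow> (\<exists>k. card (rcosets\<^bsub>G\<^esub> N) = 2 ^ k))"

definition cont_hom :: "'a topgroup \<Rightarrow> 'b topgroup \<Rightarrow> ('a \<Rightarrow> 'b) set" where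
  "cont_hom G H = {f \<in> hom G H. continuous_map (topo G) (topo H) f}"

text \<open>Coproducts in the category of pro-2 groups, by their universal property. Since HOL cannot
  quantify over types inside a formula, the type \<open>'k\<close> of the test groups is a parameter; the full
  universal property is the one for all types \<open>'k\<close>.\<close>

definition is_pro2_coproduct ::
    "'k itself \<Rightarrow> 'i set \<Rightarrow> ('i \<Rightarrow> 'a topgroup) \<Rightarrow> ('i \<Rightarrow> 'a \<Rightarrow> 'c) \<Rightarrow> 'c topgroup \<Rightarrow> bool" where
  "is_pro2_coproduct _ I G \<iota> C \<longleftrightarrow>
     (\<forall>i\<in>I. pro2_group (G i)) \<and> pro2_group C \<and> (\<forall>i\<in>I. \<iota> i \<in> cont_hom (G i) C) \<and>
     (\<forall>(K :: 'k topgroup) f. pro2_group K \<and> (\<forall>i\<in>I. f i \<in> cont_hom (G i) K) \<longrightarrow>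
        (\<exists>!\<phi>. \<phi> \<in> cont_hom C K \<and> \<phi> \<in> extensional (carrier C) \<and>
              (\<forall>i\<in>I. \<forall>g\<in>carrier (G i). \<phi> (\<iota> i g) = f i g)))"


section \<open>Free pro-2 groups and presentations\<close>

text \<open>The free pro-2 group on \<open>x\<^sub>1, \<dots>, x\<^sub>d\<close> is the pro-2 completion of the free group. It is
  realised as the closure of the image of the free group in the product, over all finite 2-groups
  \<open>H\<close> and all \<open>d\<close>-tuples \<open>h\<close> in \<open>H\<close>, of the discrete groups \<open>H\<close>; the generator \<open>x\<^sub>i\<close> has the
  component \<open>h i\<close> at the index \<open>(H, h)\<close>. Up to isomorphism all finite groups have their carrier
  in \<^typ>\<open>nat\<close>.\<close>

type_synonym free_pro2_elt = "nat monoid \<times> (nat \<Rightarrow> nat) \<Rightarrow> nat"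

definition free_pro2_index :: "nat \<Rightarrow> (nat monoid \<times> (nat \<Rightarrow> nat)) set" where
  "free_pro2_index d =
     {(H, h). group H \<and> (\<exists>k. order H = 2 ^ k) \<and> h \<in> {1..d} \<rightarrow>\<^sub>E carrier H}"

definition free_pro2_ambient :: "nat \<Rightarrow> free_pro2_elt monoid" where
  "free_pro2_ambient d = product_group (free_pro2_index d) fst"

definition free_pro2_ambient_topology :: "nat \<Rightarrow> free_pro2_elt topology" where
  "free_pro2_ambient_topology d =
     product_topology (\<lambda>a. discrete_topology (carrier (fst a))) (free_pro2_index d)"

definition free_pro2_gen :: "nat \<Rightarrow> nat \<Rightarrow> free_pro2_elt" where
  "free_pro2_gen d i = (\<lambda>a\<in>free_pro2_index d. snd a i)"

definition free_pro2_carrier :: "nat \<Rightarrow> free_pro2_elt set" where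
  "free_pro2_carrier d =
     free_pro2_ambient_topology d closure_of
       generate (free_pro2_ambient d) (free_pro2_gen d ` {1..d})"

definition free_pro2 :: "nat \<Rightarrow> free_pro2_elt topgroup" where
  "free_pro2 d =
     \<lparr>carrier = free_pro2_carrier d,
      mult = mult (free_pro2_ambient d),
      one = one (free_pro2_ambient d),
      topo = subtopology (free_pro2_ambient_topology d) (free_pro2_carrier d)\<rparr>"

definition closed_normal_closure :: "'a topgroup \<Rightarrow> 'a set \<Rightarrow> 'a set" where
  "closed_normal_closure G R = \<Inter>{N. N \<lhd> G \<and> closedin (topo G) N \<and> R \<subseteq> N}"

text \<open>A set of cosets is open in the quotient topology iff the union of these cosets is open.\<close>

definition quotient_topgroup :: "'a topgroup \<Rightarrow> 'a set \<Rightarrow> 'a set topgroup" where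
  "quotient_topgroup G N =
     \<lparr>carrier = carrier (G Mod N),
      mult = mult (G Mod N),
      one = one (G Mod N),
      topo = topology (\<lambda>U. U \<subseteq> carrier (G Mod N) \<and> openin (topo G) (\<Union>U))\<rparr>"


section \<open>Graphs and pro-2 right angled Artin groups\<close>

record graph =
  nverts :: nat
  edges :: "nat set set"

text \<open>The vertices are \<open>1, \<dots>, nverts \<Gamma>\<close>; there may be none.\<close>

definition ugraph :: "graph \<Rightarrow> bool" where
  "ugraph \<Gamma> \<longleftrightarrow> (\<forall>e\<in>edges \<Gamma>. e \<subseteq> {1..nverts \<Gamma>} \<and> card e = 2)"

text \<open>Disjoint union; the vertices of the second graph are shifted past those of the first.\<close>

definition graph_union :: "graph \<Rightarrow> graph \<Rightarrow> graph" where
  "graph_union \<Gamma> \<Gamma>' =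
     \<lparr>nverts = nverts \<Gamma> + nverts \<Gamma>',
      edges = edges \<Gamma> \<union> (\<lambda>e. (\<lambda>j. nverts \<Gamma> + j) ` e) ` edges \<Gamma>'\<rparr>"

definition point_graph :: graph where
  "point_graph = \<lparr>nverts = 1, edges = {}\<rparr>"

type_synonym raag_elt = "free_pro2_elt set"

definition raag_relators :: "graph \<Rightarrow> free_pro2_elt set" where
  "raag_relators \<Gamma> =
     (let F = free_pro2 (nverts \<Gamma>); x = free_pro2_gen (nverts \<Gamma>) in
       {inv\<^bsub>F\<^esub> (x i) \<otimes>\<^bsub>F\<^esub> inv\<^bsub>F\<^esub> (x j) \<otimes>\<^bsub>F\<^esub> x i \<otimes>\<^bsub>F\<^esub> x j | i j. {i, j} \<in> edges \<Gamma>})"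

definition raag_kernel :: "graph \<Rightarrow> free_pro2_elt set" where
  "raag_kernel \<Gamma> = closed_normal_closure (free_pro2 (nverts \<Gamma>)) (raag_relators \<Gamma>)"

definition raag :: "graph \<Rightarrow> raag_elt topgroup" where
  "raag \<Gamma> = quotient_topgroup (free_pro2 (nverts \<Gamma>)) (raag_kernel \<Gamma>)"

definition raag_gen :: "graph \<Rightarrow> nat \<Rightarrow> raag_elt" where
  "raag_gen \<Gamma> i = raag_kernel \<Gamma> #>\<^bsub>free_pro2 (nverts \<Gamma>)\<^esub> free_pro2_gen (nverts \<Gamma>) i"


section \<open>\<open>\<Delta>\<close>-RAAGs\<close>

text \<open>The group of order 2, discrete, with elements \<open>0\<close> (neutral) and \<open>1\<close> (the generator).\<close>

definition Delta :: "int topgroup" where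
  "Delta =
     \<lparr>carrier = carrier (integer_mod_group 2),
      mult = mult (integer_mod_group 2),
      one = one (integer_mod_group 2),
      topo = discrete_topology (carrier (integer_mod_group 2))\<rparr>"

abbreviation Delta_gen :: int where
  "Delta_gen \<equiv> 1"

definition semidirect ::
    "'a topgroup \<Rightarrow> 'b topgroup \<Rightarrow> ('b \<Rightarrow> 'a \<Rightarrow> 'a) \<Rightarrow> ('a \<times> 'b) topgroup" where
  "semidirect N H \<theta> =
     \<lparr>carrier = carrier N \<times> carrier H,
      mult = (\<lambda>(n, h) (n', h'). (n \<otimes>\<^bsub>N\<^esub> \<theta> h n', h \<otimes>\<^bsub>H\<^esub> h')),
      one = (\<one>\<^bsub>N\<^esub>, \<one>\<^bsub>H\<^esub>),
      topo = prod_topology (topo N) (topo H)\<rparr>"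

text \<open>\<open>delta_action \<Gamma> z \<delta>\<close>: the vector \<open>(z 1, \<dots>, z d)\<close> gives rise to a well-defined action,
  namely \<open>\<delta>\<close>, by automorphisms of the pro-2 group. As the \<open>x\<^sub>i\<close> generate topologically,
  \<open>\<delta>\<close> is determined by \<open>z\<close> on \<^term>\<open>carrier Delta\<close>.\<close>

definition delta_action ::
    "graph \<Rightarrow> (nat \<Rightarrow> raag_elt) \<Rightarrow> (int \<Rightarrow> raag_elt \<Rightarrow> raag_elt) \<Rightarrow> bool" where
  "delta_action \<Gamma> z \<delta> \<longleftrightarrow>
     (\<forall>i\<in>{1..nverts \<Gamma>}. z i \<in> carrier (raag \<Gamma>)) \<and>
     \<delta> \<in> hom Delta (AutoGroup (raag \<Gamma>)) \<and>
     (\<forall>s\<in>carrier Delta. continuous_map (topo (raag \<Gamma>)) (topo (raag \<Gamma>)) (\<delta> s)) \<and>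
     (\<forall>i\<in>{1..nverts \<Gamma>}. \<delta> Delta_gen (raag_gen \<Gamma> i) =
        inv\<^bsub>raag \<Gamma>\<^esub> (z i) \<otimes>\<^bsub>raag \<Gamma>\<^esub> inv\<^bsub>raag \<Gamma>\<^esub> (raag_gen \<Gamma> i) \<otimes>\<^bsub>raag \<Gamma>\<^esub> z i)"

abbreviation delta_raag ::
    "graph \<Rightarrow> (int \<Rightarrow> raag_elt \<Rightarrow> raag_elt) \<Rightarrow> (raag_elt \<times> int) topgroup" where
  "delta_raag \<Gamma> \<delta> \<equiv> semidirect (raag \<Gamma>) Delta \<delta>"

text \<open>The vector for the coproduct of two \<open>\<Delta>\<close>-RAAGs. Let \<open>s\<close>, \<open>t\<close> be the involutions of the two
  factors and \<open>\<zeta> = s t\<close>, so \<open>s = \<zeta> t\<close> and \<open>s \<zeta> s = \<zeta>\<^sup>-\<^sup>1\<close>. For a generator \<open>x\<close> of the second factor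
  with \<open>t x t = z\<^sup>-\<^sup>1 x\<^sup>-\<^sup>1 z\<close> one gets \<open>s x s = \<zeta> z\<^sup>-\<^sup>1 x\<^sup>-\<^sup>1 z \<zeta>\<^sup>-\<^sup>1 = w\<^sup>-\<^sup>1 x\<^sup>-\<^sup>1 w\<close> with \<open>w = z \<zeta>\<^sup>-\<^sup>1\<close>. In the
  convention used in \<^const>\<open>delta_action\<close> the entry for \<open>x\<close> is therefore \<open>z \<zeta>\<^sup>-\<^sup>1\<close>; the product
  \<open>\<zeta> z\<close> belongs to the opposite convention \<open>x \<mapsto> z x\<^sup>-\<^sup>1 z\<^sup>-\<^sup>1\<close> and does not define an involution
  here, for example if \<open>z = x\<close> generates the second RAAG.\<close>

end

theory Submission
  imports Defs
begin

text \<open>Free pro-2 groups, and hence pro-2 RAAGs and semidirect products with \<open>\<Delta>\<close>, are determined by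
  universal properties with respect to pro-2 groups. Let \<open>s\<close>, \<open>t\<close> be the involutions of the two
  factors and \<open>\<zeta> = s t\<close>. The RAAG of \<open>\<Gamma>\<^sub>1 \<squnion> \<Gamma>\<^sub>2 \<squnion> pt\<close> is the coproduct of \<open>G\<^sub>1\<close>, \<open>G\<^sub>2\<close> and the free
  pro-2 group on \<open>\<zeta>\<close>, so it has an endomorphism \<open>\<sigma>\<close> that is the given involution on \<open>G\<^sub>1\<close>, the given
  involution followed by conjugation with \<open>\<zeta>\<close> on \<open>G\<^sub>2\<close>, and inversion on \<open>\<zeta>\<close>; on generators one sees
  \<open>\<sigma>\<^sup>2 = 1\<close>. A homomorphism from the semidirect product for \<open>\<sigma>\<close> amounts to homomorphisms on \<open>G\<^sub>1\<close> and
  \<open>G\<^sub>2\<close> and images of \<open>s\<close> and \<open>\<zeta>\<close>, equivalently of \<open>s\<close> and \<open>t = s \<zeta>\<close>, subject to exactly the relations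
  of the two factors.\<close>

section \<open>Pro-2 groups\<close>

text \<open>The free pro-2 group is a concrete closure in a product of finite 2-groups with carriers
  in \<open>nat\<close>, while the test groups have an arbitrary element type \<open>'k\<close>. The
  bridge is an injection of each finite quotient of a test group into \<open>nat\<close>: the
  quotient then occurs among the coordinates, and compactness of the test group glues the values
  found in the quotients. Afterwards maps are chosen from universal properties and compared on
  topological generators, by density and the Hausdorff property. Bijectivity of \<sigma> needs no
  separate argument, since an endomorphism squaring to the identity is its own inverse. The groups
  are treated with the same economy: that they are pro-2 is verified through a base of cosets of
  normal subgroups of 2-power index, uniformly for free groups, quotients and semidirect products.
  Coproducts of n factors arise by adjoining one factor at a time, which is possible because all the
  groups involved have the same element type.\<close>

lemma (in group) inv_mult_cancel:
  "x \<in> carrier G \<Longrightarrow> y \<in> carrier G \<Longrightarrow> inv x \<otimes> (x \<otimes> y) = y"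
  by (simp flip: m_assoc)

text \<open>Taking images under h matches the cosets of the preimage with the cosets of M: h is
  onto, and a coset of the preimage is the full preimage of its image. This carries indices along
  quotient maps in either direction.\<close>

lemma (in group_hom) card_rcosets_vimage:
  assumes surj: "h ` carrier G = carrier H" and M: "subgroup M H"
  shows "card (rcosets\<^bsub>G\<^esub> {x \<in> carrier G. h x \<in> M}) = card (rcosets\<^bsub>H\<^esub> M)"
proof -
  let ?M = "{x \<in> carrier G. h x \<in> M}"
  interpret M: subgroup M H by fact
  have coset: "h ` (?M #>\<^bsub>G\<^esub> x) = M #>\<^bsub>H\<^esub> h x" if x: "x \<in> carrier G" for x
  proof
    show "h ` (?M #>\<^bsub>G\<^esub> x) \<subseteq> M #>\<^bsub>H\<^esub> h x"
      using x by (auto simp: r_coset_def)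
    show "M #>\<^bsub>H\<^esub> h x \<subseteq> h ` (?M #>\<^bsub>G\<^esub> x)"
    proof
      fix y assume "y \<in> M #>\<^bsub>H\<^esub> h x"
      then obtain m where m: "m \<in> M" "y = m \<otimes>\<^bsub>H\<^esub> h x" by (auto simp: r_coset_def)
      moreover obtain g where "g \<in> carrier G" "h g = m"
        using m(1) surj M.subset by (metis imageE subsetD)
      ultimately show "y \<in> h ` (?M #>\<^bsub>G\<^esub> x)"
        using x by (force simp: r_coset_def)
    qed
  qed
  have vimage: "?M #>\<^bsub>G\<^esub> x = {y \<in> carrier G. h y \<in> M #>\<^bsub>H\<^esub> h x}" if x: "x \<in> carrier G" for x
  proof
    show "?M #>\<^bsub>G\<^esub> x \<subseteq> {y \<in> carrier G. h y \<in> M #>\<^bsub>H\<^esub> h x}"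
      using x by (auto simp: r_coset_def)
    show "{y \<in> carrier G. h y \<in> M #>\<^bsub>H\<^esub> h x} \<subseteq> ?M #>\<^bsub>G\<^esub> x"
    proof
      fix y assume "y \<in> {y \<in> carrier G. h y \<in> M #>\<^bsub>H\<^esub> h x}"
      then obtain m where y: "y \<in> carrier G" and m: "m \<in> M" "h y = m \<otimes>\<^bsub>H\<^esub> h x"
        by (auto simp: r_coset_def)
      have "h (y \<otimes>\<^bsub>G\<^esub> inv\<^bsub>G\<^esub> x) = m"
        using x y m by (simp add: H.m_assoc)
      then have "y \<otimes>\<^bsub>G\<^esub> inv\<^bsub>G\<^esub> x \<in> ?M" using x y m by simp
      moreover have "y = (y \<otimes>\<^bsub>G\<^esub> inv\<^bsub>G\<^esub> x) \<otimes>\<^bsub>G\<^esub> x" using x y by (simp add: G.m_assoc)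
      ultimately show "y \<in> ?M #>\<^bsub>G\<^esub> x" unfolding r_coset_def by blast
    qed
  qed
  have "bij_betw ((`) h) (rcosets\<^bsub>G\<^esub> ?M) (rcosets\<^bsub>H\<^esub> M)"
    unfolding bij_betw_def
  proof
    show "inj_on ((`) h) (rcosets\<^bsub>G\<^esub> ?M)"
    proof (rule inj_onI)
      fix C D assume C: "C \<in> rcosets\<^bsub>G\<^esub> ?M" and D: "D \<in> rcosets\<^bsub>G\<^esub> ?M" and eq: "h ` C = h ` D"
      obtain x y where "x \<in> carrier G" "y \<in> carrier G" "C = ?M #>\<^bsub>G\<^esub> x" "D = ?M #>\<^bsub>G\<^esub> y"
        using C D by (auto simp: RCOSETS_def)
      then show "C = D" using eq coset[of x] coset[of y] vimage[of x] vimage[of y] by simp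
    qed
    show "((`) h) ` (rcosets\<^bsub>G\<^esub> ?M) = rcosets\<^bsub>H\<^esub> M"
      by (auto simp: RCOSETS_def coset image_UN simp flip: surj)
  qed
  then show ?thesis by (rule bij_betw_same_card)
qed

lemma power2_dvd: "k dvd (2::nat) ^ n \<Longrightarrow> \<exists>m. k = 2 ^ m"
  using divides_primepow_nat[of 2 k n] by auto

text \<open>G may be infinite, so Lagrange's theorem is applied in \<open>G Mod M\<close>, which has
  order 2 ^ k. The image of N there has the same index as N, and this index divides 2 ^ k.\<close>

lemma (in group) two_power_index_mono:
  assumes M: "M \<lhd> G" and N: "N \<lhd> G" and "M \<subseteq> N" and "card (rcosets M) = 2 ^ k"
  shows "\<exists>j. card (rcosets N) = 2 ^ j"
proof -
  interpret M: normal M G by fact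
  interpret N: normal N G by fact
  interpret Q: group "G Mod M" by (rule M.factorgroup_is_group)
  interpret \<pi>: group_hom G "G Mod M" "\<lambda>x. M #> x"
    by unfold_locales (rule M.r_coset_hom_Mod)
  have surj: "(\<lambda>x. M #> x) ` carrier G = carrier (G Mod M)"
    by (simp add: carrier_FactGroup)
  have sub: "subgroup ((\<lambda>x. M #> x) ` N) (G Mod M)"
    using \<pi>.subgroup_img_is_subgroup N.subgroup_axioms by blast
  \<comment> \<open>N is the full preimage of its image because it contains M.\<close>
  have "{x \<in> carrier G. M #> x \<in> (\<lambda>x. M #> x) ` N} = N"
  proof -
    have "x \<in> N" if "x \<in> carrier G" "M #> x = M #> n" "n \<in> N" for x n
    proof -
      have "x \<in> M #> n" using that M.subgroup_axioms rcos_self by metis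
      then obtain m where "m \<in> M" "x = m \<otimes> n" by (auto simp: r_coset_def)
      then show ?thesis using \<open>M \<subseteq> N\<close> \<open>n \<in> N\<close> by auto
    qed
    then show ?thesis using N.subset by auto
  qed
  with \<pi>.card_rcosets_vimage[OF surj sub]
  have "card (rcosets N) = card (rcosets\<^bsub>G Mod M\<^esub> ((\<lambda>x. M #> x) ` N))" by simp
  moreover have "card (rcosets\<^bsub>G Mod M\<^esub> ((\<lambda>x. M #> x) ` N)) dvd order (G Mod M)"
    using Q.lagrange[OF sub] by (metis dvd_triv_left)
  moreover have "order (G Mod M) = 2 ^ k"
    using assms(4) by (simp add: order_def FactGroup_def)
  ultimately show ?thesis using power2_dvd by metis
qed

text \<open>The index of the kernel is the order of the image, by the first isomorphism theorem, and
  the image is a subgroup of H.\<close>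

lemma (in group_hom) card_rcosets_kernel_dvd:
  shows "card (rcosets (kernel G H h)) dvd order H"
proof -
  have "card (rcosets (kernel G H h)) = card (h ` carrier G)"
  proof -
    interpret I: group_hom G "H\<lparr>carrier := h ` carrier G\<rparr>" h
      using H.subgroup_imp_group[OF img_is_subgroup]
      by (simp add: group_hom_def group_hom_axioms_def G.group_axioms hom_def)
    have "iso (G Mod kernel G H h) (H\<lparr>carrier := h ` carrier G\<rparr>) \<noteq> {}"
      using I.FactGroup_iso by (simp add: kernel_def is_iso_def)
    then obtain f where "bij_betw f (rcosets (kernel G H h)) (h ` carrier G)"
      by (auto simp: iso_def FactGroup_def)
    then show ?thesis by (rule bij_betw_same_card)
  qed
  moreover have "card (h ` carrier G) dvd order H"
    using H.lagrange[OF img_is_subgroup] by (metis dvd_triv_right)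
  ultimately show ?thesis by simp
qed

section \<open>Recognising pro-2 groups by a base of cosets\<close>

text \<open>Cosets of a normal subgroup multiply and invert as in the quotient group, so a base of
  such cosets makes the operations continuous. An open normal subgroup contains some M of the base,
  and then \<open>two_power_index_mono\<close> bounds its index by a power of 2 and makes it one.
  Free groups, quotients and semidirect products are all shown to be pro-2 in this way.\<close>

lemma pro2I:
  assumes grp: "group G" and space: "topspace (topo G) = carrier G"
    and "compact_space (topo G)" and "Hausdorff_space (topo G)"
    and base: "\<And>U x. openin (topo G) U \<Longrightarrow> x \<in> U \<Longrightarrow>
      \<exists>M k. M \<lhd> G \<and> card (rcosets\<^bsub>G\<^esub> M) = 2 ^ k \<and> M #>\<^bsub>G\<^esub> x \<subseteq> U \<and>
          (\<forall>y\<in>carrier G. openin (topo G) (M #>\<^bsub>G\<^esub> y))"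
  shows "pro2_group G"
proof -
  interpret group G by fact
  have "continuous_map (prod_topology (topo G) (topo G)) (topo G) (\<lambda>(x, y). x \<otimes>\<^bsub>G\<^esub> y)"
  proof -
    have "openin (prod_topology (topo G) (topo G))
            {(x, y). x \<in> carrier G \<and> y \<in> carrier G \<and> x \<otimes>\<^bsub>G\<^esub> y \<in> U}"
      if U: "openin (topo G) U" for U
      unfolding openin_prod_topology_alt
    proof clarify
      fix x y assume x: "x \<in> carrier G" and y: "y \<in> carrier G" and xy: "x \<otimes>\<^bsub>G\<^esub> y \<in> U"
      from base[OF U xy] obtain M where M: "M \<lhd> G" and sub: "M #>\<^bsub>G\<^esub> (x \<otimes>\<^bsub>G\<^esub> y) \<subseteq> U"
        and op: "\<And>y. y \<in> carrier G \<Longrightarrow> openin (topo G) (M #>\<^bsub>G\<^esub> y)" by blast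
      interpret M: normal M G by fact
      have "(M #>\<^bsub>G\<^esub> x) \<times> (M #>\<^bsub>G\<^esub> y) \<subseteq> {(x, y). x \<in> carrier G \<and> y \<in> carrier G \<and> x \<otimes>\<^bsub>G\<^esub> y \<in> U}"
      proof clarify
        fix a b assume a: "a \<in> M #>\<^bsub>G\<^esub> x" and b: "b \<in> M #>\<^bsub>G\<^esub> y"
        have "a \<otimes>\<^bsub>G\<^esub> b \<in> (M #>\<^bsub>G\<^esub> x) <#>\<^bsub>G\<^esub> (M #>\<^bsub>G\<^esub> y)"
          using a b by (auto simp: set_mult_def)
        then show "a \<in> carrier G \<and> b \<in> carrier G \<and> a \<otimes>\<^bsub>G\<^esub> b \<in> U"
          using a b x y sub M.rcos_sum r_coset_subset_G[OF M.subset] by blast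
      qed
      then show "\<exists>U' V. openin (topo G) U' \<and> openin (topo G) V \<and> x \<in> U' \<and> y \<in> V \<and>
          U' \<times> V \<subseteq> {(x, y). x \<in> carrier G \<and> y \<in> carrier G \<and> x \<otimes>\<^bsub>G\<^esub> y \<in> U}"
        using op x y rcos_self[OF _ M.subgroup_axioms] by blast
    qed
    moreover have "{p \<in> topspace (prod_topology (topo G) (topo G)). (\<lambda>(x, y). x \<otimes>\<^bsub>G\<^esub> y) p \<in> U} =
        {(x, y). x \<in> carrier G \<and> y \<in> carrier G \<and> x \<otimes>\<^bsub>G\<^esub> y \<in> U}" for U
      by (auto simp: space)
    ultimately show ?thesis by (simp only: continuous_map_def) (auto simp: space)
  qed
  moreover have "continuous_map (topo G) (topo G) (\<lambda>x. inv\<^bsub>G\<^esub> x)"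
  proof -
    have "openin (topo G) {x \<in> carrier G. inv\<^bsub>G\<^esub> x \<in> U}" if U: "openin (topo G) U" for U
    proof (subst openin_subopen, clarify)
      fix x assume x: "x \<in> carrier G" and xU: "inv\<^bsub>G\<^esub> x \<in> U"
      from base[OF U xU] obtain M where M: "M \<lhd> G" and sub: "M #>\<^bsub>G\<^esub> (inv\<^bsub>G\<^esub> x) \<subseteq> U"
        and op: "\<And>y. y \<in> carrier G \<Longrightarrow> openin (topo G) (M #>\<^bsub>G\<^esub> y)" by blast
      interpret M: normal M G by fact
      have "M #>\<^bsub>G\<^esub> x \<subseteq> {x \<in> carrier G. inv\<^bsub>G\<^esub> x \<in> U}"
      proof
        fix a assume a: "a \<in> M #>\<^bsub>G\<^esub> x"
        then have "inv\<^bsub>G\<^esub> a \<in> M #>\<^bsub>G\<^esub> inv\<^bsub>G\<^esub> x"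
          using M.rcos_inv[OF x] by (auto simp: SET_INV_def)
        then show "a \<in> {x \<in> carrier G. inv\<^bsub>G\<^esub> x \<in> U}"
          using a x sub r_coset_subset_G[OF M.subset] by blast
      qed
      then show "\<exists>T. openin (topo G) T \<and> x \<in> T \<and> T \<subseteq> {x \<in> carrier G. inv\<^bsub>G\<^esub> x \<in> U}"
        using op x rcos_self[OF _ M.subgroup_axioms] by blast
    qed
    then show ?thesis by (auto simp: continuous_map_def space)
  qed
  moreover have "\<exists>H. subgroup H G \<and> openin (topo G) H \<and> H \<subseteq> U"
    if "openin (topo G) U" "\<one>\<^bsub>G\<^esub> \<in> U" for U
    using base[OF that] by (metis normal_def coset_mult_one one_closed subgroup.subset)
  moreover have "\<exists>k. card (rcosets\<^bsub>G\<^esub> N) = 2 ^ k" if N: "N \<lhd> G" "openin (topo G) N" for N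
  proof -
    interpret N: normal N G by fact
    obtain M k where "M \<lhd> G" "card (rcosets\<^bsub>G\<^esub> M) = 2 ^ k" "M #>\<^bsub>G\<^esub> \<one>\<^bsub>G\<^esub> \<subseteq> N"
      using base[OF N(2) N.one_closed] by blast
    then show ?thesis
      using two_power_index_mono N(1) by (metis normal_def coset_mult_one subgroup.subset)
  qed
  ultimately show ?thesis
    using assms by (simp add: pro2_group_def topological_group_def)
qed

lemma
  assumes "pro2_group G"
  shows pro2_group_is_group: "group G"
    and pro2_topspace: "topspace (topo G) = carrier G"
    and pro2_compact: "compact_space (topo G)"
    and pro2_Hausdorff: "Hausdorff_space (topo G)"
    and pro2_continuous_mult:
      "continuous_map (prod_topology (topo G) (topo G)) (topo G) (\<lambda>(x, y). x \<otimes>\<^bsub>G\<^esub> y)"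
    and pro2_continuous_inv: "continuous_map (topo G) (topo G) (\<lambda>x. inv\<^bsub>G\<^esub> x)"
    and pro2_index: "N \<lhd> G \<Longrightarrow> openin (topo G) N \<Longrightarrow> \<exists>k. card (rcosets\<^bsub>G\<^esub> N) = 2 ^ k"
  using assms by (auto simp: pro2_group_def topological_group_def)

section \<open>Open normal subgroups of a pro-2 group\<close>

lemma continuous_map_mult:
  assumes "pro2_group G" "continuous_map T (topo G) f" "continuous_map T (topo G) g"
  shows "continuous_map T (topo G) (\<lambda>x. f x \<otimes>\<^bsub>G\<^esub> g x)"
  using continuous_map_compose[OF continuous_map_pairedI[OF assms(2,3)] pro2_continuous_mult[OF assms(1)]]
  by (simp add: o_def)

text \<open>The set is the preimage of M under right translation by the inverse of x. Here M is any
  open set, so neighbourhoods of the identity can be translated as well as subgroups.\<close>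

lemma open_rcoset:
  assumes G: "pro2_group G" and M: "openin (topo G) M" and x: "x \<in> carrier G"
  shows "openin (topo G) (M #>\<^bsub>G\<^esub> x)"
proof -
  interpret group G using G by (rule pro2_group_is_group)
  have "M \<subseteq> carrier G" using openin_subset[OF M] by (simp add: pro2_topspace[OF G])
  have "M #>\<^bsub>G\<^esub> x = {y \<in> topspace (topo G). y \<otimes>\<^bsub>G\<^esub> inv\<^bsub>G\<^esub> x \<in> M}"
  proof -
    have "\<exists>h\<in>M. y = h \<otimes>\<^bsub>G\<^esub> x" if "y \<in> carrier G" "y \<otimes>\<^bsub>G\<^esub> inv\<^bsub>G\<^esub> x \<in> M" for y
      using that x by (intro bexI[of _ "y \<otimes>\<^bsub>G\<^esub> inv\<^bsub>G\<^esub> x"]) (auto simp: m_assoc)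
    then show ?thesis
      using x \<open>M \<subseteq> carrier G\<close> by (auto simp: r_coset_def pro2_topspace[OF G] m_assoc subset_iff)
  qed
  moreover have "continuous_map (topo G) (topo G) (\<lambda>y. y \<otimes>\<^bsub>G\<^esub> inv\<^bsub>G\<^esub> x)"
    using x by (intro continuous_map_mult[OF G]) (auto simp: pro2_topspace[OF G])
  ultimately show ?thesis using M by (simp add: openin_continuous_map_preimage)
qed

text \<open>By the tube lemma for \<open>(g, x) \<mapsto> g x g\<^sup>-\<^sup>1\<close>, the normal core of an open subgroup of a compact
  group is open.\<close>

lemma pro2_open_normal:
  assumes G: "pro2_group G" and U: "openin (topo G) U" "\<one>\<^bsub>G\<^esub> \<in> U"
  obtains N where "N \<lhd> G" "openin (topo G) N" "N \<subseteq> U"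
proof -
  interpret group G using G by (rule pro2_group_is_group)
  note [simp] = pro2_topspace[OF G]
  obtain H where H: "subgroup H G" "openin (topo G) H" "H \<subseteq> U"
    using G U unfolding pro2_group_def by blast
  interpret H: subgroup H G by fact
  \<comment> \<open>This is the intersection of all conjugates of H, written elementwise so that a
    single continuous map tests membership.\<close>
  define N where "N = {x \<in> carrier G. \<forall>g\<in>carrier G. g \<otimes>\<^bsub>G\<^esub> x \<otimes>\<^bsub>G\<^esub> inv\<^bsub>G\<^esub> g \<in> H}"
  have sub: "subgroup N G"
  proof (rule subgroupI)
    fix a b assume a: "a \<in> N" and b: "b \<in> N"
    have "g \<otimes>\<^bsub>G\<^esub> (a \<otimes>\<^bsub>G\<^esub> b) \<otimes>\<^bsub>G\<^esub> inv\<^bsub>G\<^esub> g \<in> H" if g: "g \<in> carrier G" for g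
    proof -
      have "g \<otimes>\<^bsub>G\<^esub> (a \<otimes>\<^bsub>G\<^esub> b) \<otimes>\<^bsub>G\<^esub> inv\<^bsub>G\<^esub> g = (g \<otimes>\<^bsub>G\<^esub> a \<otimes>\<^bsub>G\<^esub> inv\<^bsub>G\<^esub> g) \<otimes>\<^bsub>G\<^esub> (g \<otimes>\<^bsub>G\<^esub> b \<otimes>\<^bsub>G\<^esub> inv\<^bsub>G\<^esub> g)"
        using a b g by (simp add: N_def m_assoc inv_mult_cancel)
      then show ?thesis using a b g by (simp add: N_def)
    qed
    then show "a \<otimes>\<^bsub>G\<^esub> b \<in> N" using a b by (simp add: N_def)
  next
    fix a assume a: "a \<in> N"
    have "g \<otimes>\<^bsub>G\<^esub> inv\<^bsub>G\<^esub> a \<otimes>\<^bsub>G\<^esub> inv\<^bsub>G\<^esub> g \<in> H" if g: "g \<in> carrier G" for g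
    proof -
      have "g \<otimes>\<^bsub>G\<^esub> inv\<^bsub>G\<^esub> a \<otimes>\<^bsub>G\<^esub> inv\<^bsub>G\<^esub> g = inv\<^bsub>G\<^esub> (g \<otimes>\<^bsub>G\<^esub> a \<otimes>\<^bsub>G\<^esub> inv\<^bsub>G\<^esub> g)"
        using a g by (simp add: N_def m_assoc inv_mult_group)
      then show ?thesis using a g by (simp add: N_def)
    qed
    then show "inv\<^bsub>G\<^esub> a \<in> N" using a by (simp add: N_def)
  next
    have "\<one>\<^bsub>G\<^esub> \<in> N" by (auto simp: N_def)
    then show "N \<noteq> {}" by blast
  qed (auto simp: N_def)
  have "g \<otimes>\<^bsub>G\<^esub> x \<otimes>\<^bsub>G\<^esub> inv\<^bsub>G\<^esub> g \<in> N" if g: "g \<in> carrier G" and x: "x \<in> N" for g x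
  proof -
    have "h \<otimes>\<^bsub>G\<^esub> (g \<otimes>\<^bsub>G\<^esub> x \<otimes>\<^bsub>G\<^esub> inv\<^bsub>G\<^esub> g) \<otimes>\<^bsub>G\<^esub> inv\<^bsub>G\<^esub> h = (h \<otimes>\<^bsub>G\<^esub> g) \<otimes>\<^bsub>G\<^esub> x \<otimes>\<^bsub>G\<^esub> inv\<^bsub>G\<^esub> (h \<otimes>\<^bsub>G\<^esub> g)"
      if "h \<in> carrier G" for h
      using that g x by (simp add: N_def m_assoc inv_mult_group)
    then show ?thesis using g x by (simp add: N_def)
  qed
  with sub have normal: "N \<lhd> G" by (simp add: normal_inv_iff)
  have N_carrier: "N \<subseteq> carrier G" by (auto simp: N_def)
  have cont: "continuous_map (prod_topology (topo G) (topo G)) (topo G)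
      (\<lambda>p. fst p \<otimes>\<^bsub>G\<^esub> snd p \<otimes>\<^bsub>G\<^esub> inv\<^bsub>G\<^esub> (fst p))"
    by (intro continuous_map_mult[OF G] continuous_map_fst continuous_map_snd
        continuous_map_compose[OF continuous_map_fst pro2_continuous_inv[OF G], unfolded o_def])
  define W where "W = {p \<in> topspace (prod_topology (topo G) (topo G)).
      fst p \<otimes>\<^bsub>G\<^esub> snd p \<otimes>\<^bsub>G\<^esub> inv\<^bsub>G\<^esub> (fst p) \<in> H}"
  have "openin (prod_topology (topo G) (topo G)) W"
    unfolding W_def by (rule openin_continuous_map_preimage[OF cont H(2)])
  moreover have "compactin (topo G) (carrier G)"
    using pro2_compact[OF G] by (simp add: compact_space_def)
  \<comment> \<open>All conjugates of the identity are trivial, so the slice over it lies in W; the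
    tube runs along the compact first factor.\<close>
  moreover have "carrier G \<times> {\<one>\<^bsub>G\<^esub>} \<subseteq> W" by (auto simp: W_def)
  ultimately obtain V V' where V: "openin (topo G) V'" "\<one>\<^bsub>G\<^esub> \<in> V'" "carrier G \<subseteq> V" "V \<times> V' \<subseteq> W"
    using tube_lemma_left[of "topo G" "topo G" W "carrier G" "\<one>\<^bsub>G\<^esub>"] by auto
  have "V' \<subseteq> N"
  proof
    fix x assume x: "x \<in> V'"
    have "g \<otimes>\<^bsub>G\<^esub> x \<otimes>\<^bsub>G\<^esub> inv\<^bsub>G\<^esub> g \<in> H" if "g \<in> carrier G" for g
    proof -
      have "(g, x) \<in> W" using V(3,4) x that by blast
      then show ?thesis by (simp add: W_def)
    qed
    then show "x \<in> N" using openin_subset[OF V(1)] x by (auto simp: N_def)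
  qed
  \<comment> \<open>A subgroup containing a neighbourhood of the identity is open, being the union
    of the translates of that neighbourhood by its elements.\<close>
  have "openin (topo G) N"
  proof (subst openin_subopen, clarify)
    fix x assume x: "x \<in> N"
    have "V' #>\<^bsub>G\<^esub> x \<subseteq> N" using \<open>V' \<subseteq> N\<close> x subgroup.m_closed[OF sub] by (auto simp: r_coset_def)
    moreover have "x \<in> V' #>\<^bsub>G\<^esub> x" using V(2) x N_carrier by (force simp: r_coset_def)
    moreover have "openin (topo G) (V' #>\<^bsub>G\<^esub> x)" using open_rcoset[OF G V(1)] x N_carrier by auto
    ultimately show "\<exists>T. openin (topo G) T \<and> x \<in> T \<and> T \<subseteq> N" by blast
  qed
  moreover have "N \<subseteq> H"
  proof
    fix x assume "x \<in> N"
    then have "x \<in> carrier G" "\<one>\<^bsub>G\<^esub> \<otimes>\<^bsub>G\<^esub> x \<otimes>\<^bsub>G\<^esub> inv\<^bsub>G\<^esub> \<one>\<^bsub>G\<^esub> \<in> H"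
      unfolding N_def using one_closed by blast+
    then show "x \<in> H" by simp
  qed
  ultimately show ?thesis using that normal H(3) by blast
qed

text \<open>Right translation moves \<open>pro2_open_normal\<close> from the identity to x. Together
  with \<open>pro2_index\<close> and \<open>open_rcoset\<close> this recovers the hypothesis
  \<open>base\<close> of \<open>pro2I\<close> from a given pro-2 group.\<close>

lemma pro2_coset_base:
  assumes G: "pro2_group G" and U: "openin (topo G) U" "x \<in> U"
  obtains N where "N \<lhd> G" "openin (topo G) N" "N #>\<^bsub>G\<^esub> x \<subseteq> U"
proof -
  interpret group G using G by (rule pro2_group_is_group)
  note [simp] = pro2_topspace[OF G]
  have U': "U \<subseteq> carrier G" using openin_subset[OF U(1)] by simp
  then have x: "x \<in> carrier G" using U by blast
  have "openin (topo G) (U #>\<^bsub>G\<^esub> inv\<^bsub>G\<^esub> x)" using G U(1) x by (intro open_rcoset) auto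
  moreover have "\<one>\<^bsub>G\<^esub> \<in> U #>\<^bsub>G\<^esub> inv\<^bsub>G\<^esub> x" using x U(2) by (force simp: r_coset_def)
  ultimately obtain N where N: "N \<lhd> G" "openin (topo G) N" "N \<subseteq> U #>\<^bsub>G\<^esub> inv\<^bsub>G\<^esub> x"
    by (rule pro2_open_normal[OF G])
  have "N #>\<^bsub>G\<^esub> x \<subseteq> U"
  proof
    fix y assume "y \<in> N #>\<^bsub>G\<^esub> x"
    then obtain u where u: "u \<in> U" "y = u \<otimes>\<^bsub>G\<^esub> inv\<^bsub>G\<^esub> x \<otimes>\<^bsub>G\<^esub> x"
      using N(3) by (auto simp: r_coset_def)
    then have "y = u" using U' x by (auto simp: m_assoc subset_iff)
    then show "y \<in> U" using u by simp
  qed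
  then show ?thesis using that N by blast
qed

text \<open>The Hausdorff property yields a neighbourhood of the identity that misses x, and this
  contains an open normal subgroup. So elements can be told apart in the finite quotients.\<close>

lemma pro2_separated:
  assumes G: "pro2_group G" and x: "x \<in> carrier G" and "\<And>N. N \<lhd> G \<Longrightarrow> openin (topo G) N \<Longrightarrow> x \<in> N"
  shows "x = \<one>\<^bsub>G\<^esub>"
proof (rule ccontr)
  interpret group G using G by (rule pro2_group_is_group)
  assume "x \<noteq> \<one>\<^bsub>G\<^esub>"
  then obtain U where "openin (topo G) U" "\<one>\<^bsub>G\<^esub> \<in> U" "x \<notin> U"
    using x pro2_Hausdorff[OF G] unfolding Hausdorff_space_def pro2_topspace[OF G] disjnt_def
    by (metis Int_iff empty_iff one_closed)
  then show False using pro2_open_normal[OF G] assms(3) by blast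
qed

section \<open>Free pro-2 groups\<close>

lemma
  assumes "a \<in> free_pro2_index d"
  shows free_pro2_index_group: "group (fst a)"
    and free_pro2_index_order: "\<exists>k. order (fst a) = 2 ^ k"
    and free_pro2_index_finite: "finite (carrier (fst a))"
    and free_pro2_index_gen: "i \<in> {1..d} \<Longrightarrow> snd a i \<in> carrier (fst a)"
proof -
  show 1: "group (fst a)" and 2: "\<exists>k. order (fst a) = 2 ^ k"
    using assms by (auto simp: free_pro2_index_def)
  \<comment> \<open>\<open>card\<close> of an infinite set is 0, and 0 is not a power of 2.\<close>
  show "finite (carrier (fst a))"
    using 2 by (auto simp: order_def intro!: card_ge_0_finite)
  show "i \<in> {1..d} \<Longrightarrow> snd a i \<in> carrier (fst a)"
    using assms by (auto simp: free_pro2_index_def)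
qed

lemma group_free_pro2_ambient: "group (free_pro2_ambient d)"
  by (simp add: free_pro2_ambient_def free_pro2_index_group)

lemma free_pro2_gen_ambient: "free_pro2_gen d ` {1..d} \<subseteq> carrier (free_pro2_ambient d)"
  by (force simp: free_pro2_gen_def free_pro2_ambient_def dest: free_pro2_index_gen)

lemma openin_free_pro2_cylinder:
  assumes "finite J"
  shows "openin (free_pro2_ambient_topology d)
    {y \<in> carrier (free_pro2_ambient d). \<forall>a\<in>J \<inter> free_pro2_index d. y a = x a}"
  unfolding free_pro2_ambient_topology_def openin_product_topology_alt
proof
  fix y assume y: "y \<in> {y \<in> carrier (free_pro2_ambient d). \<forall>a\<in>J \<inter> free_pro2_index d. y a = x a}"
  \<comment> \<open>The box is centred at y rather than x, because x is not assumed to lie in the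
    product; on the indices in J both have the same coordinates.\<close>
  define U where "U a = (if a \<in> J then {y a} else carrier (fst a))" for a :: "nat monoid \<times> (nat \<Rightarrow> nat)"
  have yA: "y a \<in> carrier (fst a)" if "a \<in> free_pro2_index d" for a
    using y that by (simp add: free_pro2_ambient_def PiE_iff)
  have "finite {a \<in> free_pro2_index d. U a \<noteq> topspace (discrete_topology (carrier (fst a)))}"
    by (rule finite_subset[OF _ assms]) (auto simp: U_def)
  moreover have "\<forall>a\<in>free_pro2_index d. openin (discrete_topology (carrier (fst a))) (U a)"
    using yA by (simp add: U_def)
  moreover have "y \<in> Pi\<^sub>E (free_pro2_index d) U"
    using y yA by (simp add: U_def free_pro2_ambient_def PiE_iff)
  moreover have "Pi\<^sub>E (free_pro2_index d) U \<subseteq>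
      {y \<in> carrier (free_pro2_ambient d). \<forall>a\<in>J \<inter> free_pro2_index d. y a = x a}"
  proof
    fix v assume v: "v \<in> Pi\<^sub>E (free_pro2_index d) U"
    have "v a = y a" if "a \<in> J \<inter> free_pro2_index d" for a
      using PiE_mem[OF v, of a] that by (simp add: U_def)
    moreover have "v a \<in> carrier (fst a)" if "a \<in> free_pro2_index d" for a
      using PiE_mem[OF v, of a] yA that by (auto simp: U_def split: if_splits)
    ultimately show "v \<in> {y \<in> carrier (free_pro2_ambient d). \<forall>a\<in>J \<inter> free_pro2_index d. y a = x a}"
      using v y by (simp add: free_pro2_ambient_def PiE_iff)
  qed
  ultimately show "\<exists>U. finite {i \<in> free_pro2_index d. U i \<noteq> topspace (discrete_topology (carrier (fst i)))} \<and>
      (\<forall>i\<in>free_pro2_index d. openin (discrete_topology (carrier (fst i))) (U i)) \<and>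
      y \<in> Pi\<^sub>E (free_pro2_index d) U \<and> Pi\<^sub>E (free_pro2_index d) U \<subseteq>
      {y \<in> carrier (free_pro2_ambient d). \<forall>a\<in>J \<inter> free_pro2_index d. y a = x a}" by blast
qed

text \<open>A basic open box around x restricts only finitely many coordinates, and fixing exactly
  these to the coordinates of x stays inside the box.\<close>

lemma free_pro2_ambient_cylinder_base:
  assumes "openin (free_pro2_ambient_topology d) U" "x \<in> U"
  obtains J where "finite J" "J \<subseteq> free_pro2_index d"
    "{y \<in> carrier (free_pro2_ambient d). \<forall>a\<in>J. y a = x a} \<subseteq> U"
proof -
  obtain V where V: "finite {a \<in> free_pro2_index d. V a \<noteq> carrier (fst a)}"
    "x \<in> Pi\<^sub>E (free_pro2_index d) V" "Pi\<^sub>E (free_pro2_index d) V \<subseteq> U"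
    using assms unfolding free_pro2_ambient_topology_def openin_product_topology_alt by fastforce
  have "{y \<in> carrier (free_pro2_ambient d).
      \<forall>a\<in>{a \<in> free_pro2_index d. V a \<noteq> carrier (fst a)}. y a = x a} \<subseteq> Pi\<^sub>E (free_pro2_index d) V"
  proof
    fix y assume y: "y \<in> {y \<in> carrier (free_pro2_ambient d).
      \<forall>a\<in>{a \<in> free_pro2_index d. V a \<noteq> carrier (fst a)}. y a = x a}"
    have "y a \<in> V a" if a: "a \<in> free_pro2_index d" for a
    proof (cases "V a = carrier (fst a)")
      case True
      then show ?thesis using y a by (auto simp: free_pro2_ambient_def)
    next
      case False
      then have "y a = x a" using y a by blast
      then show ?thesis using PiE_mem[OF V(2) a] by simp
    qed
    then show "y \<in> Pi\<^sub>E (free_pro2_index d) V" using y by (auto simp: free_pro2_ambient_def PiE_iff)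
  qed
  then show thesis using that[of "{a \<in> free_pro2_index d. V a \<noteq> carrier (fst a)}"] V by blast
qed

lemma topspace_free_pro2_ambient:
  "topspace (free_pro2_ambient_topology d) = carrier (free_pro2_ambient d)"
  by (simp add: free_pro2_ambient_topology_def free_pro2_ambient_def)

text \<open>Cylinders over finitely many coordinates form a neighbourhood base, so membership in the
  closure becomes a condition of finite approximation by words in the generators. Closure under the
  operations and the existence of homomorphisms are both derived from this form.\<close>

lemma mem_free_pro2_carrier:
  "x \<in> free_pro2_carrier d \<longleftrightarrow> x \<in> carrier (free_pro2_ambient d) \<and>
     (\<forall>J. finite J \<and> J \<subseteq> free_pro2_index d \<longrightarrow>
        (\<exists>y\<in>generate (free_pro2_ambient d) (free_pro2_gen d ` {1..d}). \<forall>a\<in>J. y a = x a))"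
  (is "_ \<longleftrightarrow> ?R")
proof
  assume x: "x \<in> free_pro2_carrier d"
  then have xA: "x \<in> carrier (free_pro2_ambient d)"
    unfolding free_pro2_carrier_def in_closure_of topspace_free_pro2_ambient by blast
  moreover have "\<exists>y\<in>generate (free_pro2_ambient d) (free_pro2_gen d ` {1..d}). \<forall>a\<in>J. y a = x a"
    if J: "finite J" "J \<subseteq> free_pro2_index d" for J
  proof -
    let ?T = "{y \<in> carrier (free_pro2_ambient d). \<forall>a\<in>J \<inter> free_pro2_index d. y a = x a}"
    have "x \<in> ?T" using xA by simp
    then obtain y where "y \<in> generate (free_pro2_ambient d) (free_pro2_gen d ` {1..d})" "y \<in> ?T"
      using x openin_free_pro2_cylinder[OF J(1), of d x]
      unfolding free_pro2_carrier_def in_closure_of by meson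
    then show ?thesis using J(2) by (intro bexI[of _ y]) auto
  qed
  ultimately show ?R by blast
next
  assume R: ?R
  have "\<exists>y. y \<in> generate (free_pro2_ambient d) (free_pro2_gen d ` {1..d}) \<and> y \<in> T"
    if T: "openin (free_pro2_ambient_topology d) T" "x \<in> T" for T
  proof -
    obtain J where J: "finite J" "J \<subseteq> free_pro2_index d"
      "{y \<in> carrier (free_pro2_ambient d). \<forall>a\<in>J. y a = x a} \<subseteq> T"
      using free_pro2_ambient_cylinder_base[OF T] by blast
    then obtain y where y: "y \<in> generate (free_pro2_ambient d) (free_pro2_gen d ` {1..d})"
      "\<forall>a\<in>J. y a = x a" using R by blast
    moreover have "y \<in> carrier (free_pro2_ambient d)"
      using group.generate_in_carrier[OF group_free_pro2_ambient free_pro2_gen_ambient y(1)] .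
    ultimately show ?thesis using J(3) by blast
  qed
  then show "x \<in> free_pro2_carrier d"
    using R unfolding free_pro2_carrier_def in_closure_of topspace_free_pro2_ambient by blast
qed

lemma free_pro2_generate: "generate (free_pro2_ambient d) (free_pro2_gen d ` {1..d}) \<subseteq> free_pro2_carrier d"
  using closure_of_subset[of _ "free_pro2_ambient_topology d"]
    group.generate_incl[OF group_free_pro2_ambient free_pro2_gen_ambient]
  by (simp add: free_pro2_carrier_def topspace_free_pro2_ambient)

text \<open>Operations are coordinatewise, so words approximating two elements on J multiply to a
  word approximating their product on J, and likewise for inverses.\<close>

lemma subgroup_free_pro2: "subgroup (free_pro2_carrier d) (free_pro2_ambient d)"
proof -
  let ?A = "free_pro2_ambient d" and ?S = "generate (free_pro2_ambient d) (free_pro2_gen d ` {1..d})"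
  interpret group ?A by (rule group_free_pro2_ambient)
  note gen = generate_in_carrier[OF free_pro2_gen_ambient]
  have mult: "(x \<otimes>\<^bsub>?A\<^esub> y) a = x a \<otimes>\<^bsub>fst a\<^esub> y a" if "a \<in> free_pro2_index d" for x y a
    using that by (simp add: free_pro2_ambient_def)
  have inv: "(inv\<^bsub>?A\<^esub> x) a = inv\<^bsub>fst a\<^esub> (x a)" if "a \<in> free_pro2_index d" "x \<in> carrier ?A" for x a
    using that by (simp add: free_pro2_ambient_def free_pro2_index_group)
  show ?thesis
  proof (rule subgroupI)
    show "free_pro2_carrier d \<subseteq> carrier ?A" by (auto simp: mem_free_pro2_carrier)
    show "free_pro2_carrier d \<noteq> {}" using free_pro2_generate generate.one by blast
  next
    fix x assume x: "x \<in> free_pro2_carrier d"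
    then have xA: "x \<in> carrier ?A" by (simp add: mem_free_pro2_carrier)
    have "\<exists>y\<in>?S. \<forall>a\<in>J. y a = (inv\<^bsub>?A\<^esub> x) a" if J: "finite J" "J \<subseteq> free_pro2_index d" for J
    proof -
      obtain y where y: "y \<in> ?S" "\<forall>a\<in>J. y a = x a"
        using x J unfolding mem_free_pro2_carrier by blast
      have "inv\<^bsub>?A\<^esub> y \<in> ?S" by (rule generate_m_inv_closed[OF free_pro2_gen_ambient y(1)])
      then show ?thesis using y J(2) inv xA gen by (intro bexI[of _ "inv\<^bsub>?A\<^esub> y"]) auto
    qed
    then show "inv\<^bsub>?A\<^esub> x \<in> free_pro2_carrier d" using xA by (simp add: mem_free_pro2_carrier)
  next
    fix x x' assume x: "x \<in> free_pro2_carrier d" and x': "x' \<in> free_pro2_carrier d"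
    then have xA: "x \<in> carrier ?A" "x' \<in> carrier ?A" by (auto simp: mem_free_pro2_carrier)
    have "\<exists>y\<in>?S. \<forall>a\<in>J. y a = (x \<otimes>\<^bsub>?A\<^esub> x') a" if J: "finite J" "J \<subseteq> free_pro2_index d" for J
    proof -
      obtain y y' where y: "y \<in> ?S" "\<forall>a\<in>J. y a = x a" "y' \<in> ?S" "\<forall>a\<in>J. y' a = x' a"
        using x x' J unfolding mem_free_pro2_carrier by meson
      then show ?thesis using J(2) mult by (intro bexI[of _ "y \<otimes>\<^bsub>?A\<^esub> y'"] generate.eng) auto
    qed
    then show "x \<otimes>\<^bsub>?A\<^esub> x' \<in> free_pro2_carrier d" using xA by (simp add: mem_free_pro2_carrier)
  qed
qed

section \<open>The free pro-2 group is pro-2\<close>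

lemma
  shows carrier_free_pro2: "carrier (free_pro2 d) = free_pro2_carrier d"
    and mult_free_pro2: "mult (free_pro2 d) = mult (free_pro2_ambient d)"
    and one_free_pro2: "one (free_pro2 d) = one (free_pro2_ambient d)"
    and topo_free_pro2: "topo (free_pro2 d) =
      subtopology (free_pro2_ambient_topology d) (free_pro2_carrier d)"
  by (simp_all add: free_pro2_def)

lemma group_free_pro2: "group (free_pro2 d)"
proof -
  interpret A: group "free_pro2_ambient d" by (rule group_free_pro2_ambient)
  interpret S: subgroup "free_pro2_carrier d" "free_pro2_ambient d" by (rule subgroup_free_pro2)
  show ?thesis
    by (rule groupI) (auto simp: carrier_free_pro2 mult_free_pro2 one_free_pro2 A.m_assoc
        intro!: bexI[of _ "inv\<^bsub>free_pro2_ambient d\<^esub> _"])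
qed

lemma inv_free_pro2:
  assumes "x \<in> carrier (free_pro2 d)"
  shows "inv\<^bsub>free_pro2 d\<^esub> x = inv\<^bsub>free_pro2_ambient d\<^esub> x"
proof -
  interpret A: group "free_pro2_ambient d" by (rule group_free_pro2_ambient)
  interpret S: subgroup "free_pro2_carrier d" "free_pro2_ambient d" by (rule subgroup_free_pro2)
  show ?thesis
    by (rule group.inv_equality[OF group_free_pro2])
      (use assms in \<open>auto simp: carrier_free_pro2 mult_free_pro2 one_free_pro2\<close>)
qed

lemma free_pro2_eval_hom:
  assumes "a \<in> free_pro2_index d"
  shows "(\<lambda>x. x a) \<in> hom (free_pro2 d) (fst a)"
  using assms subgroup.subset[OF subgroup_free_pro2]
  by (fastforce simp: hom_def carrier_free_pro2 mult_free_pro2 free_pro2_ambient_def)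

lemma free_pro2_gen_closed: "i \<in> {1..d} \<Longrightarrow> free_pro2_gen d i \<in> carrier (free_pro2 d)"
  unfolding carrier_free_pro2 by (rule subsetD[OF free_pro2_generate generate.incl]) simp

lemma topspace_free_pro2: "topspace (topo (free_pro2 d)) = carrier (free_pro2 d)"
  using subgroup.subset[OF subgroup_free_pro2, of d]
  by (auto simp: topo_free_pro2 carrier_free_pro2 topspace_free_pro2_ambient)

lemma free_pro2_cylinder_base:
  assumes "openin (topo (free_pro2 d)) U" "x \<in> U"
  obtains J where "finite J" "J \<subseteq> free_pro2_index d"
    "{y \<in> carrier (free_pro2 d). \<forall>a\<in>J. y a = x a} \<subseteq> U"
proof -
  obtain V where V: "openin (free_pro2_ambient_topology d) V" "U = V \<inter> free_pro2_carrier d"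
    using assms(1) by (auto simp: topo_free_pro2 openin_subtopology)
  obtain J where "finite J" "J \<subseteq> free_pro2_index d"
    "{y \<in> carrier (free_pro2_ambient d). \<forall>a\<in>J. y a = x a} \<subseteq> V"
    using free_pro2_ambient_cylinder_base[OF V(1), of x] assms(2) V(2) by blast
  then show thesis
    using that[of J] V(2) subgroup.subset[OF subgroup_free_pro2, of d] by (auto simp: carrier_free_pro2)
qed

lemma openin_free_pro2:
  assumes "finite J" "J \<subseteq> free_pro2_index d"
  shows "openin (topo (free_pro2 d)) {y \<in> carrier (free_pro2 d). \<forall>a\<in>J. y a = x a}"
proof -
  have "{y \<in> carrier (free_pro2 d). \<forall>a\<in>J. y a = x a} =
      {y \<in> carrier (free_pro2_ambient d). \<forall>a\<in>J \<inter> free_pro2_index d. y a = x a} \<inter> free_pro2_carrier d"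
    using assms(2) subgroup.subset[OF subgroup_free_pro2, of d] by (auto simp: carrier_free_pro2)
  then show ?thesis
    using openin_free_pro2_cylinder[OF assms(1), of d x] by (simp add: topo_free_pro2 openin_subtopology) blast
qed

text \<open>The base subgroups are the kernels of the restrictions to finite sets J of coordinates.
  Their cosets are the cylinders over J, and their index divides the order of a finite product of
  2-groups.\<close>

lemma pro2_free_pro2: "pro2_group (free_pro2 d)"
proof (rule pro2I)
  show grp: "group (free_pro2 d)" by (rule group_free_pro2)
  interpret group "free_pro2 d" by fact
  show "topspace (topo (free_pro2 d)) = carrier (free_pro2 d)" by (rule topspace_free_pro2)
  have "compact_space (free_pro2_ambient_topology d)"
    by (auto simp: free_pro2_ambient_topology_def compact_space_product_topology
        compact_space_discrete_topology free_pro2_index_finite)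
  then have "compactin (free_pro2_ambient_topology d) (free_pro2_carrier d)"
    by (simp add: closedin_compact_space free_pro2_carrier_def)
  then show "compact_space (topo (free_pro2 d))"
    by (simp add: topo_free_pro2 compact_space_subtopology)
  show "Hausdorff_space (topo (free_pro2 d))"
    by (simp add: topo_free_pro2 free_pro2_ambient_topology_def Hausdorff_space_subtopology
        Hausdorff_space_product_topology)
  fix U x assume U: "openin (topo (free_pro2 d)) U" "x \<in> U"
  have x: "x \<in> carrier (free_pro2 d)" using openin_subset[OF U(1)] U(2) by (auto simp: topspace_free_pro2)
  obtain J where J: "finite J" "J \<subseteq> free_pro2_index d"
    "{y \<in> carrier (free_pro2 d). \<forall>a\<in>J. y a = x a} \<subseteq> U"
    using free_pro2_cylinder_base[OF U] .
  define P where "P = product_group J (fst :: nat monoid \<times> (nat \<Rightarrow> nat) \<Rightarrow> nat monoid)"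
  have grpJ: "group (fst a)" if "a \<in> J" for a using that J(2) free_pro2_index_group by blast
  interpret h: group_hom "free_pro2 d" P "\<lambda>x. restrict x J"
  proof (intro group_hom.intro group_hom_axioms.intro grp)
    show "group P" using grpJ by (simp add: P_def)
    show "(\<lambda>x. restrict x J) \<in> hom (free_pro2 d) P"
    proof (rule homI)
      fix v w assume v: "v \<in> carrier (free_pro2 d)" and w: "w \<in> carrier (free_pro2 d)"
      show "restrict v J \<in> carrier P"
        unfolding P_def carrier_product_group
        using v J(2) hom_in_carrier[OF free_pro2_eval_hom] by (intro restrict_PiE_iff[THEN iffD2]) blast
      show "restrict (v \<otimes>\<^bsub>free_pro2 d\<^esub> w) J = restrict v J \<otimes>\<^bsub>P\<^esub> restrict w J"
        using v w J(2) hom_mult[OF free_pro2_eval_hom]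
        by (auto simp: P_def subset_iff intro!: restrict_ext)
    qed
  qed
  define M where "M = kernel (free_pro2 d) P (\<lambda>x. restrict x J)"
  have M: "M \<lhd> free_pro2 d" unfolding M_def by (rule h.normal_kernel)
  have coset: "M #>\<^bsub>free_pro2 d\<^esub> y = {w \<in> carrier (free_pro2 d). \<forall>a\<in>J. w a = y a}"
    if y: "y \<in> carrier (free_pro2 d)" for y
  proof -
    have "w \<in> M #>\<^bsub>free_pro2 d\<^esub> y \<longleftrightarrow> (\<forall>a\<in>J. w a = y a)" if w: "w \<in> carrier (free_pro2 d)" for w
    proof -
      have "w \<in> M #>\<^bsub>free_pro2 d\<^esub> y \<longleftrightarrow> w \<otimes>\<^bsub>free_pro2 d\<^esub> inv\<^bsub>free_pro2 d\<^esub> y \<in> M"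
        by (rule subgroup.rcos_module[OF _ is_group y w]) (use M in \<open>simp add: normal_def\<close>)
      also have "\<dots> \<longleftrightarrow> restrict w J = restrict y J"
      proof -
        have "restrict (w \<otimes>\<^bsub>free_pro2 d\<^esub> inv\<^bsub>free_pro2 d\<^esub> y) J = restrict w J \<otimes>\<^bsub>P\<^esub> inv\<^bsub>P\<^esub> restrict y J"
          using w y by simp
        then show ?thesis
          using w y h.H.inv_solve_right'[of "\<one>\<^bsub>P\<^esub>" "restrict w J" "restrict y J"]
          by (auto simp: M_def kernel_def)
      qed
      finally show ?thesis by (auto simp: restrict_def fun_eq_iff)
    qed
    then show ?thesis using r_coset_subset_G[of M y] M y by (auto simp: M_def kernel_def)
  qed
  obtain k where k: "order P = 2 ^ k"
  proof -
    have "\<forall>a\<in>J. \<exists>k. card (carrier (fst a)) = 2 ^ k"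
      using free_pro2_index_order J(2) by (auto simp: order_def)
    then obtain e where "\<And>a. a \<in> J \<Longrightarrow> card (carrier (fst a)) = 2 ^ e a" by metis
    then have "order P = 2 ^ (\<Sum>a\<in>J. e a)"
      using J(1) by (simp add: order_def P_def card_PiE power_sum)
    then show thesis by (rule that)
  qed
  then obtain k' where "card (rcosets\<^bsub>free_pro2 d\<^esub> M) = 2 ^ k'"
    using h.card_rcosets_kernel_dvd power2_dvd by (metis M_def)
  moreover have "\<forall>y\<in>carrier (free_pro2 d). openin (topo (free_pro2 d)) (M #>\<^bsub>free_pro2 d\<^esub> y)"
    using coset openin_free_pro2[OF J(1,2)] by simp
  ultimately show "\<exists>M k. M \<lhd> free_pro2 d \<and> card (rcosets\<^bsub>free_pro2 d\<^esub> M) = 2 ^ k \<and>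
      M #>\<^bsub>free_pro2 d\<^esub> x \<subseteq> U \<and> (\<forall>y\<in>carrier (free_pro2 d). openin (topo (free_pro2 d)) (M #>\<^bsub>free_pro2 d\<^esub> y))"
    using M coset[OF x] J(3) by blast
qed

section \<open>Continuous homomorphisms\<close>

lemma cont_hom_group_hom:
  assumes "f \<in> cont_hom G H" "group G" "group H"
  shows "group_hom G H f"
  using assms by (simp add: group_hom_def group_hom_axioms_def cont_hom_def)

lemma cont_homD: "f \<in> cont_hom G H \<Longrightarrow> f \<in> hom G H" "f \<in> cont_hom G H \<Longrightarrow> continuous_map (topo G) (topo H) f"
  by (simp_all add: cont_hom_def)

lemma cont_hom_closed: "f \<in> cont_hom G H \<Longrightarrow> x \<in> carrier G \<Longrightarrow> f x \<in> carrier H"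
  by (auto simp: cont_hom_def hom_def)

lemma cont_hom_mult:
  "f \<in> cont_hom G H \<Longrightarrow> x \<in> carrier G \<Longrightarrow> y \<in> carrier G \<Longrightarrow> f (x \<otimes>\<^bsub>G\<^esub> y) = f x \<otimes>\<^bsub>H\<^esub> f y"
  by (auto simp: cont_hom_def hom_def)

lemma cont_hom_one:
  "f \<in> cont_hom G H \<Longrightarrow> group G \<Longrightarrow> group H \<Longrightarrow> f \<one>\<^bsub>G\<^esub> = \<one>\<^bsub>H\<^esub>"
  by (metis cont_hom_group_hom group_hom.hom_one)

lemma cont_hom_inv:
  "f \<in> cont_hom G H \<Longrightarrow> group G \<Longrightarrow> group H \<Longrightarrow> x \<in> carrier G \<Longrightarrow> f (inv\<^bsub>G\<^esub> x) = inv\<^bsub>H\<^esub> (f x)"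
  by (metis cont_hom_group_hom group_hom.hom_inv)

lemma cont_hom_compose:
  assumes f: "f \<in> cont_hom G H" and g: "g \<in> cont_hom H K"
  shows "(\<lambda>x. g (f x)) \<in> cont_hom G K"
  using continuous_map_compose[OF cont_homD(2)[OF f] cont_homD(2)[OF g]]
    cont_hom_closed[OF f] cont_hom_mult[OF f] cont_hom_closed[OF g] cont_hom_mult[OF g]
  by (auto simp: cont_hom_def o_def intro!: homI)

lemma cont_hom_cong:
  assumes "group G" "topspace (topo G) = carrier G" "f \<in> cont_hom G H" "\<And>x. x \<in> carrier G \<Longrightarrow> g x = f x"
  shows "g \<in> cont_hom G H"
proof -
  interpret group G by fact
  show ?thesis
    using assms continuous_map_eq[of "topo G" "topo H" f g] by (auto simp: cont_hom_def hom_def)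
qed

section \<open>Universal property of the free pro-2 group\<close>

text \<open>K/N has 2-power order, so an injection into \<open>nat\<close> turns it into a group
  occurring in the index set, whatever the element type of K; the second component of the index
  records the images of the k i. The last clause makes the fibres of p the cosets of N, so K/N can
  be used without being named.\<close>

lemma free_pro2_finite_quotient:
  assumes K: "pro2_group K" and N: "N \<lhd> K" "openin (topo K) N" and k: "\<And>i. i \<in> {1..d} \<Longrightarrow> k i \<in> carrier K"
  shows "\<exists>a p. a \<in> free_pro2_index d \<and> p \<in> hom K (fst a) \<and> (\<forall>i\<in>{1..d}. snd a i = p (k i)) \<and>
    (\<forall>x\<in>carrier K. \<forall>y\<in>carrier K. p x = p y \<longleftrightarrow> N #>\<^bsub>K\<^esub> x = N #>\<^bsub>K\<^esub> y)"
proof -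
  interpret K: group K using K by (rule pro2_group_is_group)
  interpret N: normal N K by fact
  obtain e where e: "card (rcosets\<^bsub>K\<^esub> N) = 2 ^ e" using pro2_index[OF K N] by blast
  then have "finite (carrier (K Mod N))" by (auto simp: FactGroup_def intro!: card_ge_0_finite)
  then obtain \<beta> :: "'a set \<Rightarrow> nat" where \<beta>: "inj_on \<beta> (carrier (K Mod N))"
    using finite_imp_inj_to_nat_seg by blast
  define H where "H = image_group \<beta> (K Mod N)"
  define p where "p x = \<beta> (N #>\<^bsub>K\<^esub> x)" for x
  have H: "group H" unfolding H_def
    by (rule group.inj_imp_image_group_is_group[OF N.factorgroup_is_group \<beta>])
  have "\<beta> \<in> hom (K Mod N) H" unfolding H_def
    using inj_imp_image_group_iso[OF \<beta>] by (simp add: iso_def)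
  then have p: "p \<in> hom K H"
    using hom_compose[OF N.r_coset_hom_Mod] by (auto simp: p_def[abs_def] o_def)
  have "order H = 2 ^ e"
    using e card_image[OF \<beta>] by (simp add: order_def H_def image_group_carrier FactGroup_def)
  then have "(H, \<lambda>i\<in>{1..d}. p (k i)) \<in> free_pro2_index d"
    using H hom_in_carrier[OF p] k by (auto simp: free_pro2_index_def)
  moreover have "p x = p y \<longleftrightarrow> N #>\<^bsub>K\<^esub> x = N #>\<^bsub>K\<^esub> y" if "x \<in> carrier K" "y \<in> carrier K" for x y
    using inj_on_eq_iff[OF \<beta>] that by (auto simp: p_def carrier_FactGroup)
  ultimately show ?thesis using p by (intro exI[of _ "(H, \<lambda>i\<in>{1..d}. p (k i))"] exI[of _ p]) auto
qed

text \<open>Both groups have the same operations on the smaller carrier. Density is phrased in the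
  ambient product, whereas inductions over words take place in \<open>free_pro2 d\<close>; this
  equality connects the two.\<close>

lemma generate_free_pro2:
  "generate (free_pro2_ambient d) (free_pro2_gen d ` {1..d}) = generate (free_pro2 d) (free_pro2_gen d ` {1..d})"
  (is "?A = ?F")
proof
  have gens: "free_pro2_gen d ` {1..d} \<subseteq> carrier (free_pro2 d)" using free_pro2_gen_closed by blast
  show "?A \<subseteq> ?F"
  proof
    fix x assume "x \<in> ?A" then show "x \<in> ?F"
    proof induction
      case one
      show ?case unfolding one_free_pro2[symmetric] by (rule generate.one)
    next
      case (incl h)
      then show ?case by (rule generate.incl)
    next
      case (inv h)
      then show ?case unfolding inv_free_pro2[OF subsetD[OF gens inv], symmetric] by (rule generate.inv)
    next
      case (eng x y)
      then show ?case unfolding mult_free_pro2[symmetric] by (intro generate.eng)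
    qed
  qed
  show "?F \<subseteq> ?A"
  proof
    fix x assume "x \<in> ?F" then show "x \<in> ?A"
    proof induction
      case one
      show ?case unfolding one_free_pro2 by (rule generate.one)
    next
      case (incl h)
      then show ?case by (rule generate.incl)
    next
      case (inv h)
      then show ?case unfolding inv_free_pro2[OF subsetD[OF gens inv]] by (rule generate.inv)
    next
      case (eng x y)
      then show ?case unfolding mult_free_pro2 by (intro generate.eng)
    qed
  qed
qed

text \<open>The value at \<open>x\<close> of the homomorphism with \<open>x\<^sub>i \<mapsto> k i\<close> is the unique element whose image in
  each finite quotient \<open>K/N\<close> is the component of \<open>x\<close> belonging to that quotient; it exists by
  compactness of \<open>K\<close>.\<close>

lemma free_pro2_universal:
  assumes K: "pro2_group K" and k: "\<And>i. i \<in> {1..d} \<Longrightarrow> k i \<in> carrier K"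
  shows "\<exists>\<phi>\<in>cont_hom (free_pro2 d) K. \<forall>i\<in>{1..d}. \<phi> (free_pro2_gen d i) = k i"
proof -
  let ?F = "free_pro2 d"
  interpret K: group K using K by (rule pro2_group_is_group)
  interpret F: group ?F by (rule group_free_pro2)
  define ON where "ON = {N. N \<lhd> K \<and> openin (topo K) N}"
  define Q where "Q N a p \<longleftrightarrow> a \<in> free_pro2_index d \<and> p \<in> hom K (fst a) \<and> (\<forall>i\<in>{1..d}. snd a i = p (k i)) \<and>
      (\<forall>x\<in>carrier K. \<forall>y\<in>carrier K. p x = p y \<longleftrightarrow> N #>\<^bsub>K\<^esub> x = N #>\<^bsub>K\<^esub> y)" for N a p
  have "\<exists>a p. Q N a p" if N: "N \<in> ON" for N
    using free_pro2_finite_quotient[OF K _ _ k, of N] N unfolding ON_def Q_def by simp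
  then obtain a p where Q: "\<And>N. N \<in> ON \<Longrightarrow> Q N (a N) (p N)" by metis
  have a: "\<And>N. N \<in> ON \<Longrightarrow> a N \<in> free_pro2_index d"
    and p: "\<And>N. N \<in> ON \<Longrightarrow> p N \<in> hom K (fst (a N))"
    and ap: "\<And>N i. N \<in> ON \<Longrightarrow> i \<in> {1..d} \<Longrightarrow> snd (a N) i = p N (k i)"
    and inj: "\<And>N x y. N \<in> ON \<Longrightarrow> x \<in> carrier K \<Longrightarrow> y \<in> carrier K \<Longrightarrow>
      p N x = p N y \<longleftrightarrow> N #>\<^bsub>K\<^esub> x = N #>\<^bsub>K\<^esub> y"
    using Q unfolding Q_def by blast+
  have e_hom: "group_hom ?F (fst (a N)) (\<lambda>x. x (a N))" if "N \<in> ON" for N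
    using free_pro2_eval_hom[OF a[OF that]] free_pro2_index_group[OF a[OF that]]
    by (simp add: group_hom_def group_hom_axioms_def group_free_pro2)
  have p_hom: "group_hom K (fst (a N)) (p N)" if "N \<in> ON" for N
    using p[OF that] free_pro2_index_group[OF a[OF that]]
    by (simp add: group_hom_def group_hom_axioms_def K.is_group)
  \<comment> \<open>The graph of the homomorphism to be built: \<open>a N\<close> is the coordinate
    belonging to K/N and \<open>p N\<close> the projection to it. Since the relation respects the
    operations, every word in the generators has a value.\<close>
  define R where "R x c \<longleftrightarrow> x \<in> carrier ?F \<and> c \<in> carrier K \<and> (\<forall>N\<in>ON. x (a N) = p N c)" for x c
  \<comment> \<open>Two values of x agree in every K/N, so their quotient lies in every open normal
    subgroup.\<close>
  have R_unique: "c = c'" if c: "R x c" "R x c'" for x c c'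
  proof -
    have cK: "c \<in> carrier K" "c' \<in> carrier K" using c by (auto simp: R_def)
    have "c \<otimes>\<^bsub>K\<^esub> inv\<^bsub>K\<^esub> c' \<in> N" if N: "N \<lhd> K" "openin (topo K) N" for N
    proof -
      have "N \<in> ON" using N by (simp add: ON_def)
      then have "N #>\<^bsub>K\<^esub> c = N #>\<^bsub>K\<^esub> c'" using c inj cK unfolding R_def by metis
      then show ?thesis
        using cK N(1) by (metis K.rcos_self K.is_group normal_imp_subgroup subgroup.rcos_module)
    qed
    then have "c \<otimes>\<^bsub>K\<^esub> inv\<^bsub>K\<^esub> c' = \<one>\<^bsub>K\<^esub>" using pro2_separated[OF K] cK by simp
    then show ?thesis using cK K.inv_solve_right'[of "\<one>\<^bsub>K\<^esub>" c c'] by simp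
  qed
  have R_mult: "R (x \<otimes>\<^bsub>?F\<^esub> y) (c \<otimes>\<^bsub>K\<^esub> c')" if "R x c" "R y c'" for x y c c'
    using that group_hom.hom_mult[OF e_hom] group_hom.hom_mult[OF p_hom] by (simp add: R_def)
  have R_inv: "R (inv\<^bsub>?F\<^esub> x) (inv\<^bsub>K\<^esub> c)" if "R x c" for x c
    using that group_hom.hom_inv[OF e_hom] group_hom.hom_inv[OF p_hom] by (simp add: R_def)
  have R_one: "R \<one>\<^bsub>?F\<^esub> \<one>\<^bsub>K\<^esub>"
    using group_hom.hom_one[OF e_hom] group_hom.hom_one[OF p_hom] by (simp add: R_def)
  have R_gen: "R (free_pro2_gen d i) (k i)" if i: "i \<in> {1..d}" for i
    using i k free_pro2_gen_closed ap a by (simp add: R_def free_pro2_gen_def)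
  have R_generate: "\<exists>c. R y c" if "y \<in> generate ?F (free_pro2_gen d ` {1..d})" for y
    using that
  proof induction
    case one
    show ?case using R_one by blast
  next
    case (incl h)
    then show ?case using R_gen by blast
  next
    case (inv h)
    then show ?case using R_gen R_inv by blast
  next
    case (eng x y)
    then show ?case using R_mult by blast
  qed
  have coset_open: "openin (topo K) (N #>\<^bsub>K\<^esub> c)" "c \<in> N #>\<^bsub>K\<^esub> c" "N #>\<^bsub>K\<^esub> c \<subseteq> carrier K"
    "\<And>c'. c' \<in> N #>\<^bsub>K\<^esub> c \<Longrightarrow> p N c' = p N c" if N: "N \<in> ON" and c: "c \<in> carrier K" for N c
  proof -
    interpret N: normal N K using N by (simp add: ON_def)
    show "openin (topo K) (N #>\<^bsub>K\<^esub> c)" using N c open_rcoset[OF K] by (simp add: ON_def)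
    show self: "c \<in> N #>\<^bsub>K\<^esub> c" by (rule K.rcos_self[OF c N.subgroup_axioms])
    show sub: "N #>\<^bsub>K\<^esub> c \<subseteq> carrier K" by (rule K.r_coset_subset_G[OF N.subset c])
    fix c' assume c': "c' \<in> N #>\<^bsub>K\<^esub> c"
    then have "N #>\<^bsub>K\<^esub> c = N #>\<^bsub>K\<^esub> c'" by (rule K.repr_independence[OF _ c N.subgroup_axioms])
    then show "p N c' = p N c" using inj N c c' sub by blast
  qed
  have R_ex: "\<exists>c. R x c" if x: "x \<in> carrier ?F" for x
  proof -
    \<comment> \<open>\<open>S N\<close> collects the candidates that are correct modulo N. It is
      closed because its complement is a union of open cosets, and compactness leaves only finitely
      many N at a time. For these, x may be replaced by a word y with the same finitely many
      coordinates, and y has a value.\<close>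
    define S where "S N = {c \<in> carrier K. p N c = x (a N)}" for N
    have "closedin (topo K) (S N)" if N: "N \<in> ON" for N
    proof -
      have "openin (topo K) (carrier K - S N)"
      proof (subst openin_subopen, clarify)
        fix c assume c: "c \<in> carrier K" "c \<notin> S N"
        have "c' \<notin> S N" if "c' \<in> N #>\<^bsub>K\<^esub> c" for c'
          using coset_open(4)[OF N c(1) that] c by (simp add: S_def)
        then show "\<exists>T. openin (topo K) T \<and> c \<in> T \<and> T \<subseteq> carrier K - S N"
          using coset_open(1-3)[OF N c(1)] by blast
      qed
      then show ?thesis by (auto simp: closedin_def pro2_topspace[OF K] S_def)
    qed
    moreover have "\<Inter>\<F> \<noteq> {}" if \<F>: "finite \<F>" "\<F> \<subseteq> S ` ON" for \<F>
    proof -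
      obtain T where T: "finite T" "T \<subseteq> ON" "\<F> = S ` T" using finite_subset_image[OF \<F>] by blast
      have "finite (a ` T)" "a ` T \<subseteq> free_pro2_index d" using T a by auto
      then obtain y where y: "y \<in> generate ?F (free_pro2_gen d ` {1..d})" "\<forall>b\<in>a ` T. y b = x b"
        using x unfolding carrier_free_pro2 mem_free_pro2_carrier generate_free_pro2 by meson
      obtain c where c: "R y c" using R_generate[OF y(1)] by blast
      have "c \<in> S N" if N: "N \<in> T" for N
      proof -
        have "y (a N) = p N c" using c N T(2) by (auto simp: R_def)
        moreover have "y (a N) = x (a N)" using y(2) N by blast
        ultimately show ?thesis using c by (simp add: R_def S_def)
      qed
      then have "c \<in> \<Inter>\<F>" using T(3) by blast
      then show ?thesis by blast
    qed
    ultimately have "\<Inter>(S ` ON) \<noteq> {}"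
      using pro2_compact[OF K] unfolding compact_space_fip by (metis (no_types, lifting) imageE)
    then obtain c where c: "\<And>N. N \<in> ON \<Longrightarrow> c \<in> S N" by blast
    \<comment> \<open>The member \<open>carrier K\<close> of \<open>ON\<close> is what places c in
      K; an intersection over an empty family would be everything.\<close>
    have "openin (topo K) (carrier K)" using openin_topspace[of "topo K"] by (simp add: pro2_topspace[OF K])
    then have "carrier K \<in> ON" using K.normal_invI[OF K.subgroup_self] by (simp add: ON_def)
    from c[OF this] have "c \<in> carrier K" by (simp add: S_def)
    moreover have "x (a N) = p N c" if "N \<in> ON" for N using c[OF that] by (simp add: S_def)
    ultimately show ?thesis using x by (intro exI[of _ c]) (simp add: R_def)
  qed
  define \<phi> where "\<phi> x = (SOME c. R x c)" for x
  have \<phi>: "R x (\<phi> x)" if "x \<in> carrier ?F" for x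
    unfolding \<phi>_def using R_ex[OF that] by (rule someI_ex)
  have \<phi>_eq: "\<phi> x = c" if "R x c" for x c
    using R_unique[OF \<phi> that] that by (simp add: R_def)
  have "\<phi> \<in> hom ?F K"
  proof (rule homI)
    fix x y assume x: "x \<in> carrier ?F" and y: "y \<in> carrier ?F"
    show "\<phi> x \<in> carrier K" using \<phi>[OF x] by (simp add: R_def)
    show "\<phi> (x \<otimes>\<^bsub>?F\<^esub> y) = \<phi> x \<otimes>\<^bsub>K\<^esub> \<phi> y"
      by (rule \<phi>_eq) (rule R_mult[OF \<phi>[OF x] \<phi>[OF y]])
  qed
  moreover have "continuous_map (topo ?F) (topo K) \<phi>"
  proof -
    \<comment> \<open>Modulo N the value \<phi> y depends only on the coordinate \<open>a N\<close>
      of y, so a cylinder over one coordinate is mapped into U.\<close>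
    have "openin (topo ?F) {x \<in> carrier ?F. \<phi> x \<in> U}" if U: "openin (topo K) U" for U
    proof (subst openin_subopen, clarify)
      fix x assume x: "x \<in> carrier ?F" "\<phi> x \<in> U"
      obtain N where N: "N \<lhd> K" "openin (topo K) N" "N #>\<^bsub>K\<^esub> \<phi> x \<subseteq> U"
        by (rule pro2_coset_base[OF K U x(2)])
      then have ON: "N \<in> ON" by (simp add: ON_def)
      have "\<phi> y \<in> U" if y: "y \<in> carrier ?F" "y (a N) = x (a N)" for y
      proof -
        have cl: "\<phi> y \<in> carrier K" "\<phi> x \<in> carrier K" using \<phi> y x by (auto simp: R_def)
        have "p N (\<phi> y) = p N (\<phi> x)" using \<phi>[OF y(1)] \<phi>[OF x(1)] y(2) ON by (simp add: R_def)
        then have "N #>\<^bsub>K\<^esub> \<phi> y = N #>\<^bsub>K\<^esub> \<phi> x" using inj ON cl by blast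
        then show ?thesis using coset_open(2)[OF ON cl(1)] N(3) by blast
      qed
      moreover have "openin (topo ?F) {y \<in> carrier ?F. \<forall>b\<in>{a N}. y b = x b}"
        using a[OF ON] by (intro openin_free_pro2) auto
      ultimately show "\<exists>T. openin (topo ?F) T \<and> x \<in> T \<and> T \<subseteq> {x \<in> carrier ?F. \<phi> x \<in> U}"
        using x by (intro exI[of _ "{y \<in> carrier ?F. \<forall>b\<in>{a N}. y b = x b}"]) auto
    qed
    moreover have "\<phi> x \<in> carrier K" if "x \<in> carrier ?F" for x using \<phi>[OF that] by (simp add: R_def)
    ultimately show ?thesis by (simp add: continuous_map_def topspace_free_pro2 pro2_topspace[OF K] Pi_def)
  qed
  ultimately have "\<phi> \<in> cont_hom ?F K" by (simp add: cont_hom_def)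
  then show ?thesis using \<phi>_eq R_gen by blast
qed

text \<open>Both maps agree on words in the generators, which are dense, and the set where two
  continuous maps into a Hausdorff space agree is closed.\<close>

lemma free_pro2_hom_eq:
  assumes K: "group K" "Hausdorff_space (topo K)"
    and f: "f \<in> cont_hom (free_pro2 d) K" and g: "g \<in> cont_hom (free_pro2 d) K"
    and eq: "\<And>i. i \<in> {1..d} \<Longrightarrow> f (free_pro2_gen d i) = g (free_pro2_gen d i)"
    and x: "x \<in> carrier (free_pro2 d)"
  shows "f x = g x"
proof -
  interpret f: group_hom "free_pro2 d" K f by (rule cont_hom_group_hom[OF f group_free_pro2 K(1)])
  interpret g: group_hom "free_pro2 d" K g by (rule cont_hom_group_hom[OF g group_free_pro2 K(1)])
  let ?S = "generate (free_pro2 d) (free_pro2_gen d ` {1..d})"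
  have gens: "free_pro2_gen d ` {1..d} \<subseteq> carrier (free_pro2 d)" using free_pro2_gen_closed by blast
  have "f y = g y" if "y \<in> ?S" for y
    using that
  proof induction
    case (inv h)
    then have "h \<in> carrier (free_pro2 d)" "f h = g h" using gens eq by auto
    then show ?case by simp
  next
    case (eng x y)
    then show ?case using f.G.generate_in_carrier[OF gens] by simp
  qed (use eq in auto)
  \<comment> \<open>The carrier was defined as the closure of the words in the product, so their
    closure in the subspace is the whole carrier.\<close>
  moreover have "x \<in> topo (free_pro2 d) closure_of ?S"
    using x f.G.generate_incl[OF gens]
    unfolding topo_free_pro2 closure_of_subtopology carrier_free_pro2
    by (simp only: Int_absorb1) (simp only: free_pro2_carrier_def generate_free_pro2 Int_absorb)
  ultimately show ?thesis
    using forall_in_closure_of_eq[OF _ K(2) cont_homD(2)[OF f] cont_homD(2)[OF g]] by blast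
qed

section \<open>Quotients\<close>

lemma (in group_hom) normal_vimage:
  assumes "N \<lhd> H"
  shows "{x \<in> carrier G. h x \<in> N} \<lhd> G"
proof -
  interpret N: normal N H by fact
  show ?thesis
  proof (rule G.normal_invI)
    show "subgroup {x \<in> carrier G. h x \<in> N} G"
    proof (rule G.subgroupI)
      show "{x \<in> carrier G. h x \<in> N} \<noteq> {}" using N.one_closed hom_one G.one_closed by force
    qed auto
    show "x \<otimes> y \<otimes> inv x \<in> {x \<in> carrier G. h x \<in> N}" if "x \<in> carrier G" "y \<in> {x \<in> carrier G. h x \<in> N}" for x y
      using that N.inv_op_closed2 by simp
  qed
qed

locale pro2_quotient = normal N G for N and G :: "'a topgroup" (structure) +
  assumes pro2: "pro2_group G" and closed: "closedin (topo G) N"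
begin

abbreviation "Q \<equiv> quotient_topgroup G N"
abbreviation "\<pi> \<equiv> (\<lambda>x. N #> x)"

lemma carrier_quotient: "carrier Q = \<pi> ` carrier G"
  by (simp add: quotient_topgroup_def carrier_FactGroup)

lemma group_quotient: "group Q"
proof -
  interpret F: group "G Mod N" by (rule factorgroup_is_group)
  show ?thesis
  proof (rule groupI)
    fix x assume "x \<in> carrier Q"
    then show "\<exists>y\<in>carrier Q. y \<otimes>\<^bsub>Q\<^esub> x = \<one>\<^bsub>Q\<^esub>"
      using F.l_inv_ex by (simp add: quotient_topgroup_def)
  qed (use F.m_closed F.m_assoc in \<open>simp_all add: quotient_topgroup_def del: mult_FactGroup one_FactGroup\<close>)
qed

lemma proj_group_hom: "group_hom G Q \<pi>"
  using r_coset_hom_Mod group_quotient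
  by (simp add: group_hom_def group_hom_axioms_def is_group hom_def quotient_topgroup_def)

lemma proj_eq_one_iff:
  assumes "x \<in> carrier G"
  shows "\<pi> x = \<one>\<^bsub>Q\<^esub> \<longleftrightarrow> x \<in> N"
proof -
  have "\<one>\<^bsub>Q\<^esub> = N" by (simp add: quotient_topgroup_def)
  then show ?thesis using coset_join1[OF _ assms subgroup_axioms] coset_join2[OF assms subgroup_axioms] by metis
qed

lemma Union_cosets:
  assumes "U \<subseteq> carrier Q"
  shows "\<Union>U = {x \<in> carrier G. \<pi> x \<in> U}"
proof
  have "\<pi> y \<in> U \<and> y \<in> carrier G" if C: "C \<in> U" "y \<in> C" for C y
  proof -
    obtain x where x: "x \<in> carrier G" "C = \<pi> x" using C(1) assms by (auto simp: carrier_quotient)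
    then have "\<pi> y = C" using repr_independence[OF _ x(1) subgroup_axioms] C(2) by blast
    then show ?thesis using C x r_coset_subset_G[OF subset x(1)] by blast
  qed
  then show "\<Union>U \<subseteq> {x \<in> carrier G. \<pi> x \<in> U}" by blast
  show "{x \<in> carrier G. \<pi> x \<in> U} \<subseteq> \<Union>U" using rcos_self[OF _ subgroup_axioms] by blast
qed

text \<open>\<open>topology\<close> returns the intended family only once \<open>istopology\<close>
  has been checked. The union of a set of cosets is its preimage under \<open>\<pi>\<close>, and
  preimages commute with intersections and unions.\<close>

lemma openin_quotient:
  "openin (topo Q) U \<longleftrightarrow> U \<subseteq> carrier Q \<and> openin (topo G) {x \<in> carrier G. \<pi> x \<in> U}"
proof -
  let ?P = "\<lambda>U. U \<subseteq> carrier Q \<and> openin (topo G) {x \<in> carrier G. \<pi> x \<in> U}"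
  have eq: "?P = (\<lambda>U. U \<subseteq> carrier Q \<and> openin (topo G) (\<Union>U))"
    using Union_cosets by (intro ext) auto
  have "istopology ?P"
    unfolding istopology_def
  proof (intro conjI allI impI)
    fix S T assume S: "?P S" and T: "?P T"
    have "{x \<in> carrier G. \<pi> x \<in> S \<inter> T} = {x \<in> carrier G. \<pi> x \<in> S} \<inter> {x \<in> carrier G. \<pi> x \<in> T}" by blast
    then show "openin (topo G) {x \<in> carrier G. \<pi> x \<in> S \<inter> T}" using S T by (simp add: openin_Int)
    show "S \<inter> T \<subseteq> carrier Q" using S by blast
  next
    fix \<K> assume K: "\<forall>K\<in>\<K>. ?P K"
    have "{x \<in> carrier G. \<pi> x \<in> \<Union>\<K>} = (\<Union>K\<in>\<K>. {x \<in> carrier G. \<pi> x \<in> K})" by blast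
    then show "openin (topo G) {x \<in> carrier G. \<pi> x \<in> \<Union>\<K>}" using K by auto
    show "\<Union>\<K> \<subseteq> carrier Q" using K by blast
  qed
  then have "openin (topology (\<lambda>U. U \<subseteq> carrier Q \<and> openin (topo G) (\<Union>U))) = ?P"
    unfolding eq[symmetric] by (rule topology_inverse')
  moreover have "topo Q = topology (\<lambda>U. U \<subseteq> carrier Q \<and> openin (topo G) (\<Union>U))"
    by (simp add: quotient_topgroup_def)
  ultimately show ?thesis by simp
qed

lemma topspace_quotient: "topspace (topo Q) = carrier Q"
proof -
  have "{x \<in> carrier G. \<pi> x \<in> carrier Q} = topspace (topo G)"
    by (auto simp: pro2_topspace[OF pro2] carrier_quotient)
  then have "openin (topo Q) (carrier Q)" by (simp add: openin_quotient)
  moreover have "topspace (topo Q) \<subseteq> carrier Q" using openin_quotient openin_topspace by blast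
  ultimately show ?thesis using openin_subset by blast
qed

lemma proj_cont_hom: "\<pi> \<in> cont_hom G Q"
  using group_hom.homh[OF proj_group_hom]
  by (simp add: cont_hom_def continuous_map_def pro2_topspace[OF pro2] topspace_quotient openin_quotient
      carrier_quotient)

sublocale \<pi>: group_hom G Q \<pi> by (rule proj_group_hom)

text \<open>With each x the preimage of this set contains the open coset \<open>M #> x\<close>,
  hence it is open. These sets serve as the base of the quotient.\<close>

lemma openin_proj_coset:
  assumes M: "M \<lhd> G" "openin (topo G) M" and y: "y \<in> carrier G"
  shows "openin (topo Q) (\<pi> ` M #>\<^bsub>Q\<^esub> \<pi> y)"
proof -
  interpret M: normal M G by fact
  have sub: "subgroup (\<pi> ` M) Q" using \<pi>.subgroup_img_is_subgroup[OF M.subgroup_axioms] .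
  have "\<pi> ` M #>\<^bsub>Q\<^esub> \<pi> y \<subseteq> carrier Q"
    using sub y by (intro \<pi>.H.r_coset_subset_G subgroup.subset \<pi>.hom_closed)
  moreover have "openin (topo G) {x \<in> carrier G. \<pi> x \<in> \<pi> ` M #>\<^bsub>Q\<^esub> \<pi> y}"
  proof (subst openin_subopen, clarify)
    fix x assume x: "x \<in> carrier G" "\<pi> x \<in> \<pi> ` M #>\<^bsub>Q\<^esub> \<pi> y"
    have "v \<in> carrier G \<and> \<pi> v \<in> \<pi> ` M #>\<^bsub>Q\<^esub> \<pi> y" if v: "v \<in> M #> x" for v
    proof -
      obtain m where m: "m \<in> M" "v = m \<otimes> x" using v by (auto simp: r_coset_def)
      obtain n where n: "n \<in> M" "\<pi> x = \<pi> n \<otimes>\<^bsub>Q\<^esub> \<pi> y" using x(2) by (auto simp: r_coset_def)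
      have cl: "m \<in> carrier G" "n \<in> carrier G" using m n by auto
      then have "\<pi> v = \<pi> (m \<otimes> n) \<otimes>\<^bsub>Q\<^esub> \<pi> y"
        using m(2) n(2) x(1) y by (simp only: \<pi>.hom_mult \<pi>.H.m_assoc \<pi>.hom_closed)
      moreover have "m \<otimes> n \<in> M" using m n by simp
      ultimately show ?thesis using m cl x unfolding r_coset_def by auto
    qed
    then have "M #> x \<subseteq> {x \<in> carrier G. \<pi> x \<in> \<pi> ` M #>\<^bsub>Q\<^esub> \<pi> y}" by blast
    then show "\<exists>T. openin (topo G) T \<and> x \<in> T \<and> T \<subseteq> {x \<in> carrier G. \<pi> x \<in> \<pi> ` M #>\<^bsub>Q\<^esub> \<pi> y}"
      using open_rcoset[OF pro2 M(2) x(1)] rcos_self[OF x(1) M.subgroup_axioms] by blast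
  qed
  ultimately show ?thesis by (simp add: openin_quotient)
qed

text \<open>For distinct cosets, \<open>x \<otimes> inv y\<close> lies outside the closed subgroup
  N, so a whole open coset \<open>M #> (x \<otimes> inv y)\<close> avoids N. The translates of the
  image of M by \<open>\<pi> x\<close> and \<open>\<pi> y\<close> are then disjoint.\<close>

lemma Hausdorff_quotient: "Hausdorff_space (topo Q)"
  unfolding Hausdorff_space_def topspace_quotient
proof (intro allI impI)
  fix C D assume "C \<in> carrier Q \<and> D \<in> carrier Q \<and> C \<noteq> D"
  then obtain x y where x: "x \<in> carrier G" "C = \<pi> x" and y: "y \<in> carrier G" "D = \<pi> y" and "C \<noteq> D"
    by (auto simp: carrier_quotient)
  have "x \<otimes> inv y \<notin> N"
  proof
    assume "x \<otimes> inv y \<in> N"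
    then have "\<pi> (x \<otimes> inv y) = \<one>\<^bsub>Q\<^esub>" using proj_eq_one_iff[of "x \<otimes> inv y"] x y by simp
    moreover have "\<pi> (x \<otimes> inv y) = \<pi> x \<otimes>\<^bsub>Q\<^esub> inv\<^bsub>Q\<^esub> \<pi> y"
      using x(1) y(1) by (simp only: \<pi>.hom_mult \<pi>.hom_inv inv_closed)
    ultimately have "\<pi> x = \<one>\<^bsub>Q\<^esub> \<otimes>\<^bsub>Q\<^esub> \<pi> y"
      using \<pi>.H.inv_solve_right'[OF \<pi>.H.one_closed \<pi>.hom_closed[OF x(1)] \<pi>.hom_closed[OF y(1)]] by metis
    then show False using \<pi>.H.l_one[OF \<pi>.hom_closed[OF y(1)]] \<open>C \<noteq> D\<close> x(2) y(2) by metis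
  qed
  moreover have "openin (topo G) (carrier G - N)"
    using closed by (simp add: closedin_def pro2_topspace[OF pro2])
  ultimately obtain M where M: "M \<lhd> G" "openin (topo G) M" "M #> (x \<otimes> inv y) \<subseteq> carrier G - N"
    using x y by (metis (no_types, lifting) DiffI inv_closed m_closed pro2_coset_base[OF pro2])
  interpret M: normal M G by fact
  have "disjnt (\<pi> ` M #>\<^bsub>Q\<^esub> \<pi> x) (\<pi> ` M #>\<^bsub>Q\<^esub> \<pi> y)"
    unfolding disjnt_def
  proof (rule ccontr)
    assume "(\<pi> ` M #>\<^bsub>Q\<^esub> \<pi> x) \<inter> (\<pi> ` M #>\<^bsub>Q\<^esub> \<pi> y) \<noteq> {}"
    then obtain m n where m: "m \<in> M" and n: "n \<in> M" and eq: "\<pi> m \<otimes>\<^bsub>Q\<^esub> \<pi> x = \<pi> n \<otimes>\<^bsub>Q\<^esub> \<pi> y"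
      by (auto simp: r_coset_def)
    have cl: "m \<in> carrier G" "n \<in> carrier G" using m n by auto
    \<comment> \<open>A common point would give an element of N inside the coset that was chosen to
      avoid N.\<close>
    have "\<pi> (inv n \<otimes> m \<otimes> (x \<otimes> inv y)) = inv\<^bsub>Q\<^esub> \<pi> n \<otimes>\<^bsub>Q\<^esub> (\<pi> m \<otimes>\<^bsub>Q\<^esub> \<pi> x) \<otimes>\<^bsub>Q\<^esub> inv\<^bsub>Q\<^esub> \<pi> y"
      using x(1) y(1) cl by (simp only: \<pi>.hom_mult \<pi>.hom_inv inv_closed m_closed \<pi>.H.m_assoc \<pi>.hom_closed \<pi>.H.inv_closed \<pi>.H.m_closed)
    also have "\<dots> = \<one>\<^bsub>Q\<^esub>"
      unfolding eq using \<pi>.hom_closed[OF y(1)] \<pi>.hom_closed[OF cl(2)]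
      by (simp only: \<pi>.H.m_assoc \<pi>.H.inv_mult_cancel \<pi>.H.r_inv \<pi>.H.l_inv \<pi>.H.inv_closed \<pi>.H.m_closed \<pi>.H.r_one)
    finally have "inv n \<otimes> m \<otimes> (x \<otimes> inv y) \<in> N"
      using proj_eq_one_iff[of "inv n \<otimes> m \<otimes> (x \<otimes> inv y)"] x y cl by simp
    moreover have "inv n \<otimes> m \<otimes> (x \<otimes> inv y) \<in> M #> (x \<otimes> inv y)"
      using m n unfolding r_coset_def by auto
    ultimately show False using M(3) by blast
  qed
  moreover have "C \<in> \<pi> ` M #>\<^bsub>Q\<^esub> \<pi> x" "D \<in> \<pi> ` M #>\<^bsub>Q\<^esub> \<pi> y"
    unfolding x(2) y(2)
    by (rule \<pi>.H.rcos_self[OF \<pi>.hom_closed \<pi>.subgroup_img_is_subgroup[OF M.subgroup_axioms]], fact)+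
  ultimately show "\<exists>U V. openin (topo Q) U \<and> openin (topo Q) V \<and> C \<in> U \<and> D \<in> V \<and> disjnt U V"
    using openin_proj_coset[OF M(1,2) x(1)] openin_proj_coset[OF M(1,2) y(1)] by blast
qed

text \<open>The base consists of the cosets of images of open normal subgroups M. The preimage of
  such an image contains M, so its index is a power of 2, and the image has the same index in the
  quotient.\<close>

lemma pro2_quotient: "pro2_group Q"
proof (rule pro2I[OF group_quotient topspace_quotient _ Hausdorff_quotient])
  have "compactin (topo Q) (\<pi> ` carrier G)"
    using image_compactin[OF _ cont_homD(2)[OF proj_cont_hom]] pro2_compact[OF pro2]
    by (simp add: compact_space_def pro2_topspace[OF pro2])
  then show "compact_space (topo Q)"
    by (simp add: compact_space_def topspace_quotient carrier_quotient)
  fix U C assume U: "openin (topo Q) U" "C \<in> U"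
  obtain x where x: "x \<in> carrier G" "C = \<pi> x"
    using U openin_quotient by (auto simp: carrier_quotient)
  have "openin (topo G) {x \<in> carrier G. \<pi> x \<in> U}" "x \<in> {x \<in> carrier G. \<pi> x \<in> U}"
    using U x openin_quotient by auto
  then obtain M where M: "M \<lhd> G" "openin (topo G) M" "M #> x \<subseteq> {x \<in> carrier G. \<pi> x \<in> U}"
    by (rule pro2_coset_base[OF pro2])
  interpret M: normal M G by fact
  have surj: "\<pi> ` carrier G = carrier Q" by (simp add: carrier_quotient)
  have M': "\<pi> ` M \<lhd> Q" by (rule M.surj_hom_normal_subgroup[OF proj_group_hom surj])
  interpret M': normal "\<pi> ` M" Q by fact
  obtain k where "card (rcosets M) = 2 ^ k" using pro2_index[OF pro2 M(1,2)] by blast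
  then obtain j where "card (rcosets {x \<in> carrier G. \<pi> x \<in> \<pi> ` M}) = 2 ^ j"
    using two_power_index_mono[OF M(1) \<pi>.normal_vimage[OF M']] M.subset by blast
  then have "card (rcosets\<^bsub>Q\<^esub> (\<pi> ` M)) = 2 ^ j"
    using \<pi>.card_rcosets_vimage[OF surj M'.subgroup_axioms] by metis
  moreover have "\<pi> ` M #>\<^bsub>Q\<^esub> C \<subseteq> U"
  proof
    fix v assume "v \<in> \<pi> ` M #>\<^bsub>Q\<^esub> C"
    then obtain m where m: "m \<in> M" "v = \<pi> m \<otimes>\<^bsub>Q\<^esub> \<pi> x" using x(2) by (auto simp: r_coset_def)
    then have "v = \<pi> (m \<otimes> x)" using \<pi>.hom_mult[of m x] x(1) by simp
    moreover have "m \<otimes> x \<in> M #> x" using m by (auto simp: r_coset_def)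
    ultimately show "v \<in> U" using M(3) by blast
  qed
  moreover have "\<forall>D\<in>carrier Q. openin (topo Q) (\<pi> ` M #>\<^bsub>Q\<^esub> D)"
    using openin_proj_coset[OF M(1,2)] by (auto simp: carrier_quotient)
  ultimately show "\<exists>M k. M \<lhd> Q \<and> card (rcosets\<^bsub>Q\<^esub> M) = 2 ^ k \<and> M #>\<^bsub>Q\<^esub> C \<subseteq> U \<and>
      (\<forall>D\<in>carrier Q. openin (topo Q) (M #>\<^bsub>Q\<^esub> D))"
    using M' by blast
qed

text \<open>\<open>SOME\<close> picks a representative of the coset, and the choice does not matter
  because f is trivial on N. Continuity is tested in G, where g composed with \<open>\<pi>\<close>
  is f.\<close>

lemma quotient_universal:
  assumes K: "group K" and f: "f \<in> cont_hom G K" and triv: "\<And>x. x \<in> N \<Longrightarrow> f x = \<one>\<^bsub>K\<^esub>"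
  shows "\<exists>g\<in>cont_hom Q K. \<forall>x\<in>carrier G. g (\<pi> x) = f x"
proof -
  interpret f: group_hom G K f by (rule cont_hom_group_hom[OF f is_group K])
  define g where "g C = f (SOME x. x \<in> C)" for C
  have g: "g (\<pi> x) = f x" if x: "x \<in> carrier G" for x
  proof -
    have "(SOME v. v \<in> \<pi> x) \<in> \<pi> x" using rcos_self[OF x subgroup_axioms] by (rule someI)
    then obtain n where n: "n \<in> N" "(SOME v. v \<in> \<pi> x) = n \<otimes> x" by (auto simp: r_coset_def)
    then show ?thesis using triv[OF n(1)] x by (simp add: g_def)
  qed
  have "g \<in> hom Q K"
  proof (rule homI)
    fix C D assume "C \<in> carrier Q" "D \<in> carrier Q"
    then obtain x y where x: "x \<in> carrier G" "C = \<pi> x" and y: "y \<in> carrier G" "D = \<pi> y"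
      by (auto simp: carrier_quotient)
    show "g C \<in> carrier K" using g x by simp
    have "g (C \<otimes>\<^bsub>Q\<^esub> D) = g (\<pi> (x \<otimes> y))" using x y \<pi>.hom_mult[of x y] by simp
    also have "\<dots> = f x \<otimes>\<^bsub>K\<^esub> f y" using g[of "x \<otimes> y"] x(1) y(1) by (simp del: \<pi>.hom_mult)
    finally show "g (C \<otimes>\<^bsub>Q\<^esub> D) = g C \<otimes>\<^bsub>K\<^esub> g D" using g x y by simp
  qed
  moreover have "continuous_map (topo Q) (topo K) g"
    unfolding continuous_map_def
  proof (intro conjI allI impI)
    \<comment> \<open>The range condition concerns \<open>topspace\<close>, which the hypotheses on
      K do not tie to \<open>carrier K\<close>; it is therefore taken from the continuity of
      f.\<close>
    have f_cl: "f x \<in> topspace (topo K)" if "x \<in> carrier G" for x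
      using cont_homD(2)[OF f] that by (auto simp: continuous_map_def pro2_topspace[OF pro2])
    then show "g \<in> topspace (topo Q) \<rightarrow> topspace (topo K)"
      using g by (auto simp: topspace_quotient carrier_quotient)
    fix U assume U: "openin (topo K) U"
    have "{x \<in> carrier G. \<pi> x \<in> {C \<in> topspace (topo Q). g C \<in> U}} = {x \<in> topspace (topo G). f x \<in> U}"
      using g by (auto simp: topspace_quotient carrier_quotient pro2_topspace[OF pro2])
    then show "openin (topo Q) {C \<in> topspace (topo Q). g C \<in> U}"
      using openin_continuous_map_preimage[OF cont_homD(2)[OF f] U]
      by (simp add: openin_quotient topspace_quotient)
  qed
  ultimately have "g \<in> cont_hom Q K" by (simp add: cont_hom_def)
  then show ?thesis using g by blast
qed

end

section \<open>Right angled Artin groups and semidirect products\<close>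

lemma closed_normal_closure:
  assumes G: "pro2_group G" and R: "R \<subseteq> carrier G"
  shows "closed_normal_closure G R \<lhd> G" "closedin (topo G) (closed_normal_closure G R)"
    "R \<subseteq> closed_normal_closure G R"
proof -
  interpret group G using G by (rule pro2_group_is_group)
  let ?\<N> = "{N. N \<lhd> G \<and> closedin (topo G) N \<and> R \<subseteq> N}"
  have "carrier G \<lhd> G" using normal_invI[OF subgroup_self] by simp
  moreover have "closedin (topo G) (carrier G)"
    using closedin_topspace[of "topo G"] by (simp add: pro2_topspace[OF G])
  \<comment> \<open>The family is nonempty; the intersection of no sets would be
    \<open>UNIV\<close>, which need not be a subgroup of G.\<close>
  ultimately have ne: "carrier G \<in> ?\<N>" using R by simp
  show "R \<subseteq> closed_normal_closure G R" by (auto simp: closed_normal_closure_def)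
  show "closedin (topo G) (closed_normal_closure G R)"
    unfolding closed_normal_closure_def using ne by (intro closedin_Inter) blast+
  show "closed_normal_closure G R \<lhd> G"
  proof (rule normal_invI)
    show "subgroup (closed_normal_closure G R) G"
      unfolding closed_normal_closure_def
      using ne by (intro subgroups_Inter) (auto intro: normal_imp_subgroup)
    fix x h assume x: "x \<in> carrier G" and h: "h \<in> closed_normal_closure G R"
    then show "x \<otimes>\<^bsub>G\<^esub> h \<otimes>\<^bsub>G\<^esub> inv\<^bsub>G\<^esub> x \<in> closed_normal_closure G R"
      unfolding closed_normal_closure_def by (blast intro: normal.inv_op_closed2)
  qed
qed

lemma ugraph_edge:
  assumes "ugraph \<Gamma>" "{i, j} \<in> edges \<Gamma>"
  shows "i \<in> {1..nverts \<Gamma>}" "j \<in> {1..nverts \<Gamma>}"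
  using assms unfolding ugraph_def by blast+

section \<open>Pro-2 RAAGs by generators and relations\<close>

context
  fixes \<Gamma> :: graph
  assumes \<Gamma>: "ugraph \<Gamma>"
begin

lemma raag_relators_closed: "raag_relators \<Gamma> \<subseteq> carrier (free_pro2 (nverts \<Gamma>))"
proof -
  interpret F: group "free_pro2 (nverts \<Gamma>)" by (rule group_free_pro2)
  show ?thesis
    using ugraph_edge[OF \<Gamma>] free_pro2_gen_closed[of _ "nverts \<Gamma>"]
    unfolding raag_relators_def Let_def by (blast intro: F.m_closed F.inv_closed)
qed

lemma raag_quotient: "pro2_quotient (raag_kernel \<Gamma>) (free_pro2 (nverts \<Gamma>))"
  using closed_normal_closure[OF pro2_free_pro2 raag_relators_closed]
  by (simp add: pro2_quotient_def pro2_quotient_axioms_def raag_kernel_def pro2_free_pro2)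

lemma pro2_raag: "pro2_group (raag \<Gamma>)"
  unfolding raag_def using raag_quotient by (rule pro2_quotient.pro2_quotient)

lemma raag_proj:
  "(\<lambda>x. raag_kernel \<Gamma> #>\<^bsub>free_pro2 (nverts \<Gamma>)\<^esub> x) \<in> cont_hom (free_pro2 (nverts \<Gamma>)) (raag \<Gamma>)"
  unfolding raag_def using raag_quotient by (rule pro2_quotient.proj_cont_hom)

lemma raag_gen_closed: "i \<in> {1..nverts \<Gamma>} \<Longrightarrow> raag_gen \<Gamma> i \<in> carrier (raag \<Gamma>)"
  unfolding raag_gen_def by (rule cont_hom_closed[OF raag_proj free_pro2_gen_closed])

text \<open>The relator of the edge lies in the kernel, so the projection sends it to the identity;
  a commutator is trivial exactly when its two entries commute.\<close>

lemma raag_gen_commute: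
  assumes e: "{i, j} \<in> edges \<Gamma>"
  shows "raag_gen \<Gamma> i \<otimes>\<^bsub>raag \<Gamma>\<^esub> raag_gen \<Gamma> j = raag_gen \<Gamma> j \<otimes>\<^bsub>raag \<Gamma>\<^esub> raag_gen \<Gamma> i"
proof -
  let ?F = "free_pro2 (nverts \<Gamma>)" and ?x = "free_pro2_gen (nverts \<Gamma>)"
  interpret h: group_hom ?F "raag \<Gamma>" "\<lambda>x. raag_kernel \<Gamma> #>\<^bsub>?F\<^esub> x"
    by (rule cont_hom_group_hom[OF raag_proj group_free_pro2 pro2_group_is_group[OF pro2_raag]])
  let ?r = "inv\<^bsub>?F\<^esub> (?x i) \<otimes>\<^bsub>?F\<^esub> inv\<^bsub>?F\<^esub> (?x j) \<otimes>\<^bsub>?F\<^esub> ?x i \<otimes>\<^bsub>?F\<^esub> ?x j"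
  have x: "?x i \<in> carrier ?F" "?x j \<in> carrier ?F"
    using ugraph_edge[OF \<Gamma> e] free_pro2_gen_closed by blast+
  have "?r \<in> raag_relators \<Gamma>" using e by (auto simp: raag_relators_def Let_def)
  then have "?r \<in> raag_kernel \<Gamma>"
    unfolding raag_kernel_def using closed_normal_closure(3)[OF pro2_free_pro2 raag_relators_closed] by blast
  moreover have "?r \<in> carrier ?F" using x by simp
  ultimately have "raag_kernel \<Gamma> #>\<^bsub>?F\<^esub> ?r = \<one>\<^bsub>raag \<Gamma>\<^esub>"
    using pro2_quotient.proj_eq_one_iff[OF raag_quotient] by (simp add: raag_def)
  moreover have "raag_kernel \<Gamma> #>\<^bsub>?F\<^esub> ?r =
      inv\<^bsub>raag \<Gamma>\<^esub> raag_gen \<Gamma> i \<otimes>\<^bsub>raag \<Gamma>\<^esub> inv\<^bsub>raag \<Gamma>\<^esub> raag_gen \<Gamma> j \<otimes>\<^bsub>raag \<Gamma>\<^esub> raag_gen \<Gamma> i \<otimes>\<^bsub>raag \<Gamma>\<^esub> raag_gen \<Gamma> j"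
    using x by (simp only: raag_gen_def h.hom_mult h.hom_inv h.G.m_closed h.G.inv_closed)
  moreover have g: "raag_gen \<Gamma> i \<in> carrier (raag \<Gamma>)" "raag_gen \<Gamma> j \<in> carrier (raag \<Gamma>)"
    using raag_gen_closed ugraph_edge[OF \<Gamma> e] by blast+
  ultimately have "inv\<^bsub>raag \<Gamma>\<^esub> (raag_gen \<Gamma> j \<otimes>\<^bsub>raag \<Gamma>\<^esub> raag_gen \<Gamma> i) \<otimes>\<^bsub>raag \<Gamma>\<^esub> (raag_gen \<Gamma> i \<otimes>\<^bsub>raag \<Gamma>\<^esub> raag_gen \<Gamma> j) = \<one>\<^bsub>raag \<Gamma>\<^esub>"
    by (simp add: h.H.inv_mult_group h.H.m_assoc)
  then show ?thesis using g h.H.inv_solve_left'[of "\<one>\<^bsub>raag \<Gamma>\<^esub>"] by simp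
qed

text \<open>Composing with the projection, which is onto, reduces this to
  \<open>free_pro2_hom_eq\<close>.\<close>

lemma raag_hom_eq:
  assumes K: "group K" "Hausdorff_space (topo K)"
    and f: "f \<in> cont_hom (raag \<Gamma>) K" and g: "g \<in> cont_hom (raag \<Gamma>) K"
    and eq: "\<And>i. i \<in> {1..nverts \<Gamma>} \<Longrightarrow> f (raag_gen \<Gamma> i) = g (raag_gen \<Gamma> i)"
    and x: "x \<in> carrier (raag \<Gamma>)"
  shows "f x = g x"
proof -
  let ?F = "free_pro2 (nverts \<Gamma>)"
  obtain y where y: "y \<in> carrier ?F" "x = raag_kernel \<Gamma> #>\<^bsub>?F\<^esub> y"
    using x pro2_quotient.carrier_quotient[OF raag_quotient] by (auto simp: raag_def)
  show ?thesis
    unfolding y(2)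
    by (rule free_pro2_hom_eq[OF K cont_hom_compose[OF raag_proj f] cont_hom_compose[OF raag_proj g] _ y(1)])
      (use eq in \<open>simp add: raag_gen_def\<close>)
qed

text \<open>The kernel of the map from the free group is normal, contains the relators, and is
  closed because points are closed in the Hausdorff group K. So it contains the closed normal
  closure of the relators, and the map factors.\<close>

lemma raag_universal:
  assumes K: "pro2_group K" and k: "\<And>i. i \<in> {1..nverts \<Gamma>} \<Longrightarrow> k i \<in> carrier K"
    and comm: "\<And>i j. {i, j} \<in> edges \<Gamma> \<Longrightarrow> k i \<otimes>\<^bsub>K\<^esub> k j = k j \<otimes>\<^bsub>K\<^esub> k i"
  shows "\<exists>\<phi>\<in>cont_hom (raag \<Gamma>) K. \<forall>i\<in>{1..nverts \<Gamma>}. \<phi> (raag_gen \<Gamma> i) = k i"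
proof -
  let ?F = "free_pro2 (nverts \<Gamma>)" and ?x = "free_pro2_gen (nverts \<Gamma>)"
  interpret K: group K using K by (rule pro2_group_is_group)
  obtain f where f: "f \<in> cont_hom ?F K" and fx: "\<And>i. i \<in> {1..nverts \<Gamma>} \<Longrightarrow> f (?x i) = k i"
    using free_pro2_universal[where d = "nverts \<Gamma>", OF K, of k] k by blast
  interpret f: group_hom ?F K f by (rule cont_hom_group_hom[OF f group_free_pro2 K.is_group])
  let ?N = "kernel ?F K f"
  have "raag_relators \<Gamma> \<subseteq> ?N"
  proof
    fix r assume r: "r \<in> raag_relators \<Gamma>"
    then obtain i j where e: "{i, j} \<in> edges \<Gamma>"
      and rij: "r = inv\<^bsub>?F\<^esub> (?x i) \<otimes>\<^bsub>?F\<^esub> inv\<^bsub>?F\<^esub> (?x j) \<otimes>\<^bsub>?F\<^esub> ?x i \<otimes>\<^bsub>?F\<^esub> ?x j"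
      by (auto simp: raag_relators_def Let_def)
    note ij = ugraph_edge[OF \<Gamma> e]
    have "f r = inv\<^bsub>K\<^esub> k i \<otimes>\<^bsub>K\<^esub> inv\<^bsub>K\<^esub> k j \<otimes>\<^bsub>K\<^esub> k i \<otimes>\<^bsub>K\<^esub> k j"
      unfolding rij using free_pro2_gen_closed[OF ij(1)] free_pro2_gen_closed[OF ij(2)] fx[OF ij(1)] fx[OF ij(2)]
      by simp
    also have "\<dots> = inv\<^bsub>K\<^esub> (k j \<otimes>\<^bsub>K\<^esub> k i) \<otimes>\<^bsub>K\<^esub> (k i \<otimes>\<^bsub>K\<^esub> k j)"
      using k[OF ij(1)] k[OF ij(2)] by (simp add: K.inv_mult_group K.m_assoc)
    also have "\<dots> = \<one>\<^bsub>K\<^esub>" unfolding comm[OF e] using k[OF ij(1)] k[OF ij(2)] by simp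
    finally show "r \<in> ?N" using r raag_relators_closed by (auto simp: kernel_def)
  qed
  moreover have "closedin (topo ?F) ?N"
  proof -
    have "closedin (topo K) {\<one>\<^bsub>K\<^esub>}"
      using pro2_Hausdorff[OF K] by (intro closedin_Hausdorff_singleton) (auto simp: pro2_topspace[OF K])
    from closedin_continuous_map_preimage[OF cont_homD(2)[OF f] this]
    show ?thesis by (simp add: kernel_def topspace_free_pro2)
  qed
  ultimately have "raag_kernel \<Gamma> \<subseteq> ?N"
    using f.normal_kernel unfolding raag_kernel_def closed_normal_closure_def by blast
  then have "\<And>x. x \<in> raag_kernel \<Gamma> \<Longrightarrow> f x = \<one>\<^bsub>K\<^esub>" by (auto simp: kernel_def)
  then obtain g where "g \<in> cont_hom (raag \<Gamma>) K"
    "\<And>x. x \<in> carrier ?F \<Longrightarrow> g (raag_kernel \<Gamma> #>\<^bsub>?F\<^esub> x) = f x"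
    unfolding raag_def using pro2_quotient.quotient_universal[OF raag_quotient K.is_group f] by blast
  then show ?thesis using fx free_pro2_gen_closed by (intro bexI[of _ g]) (simp_all add: raag_gen_def)
qed

end

section \<open>Semidirect products with the group of order two\<close>

lemma carrier_Delta: "carrier Delta = {0, 1}"
  by (auto simp: Delta_def carrier_integer_mod_group)

lemma one_Delta: "\<one>\<^bsub>Delta\<^esub> = 0"
  by (simp add: Delta_def)

lemma mult_Delta: "a \<otimes>\<^bsub>Delta\<^esub> b = (a + b) mod 2"
  by (simp add: Delta_def)

lemma topo_Delta: "topo Delta = discrete_topology {0, 1}"
  using carrier_Delta by (simp add: Delta_def)

text \<open>An action of the group of order two amounts to one continuous endomorphism squaring to
  the identity. \<open>delta_action_semidirect\<close> and \<open>delta_actionI\<close> pass between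
  this form and homomorphisms into the automorphism group.\<close>

locale delta_semidirect =
  fixes G :: "'a topgroup" and \<theta> :: "int \<Rightarrow> 'a \<Rightarrow> 'a"
  assumes pro2: "pro2_group G"
    and theta_0: "\<And>x. x \<in> carrier G \<Longrightarrow> \<theta> 0 x = x"
    and theta_1: "\<theta> 1 \<in> cont_hom G G"
    and theta_1_1: "\<And>x. x \<in> carrier G \<Longrightarrow> \<theta> 1 (\<theta> 1 x) = x"
begin

abbreviation "S \<equiv> semidirect G Delta \<theta>"

sublocale G: group G using pro2 by (rule pro2_group_is_group)

lemma carrier_S: "carrier S = carrier G \<times> {0, 1}"
  by (simp add: semidirect_def carrier_Delta)

lemma mult_S: "(g, a) \<otimes>\<^bsub>S\<^esub> (h, b) = (g \<otimes>\<^bsub>G\<^esub> \<theta> a h, (a + b) mod 2)"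
  by (simp add: semidirect_def mult_Delta)

lemma one_S: "\<one>\<^bsub>S\<^esub> = (\<one>\<^bsub>G\<^esub>, 0)"
  by (simp add: semidirect_def one_Delta)

lemma topo_S: "topo S = prod_topology (topo G) (discrete_topology {0, 1})"
  by (simp add: semidirect_def topo_Delta)

lemma theta_closed: "a \<in> {0, 1} \<Longrightarrow> x \<in> carrier G \<Longrightarrow> \<theta> a x \<in> carrier G"
  using theta_0 cont_hom_closed[OF theta_1] by auto

lemma theta_mult:
  "a \<in> {0, 1} \<Longrightarrow> x \<in> carrier G \<Longrightarrow> y \<in> carrier G \<Longrightarrow> \<theta> a (x \<otimes>\<^bsub>G\<^esub> y) = \<theta> a x \<otimes>\<^bsub>G\<^esub> \<theta> a y"
  using theta_0 cont_hom_mult[OF theta_1] by auto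

lemma theta_theta:
  "a \<in> {0, 1} \<Longrightarrow> b \<in> {0, 1} \<Longrightarrow> x \<in> carrier G \<Longrightarrow> \<theta> a (\<theta> b x) = \<theta> ((a + b) mod 2) x"
  using theta_0 theta_1_1 cont_hom_closed[OF theta_1] by auto

lemma theta_one: "a \<in> {0, 1} \<Longrightarrow> \<theta> a \<one>\<^bsub>G\<^esub> = \<one>\<^bsub>G\<^esub>"
  using theta_0 cont_hom_one[OF theta_1] G.is_group by auto

text \<open>In Z/2 every element is its own inverse, so the inverse of (g, a) has second component a
  and is twisted by \<open>\<theta> a\<close> itself.\<close>

lemma inverse_S:
  assumes "g \<in> carrier G" "a \<in> {0, 1}"
  shows "(\<theta> a (inv\<^bsub>G\<^esub> g), a) \<in> carrier S" "(\<theta> a (inv\<^bsub>G\<^esub> g), a) \<otimes>\<^bsub>S\<^esub> (g, a) = \<one>\<^bsub>S\<^esub>"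
proof -
  show "(\<theta> a (inv\<^bsub>G\<^esub> g), a) \<in> carrier S" using assms theta_closed by (simp add: carrier_S)
  have "\<theta> a (inv\<^bsub>G\<^esub> g) \<otimes>\<^bsub>G\<^esub> \<theta> a g = \<one>\<^bsub>G\<^esub>"
    using assms theta_mult[OF assms(2), of "inv\<^bsub>G\<^esub> g" g] theta_one by simp
  then show "(\<theta> a (inv\<^bsub>G\<^esub> g), a) \<otimes>\<^bsub>S\<^esub> (g, a) = \<one>\<^bsub>S\<^esub>" using assms by (auto simp: mult_S one_S)
qed

lemma group_S: "group S"
proof (rule groupI)
  fix x y assume "x \<in> carrier S" "y \<in> carrier S"
  then show "x \<otimes>\<^bsub>S\<^esub> y \<in> carrier S" using theta_closed by (auto simp: carrier_S mult_S)
next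
  show "\<one>\<^bsub>S\<^esub> \<in> carrier S" by (simp add: carrier_S one_S)
next
  fix x y z assume "x \<in> carrier S" "y \<in> carrier S" "z \<in> carrier S"
  then obtain g a h b k c where xyz: "x = (g, a)" "y = (h, b)" "z = (k, c)"
    "g \<in> carrier G" "h \<in> carrier G" "k \<in> carrier G" "a \<in> {0, 1}" "b \<in> {0, 1}" "c \<in> {0, 1}"
    by (auto simp: carrier_S)
  have "((a + b) mod 2 + c) mod 2 = (a + (b + c) mod 2) mod 2" by presburger
  moreover have "\<theta> a (h \<otimes>\<^bsub>G\<^esub> \<theta> b k) = \<theta> a h \<otimes>\<^bsub>G\<^esub> \<theta> ((a + b) mod 2) k"
    using theta_mult[OF xyz(7) xyz(5) theta_closed[OF xyz(8) xyz(6)]] theta_theta[OF xyz(7,8,6)] by simp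
  moreover have "(a + b) mod 2 \<in> {0, 1}" by auto
  ultimately show "x \<otimes>\<^bsub>S\<^esub> y \<otimes>\<^bsub>S\<^esub> z = x \<otimes>\<^bsub>S\<^esub> (y \<otimes>\<^bsub>S\<^esub> z)"
    using G.m_assoc[OF xyz(4) theta_closed[OF xyz(7) xyz(5)] theta_closed[OF _ xyz(6), of "(a + b) mod 2"]]
    unfolding xyz(1-3) mult_S by (simp only: prod.inject)
next
  fix x assume "x \<in> carrier S"
  then show "\<one>\<^bsub>S\<^esub> \<otimes>\<^bsub>S\<^esub> x = x" using theta_0 by (auto simp: carrier_S one_S mult_S)
next
  fix x assume "x \<in> carrier S"
  then obtain g a where "x = (g, a)" "g \<in> carrier G" "a \<in> {0, 1}" by (auto simp: carrier_S)
  then show "\<exists>y\<in>carrier S. y \<otimes>\<^bsub>S\<^esub> x = \<one>\<^bsub>S\<^esub>" using inverse_S by blast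
qed

sublocale S: group S by (rule group_S)

lemma inv_S: "g \<in> carrier G \<Longrightarrow> a \<in> {0, 1} \<Longrightarrow> inv\<^bsub>S\<^esub> (g, a) = (\<theta> a (inv\<^bsub>G\<^esub> g), a)"
  using inverse_S by (intro S.inv_equality) (auto simp: carrier_S)

text \<open>An open normal subgroup M of G has to be stable under the involution for M \<times> {0}
  to be normal in S. The cosets of M \<times> {0} are then the products C \<times> {b}, so its index
  is twice that of M.\<close>

lemma pro2_S: "pro2_group S"
proof (rule pro2I[OF group_S])
  show "topspace (topo S) = carrier S" by (simp add: topo_S carrier_S pro2_topspace[OF pro2])
  show "compact_space (topo S)"
    using pro2_compact[OF pro2] by (simp add: topo_S compact_space_prod_topology compact_space_discrete_topology)
  show "Hausdorff_space (topo S)"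
    using pro2_Hausdorff[OF pro2] by (simp add: topo_S Hausdorff_space_prod_topology)
  fix U x assume U: "openin (topo S) U" "x \<in> U"
  obtain g a where x: "x = (g, a)" by (cases x)
  have "\<forall>g a. (g, a) \<in> U \<longrightarrow> (\<exists>V W. openin (topo G) V \<and> openin (discrete_topology {0, 1}) W \<and>
      g \<in> V \<and> a \<in> W \<and> V \<times> W \<subseteq> U)"
    using U(1) unfolding topo_S openin_prod_topology_alt .
  from this[rule_format, OF U(2)[unfolded x]]
  obtain V W where V: "openin (topo G) V" "openin (discrete_topology {0, 1}) W" "g \<in> V" "a \<in> W" "V \<times> W \<subseteq> U"
    by (elim exE conjE)
  then have g: "g \<in> carrier G" and a: "a \<in> {0, 1}"
    using openin_subset[OF V(1)] by (auto simp: pro2_topspace[OF pro2])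
  obtain M\<^sub>0 where M0: "M\<^sub>0 \<lhd> G" "openin (topo G) M\<^sub>0" "M\<^sub>0 #>\<^bsub>G\<^esub> g \<subseteq> V"
    using pro2_coset_base[OF pro2 V(1,3)] by blast
  interpret M0: normal M\<^sub>0 G by fact
  interpret t: group_hom G G "\<theta> 1"
    by (rule cont_hom_group_hom[OF theta_1 G.is_group G.is_group])
  \<comment> \<open>Intersecting with the preimage under \<open>\<theta> 1\<close> makes the
    subgroup stable, because \<open>\<theta> 1\<close> squares to the identity and so exchanges the
    two conditions.\<close>
  define M where "M = M\<^sub>0 \<inter> {x \<in> carrier G. \<theta> 1 x \<in> M\<^sub>0}"
  have M: "M \<lhd> G"
    unfolding M_def by (rule G.normal_subgroup_intersect[OF M0(1) t.normal_vimage[OF M0(1)]])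
  have "openin (topo G) {x \<in> topspace (topo G). \<theta> 1 x \<in> M\<^sub>0}"
    by (rule openin_continuous_map_preimage[OF cont_homD(2)[OF theta_1] M0(2)])
  then have M_open: "openin (topo G) M"
    unfolding M_def using M0(2) by (simp add: pro2_topspace[OF pro2] openin_Int)
  have M_theta: "\<theta> b m \<in> M" if "b \<in> {0, 1}" "m \<in> M" for b m
  proof (cases "b = 0")
    case True
    then show ?thesis using that theta_0 by (simp add: M_def)
  next
    case False
    then have "b = 1" using that(1) by simp
    then show ?thesis using that theta_1_1 theta_closed[of 1 m] by (simp add: M_def)
  qed
  interpret M: normal M G by fact
  have coset: "M \<times> {0} #>\<^bsub>S\<^esub> (h, b) = (M #>\<^bsub>G\<^esub> h) \<times> {b}" if hb: "h \<in> carrier G" "b \<in> {0, 1}" for h b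
  proof -
    have "M \<times> {0} #>\<^bsub>S\<^esub> (h, b) = (\<lambda>m. (m, 0) \<otimes>\<^bsub>S\<^esub> (h, b)) ` M"
      unfolding r_coset_def by blast
    also have "(\<lambda>m. (m, 0) \<otimes>\<^bsub>S\<^esub> (h, b)) = (\<lambda>m. (m \<otimes>\<^bsub>G\<^esub> h, b))"
      using hb(2) theta_0[OF hb(1)] by (auto simp: mult_S)
    also have "(\<lambda>m. (m \<otimes>\<^bsub>G\<^esub> h, b)) ` M = (M #>\<^bsub>G\<^esub> h) \<times> {b}"
      unfolding r_coset_def by blast
    finally show ?thesis .
  qed
  have sub: "subgroup (M \<times> {0}) S"
  proof (rule S.subgroupI)
    show "M \<times> {0} \<subseteq> carrier S" using M.subset by (auto simp: carrier_S)
    show "M \<times> {0} \<noteq> {}" using M.one_closed by blast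
    show "inv\<^bsub>S\<^esub> u \<in> M \<times> {0}" if "u \<in> M \<times> {0}" for u
      using that M_theta M.subset by (auto simp: inv_S)
    show "u \<otimes>\<^bsub>S\<^esub> v \<in> M \<times> {0}" if "u \<in> M \<times> {0}" "v \<in> M \<times> {0}" for u v
      using that M_theta by (auto simp: mult_S)
  qed
  have "M \<times> {0} \<lhd> S"
  proof (rule S.normal_invI[OF sub])
    fix u v assume u: "u \<in> carrier S" and v: "v \<in> M \<times> {0 :: int}"
    obtain h b where h: "u = (h, b)" "h \<in> carrier G" "b \<in> {0, 1}" using u by (auto simp: carrier_S)
    obtain m where m: "v = (m, 0)" "m \<in> M" using v by auto
    have m': "\<theta> b m \<in> M" using M_theta h m by blast
    have "u \<otimes>\<^bsub>S\<^esub> v \<otimes>\<^bsub>S\<^esub> inv\<^bsub>S\<^esub> u = (h \<otimes>\<^bsub>G\<^esub> \<theta> b m \<otimes>\<^bsub>G\<^esub> inv\<^bsub>G\<^esub> h, 0)"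
    proof -
      have "\<theta> b (\<theta> b (inv\<^bsub>G\<^esub> h)) = inv\<^bsub>G\<^esub> h" using h(2,3) theta_0 theta_1_1 by auto
      then show ?thesis using h(2,3) unfolding h(1) m(1) by (auto simp: inv_S mult_S)
    qed
    then show "u \<otimes>\<^bsub>S\<^esub> v \<otimes>\<^bsub>S\<^esub> inv\<^bsub>S\<^esub> u \<in> M \<times> {0}" using M.inv_op_closed2[OF h(2) m'] by simp
  qed
  moreover have "\<exists>k. card (rcosets\<^bsub>S\<^esub> (M \<times> {0})) = 2 ^ k"
  proof -
    have "rcosets\<^bsub>S\<^esub> (M \<times> {0}) = (\<lambda>(C, b). C \<times> {b}) ` ((rcosets\<^bsub>G\<^esub> M) \<times> {0, 1})"
    proof
      show "rcosets\<^bsub>S\<^esub> (M \<times> {0}) \<subseteq> (\<lambda>(C, b). C \<times> {b}) ` ((rcosets\<^bsub>G\<^esub> M) \<times> {0, 1})"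
      proof
        fix D assume "D \<in> rcosets\<^bsub>S\<^esub> (M \<times> {0})"
        then obtain h b where "h \<in> carrier G" "b \<in> {0, 1}" "D = M \<times> {0} #>\<^bsub>S\<^esub> (h, b)"
          unfolding RCOSETS_def carrier_S by blast
        then have "D = (\<lambda>(C, b). C \<times> {b}) (M #>\<^bsub>G\<^esub> h, b)" "(M #>\<^bsub>G\<^esub> h, b) \<in> (rcosets\<^bsub>G\<^esub> M) \<times> {0, 1}"
          using coset by (auto simp: RCOSETS_def)
        then show "D \<in> (\<lambda>(C, b). C \<times> {b}) ` ((rcosets\<^bsub>G\<^esub> M) \<times> {0, 1})" by (rule image_eqI)
      qed
      show "(\<lambda>(C, b). C \<times> {b}) ` ((rcosets\<^bsub>G\<^esub> M) \<times> {0, 1}) \<subseteq> rcosets\<^bsub>S\<^esub> (M \<times> {0})"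
      proof clarify
        fix C and b :: int assume "C \<in> rcosets\<^bsub>G\<^esub> M" "b \<in> {0, 1}"
        then obtain h where h: "h \<in> carrier G" "C = M #>\<^bsub>G\<^esub> h" by (auto simp: RCOSETS_def)
        then have "C \<times> {b} = M \<times> {0} #>\<^bsub>S\<^esub> (h, b)" "(h, b) \<in> carrier S"
          using coset[OF h(1) \<open>b \<in> {0, 1}\<close>] \<open>b \<in> {0, 1}\<close> by (simp_all add: carrier_S)
        then show "C \<times> {b} \<in> rcosets\<^bsub>S\<^esub> (M \<times> {0})" unfolding RCOSETS_def by blast
      qed
    qed
    \<comment> \<open>Cosets are nonempty, so both C and b can be read off from C \<times>
      {b}.\<close>
    moreover have "inj_on (\<lambda>(C, b). C \<times> {b}) ((rcosets\<^bsub>G\<^esub> M) \<times> {0, 1 :: int})"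
      using M.rcosets_non_empty by (auto simp: inj_on_def times_eq_iff)
    ultimately have "card (rcosets\<^bsub>S\<^esub> (M \<times> {0})) = card (rcosets\<^bsub>G\<^esub> M) * 2"
      by (simp add: card_image card_cartesian_product)
    moreover obtain k where "card (rcosets\<^bsub>G\<^esub> M) = 2 ^ k" using pro2_index[OF pro2 M M_open] by blast
    ultimately have "card (rcosets\<^bsub>S\<^esub> (M \<times> {0})) = 2 ^ Suc k" by simp
    then show ?thesis by blast
  qed
  moreover have "M \<times> {0} #>\<^bsub>S\<^esub> x \<subseteq> U"
  proof -
    have "M #>\<^bsub>G\<^esub> g \<subseteq> M\<^sub>0 #>\<^bsub>G\<^esub> g" unfolding r_coset_def M_def by (rule UN_mono) simp_all
    then have "M #>\<^bsub>G\<^esub> g \<subseteq> V" using M0(3) by (rule subset_trans)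
    then have "(M #>\<^bsub>G\<^esub> g) \<times> {a} \<subseteq> V \<times> W" using V(4) by (intro Sigma_mono) simp_all
    then show ?thesis unfolding x coset[OF g a] using V(5) by (rule subset_trans)
  qed
  moreover have "openin (topo S) (M \<times> {0} #>\<^bsub>S\<^esub> y)" if "y \<in> carrier S" for y
  proof -
    obtain h b where h: "y = (h, b)" "h \<in> carrier G" "b \<in> {0, 1}"
      using \<open>y \<in> carrier S\<close> by (auto simp: carrier_S)
    then show ?thesis
      using coset[OF h(2,3)] open_rcoset[OF pro2 M_open h(2)] by (simp add: topo_S openin_prod_Times_iff)
  qed
  ultimately show "\<exists>M k. M \<lhd> S \<and> card (rcosets\<^bsub>S\<^esub> M) = 2 ^ k \<and> M #>\<^bsub>S\<^esub> x \<subseteq> U \<and>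
      (\<forall>y\<in>carrier S. openin (topo S) (M #>\<^bsub>S\<^esub> y))"
    by (intro exI[of _ "M \<times> {0}"]) blast
qed

lemma embed_cont_hom: "(\<lambda>g. (g, 0)) \<in> cont_hom G S"
  using theta_0
  by (auto simp: cont_hom_def carrier_S mult_S topo_S continuous_map_pairwise o_def intro!: homI)

lemma involution_S: "(\<one>\<^bsub>G\<^esub>, 1) \<in> carrier S" "(\<one>\<^bsub>G\<^esub>, 1) \<otimes>\<^bsub>S\<^esub> (\<one>\<^bsub>G\<^esub>, 1) = \<one>\<^bsub>S\<^esub>"
  using theta_one[of 1] by (simp_all add: carrier_S mult_S one_S)

text \<open>Conjugation by the involution is written without inverses; in this form it is the
  hypothesis \<open>conj\<close> of \<open>semidirect_universal\<close>.\<close>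

lemma involution_conj:
  assumes "g \<in> carrier G"
  shows "(\<one>\<^bsub>G\<^esub>, 1) \<otimes>\<^bsub>S\<^esub> (g, 0) = (\<theta> 1 g, 0) \<otimes>\<^bsub>S\<^esub> (\<one>\<^bsub>G\<^esub>, 1)"
  using assms theta_0 theta_closed[of 1 g] by (simp add: mult_S)

lemma decompose_S: "g \<in> carrier G \<Longrightarrow> (g, 0) \<otimes>\<^bsub>S\<^esub> (\<one>\<^bsub>G\<^esub>, 1) = (g, 1)"
  using theta_0 by (simp add: mult_S)

text \<open>Every element is some (g, 0) or, by \<open>decompose_S\<close>, such an element times
  the involution.\<close>

lemma semidirect_hom_eq:
  assumes f: "f \<in> hom S K" and f': "f' \<in> hom S K"
    and G: "\<And>g. g \<in> carrier G \<Longrightarrow> f (g, 0) = f' (g, 0)" and "f (\<one>\<^bsub>G\<^esub>, 1) = f' (\<one>\<^bsub>G\<^esub>, 1)"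
    and x: "x \<in> carrier S"
  shows "f x = f' x"
proof -
  obtain g a where g: "x = (g, a)" "g \<in> carrier G" "a \<in> {0, 1}" using x by (auto simp: carrier_S)
  have "f (g, 1) = f' (g, 1)"
    unfolding decompose_S[OF g(2), symmetric]
    using hom_mult[OF f] hom_mult[OF f'] G[OF g(2)] assms(4) involution_S(1) g(2)
    by (simp add: carrier_S del: mult_S)
  then show ?thesis using G g by auto
qed

lemma semidirect_universal:
  assumes K: "pro2_group K" and f: "f \<in> cont_hom G K" and s: "s \<in> carrier K" "s \<otimes>\<^bsub>K\<^esub> s = \<one>\<^bsub>K\<^esub>"
    and conj: "\<And>g. g \<in> carrier G \<Longrightarrow> s \<otimes>\<^bsub>K\<^esub> f g = f (\<theta> 1 g) \<otimes>\<^bsub>K\<^esub> s"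
  shows "\<exists>\<phi>\<in>cont_hom S K. (\<forall>g\<in>carrier G. \<phi> (g, 0) = f g) \<and> \<phi> (\<one>\<^bsub>G\<^esub>, 1) = s"
proof -
  interpret K: group K using K by (rule pro2_group_is_group)
  define c where "c a = (if a = 1 then s else \<one>\<^bsub>K\<^esub>)" for a :: int
  define \<phi> where "\<phi> p = f (fst p) \<otimes>\<^bsub>K\<^esub> c (snd p)" for p
  have c_closed: "c a \<in> carrier K" for a using s by (simp add: c_def)
  have c_conj: "c a \<otimes>\<^bsub>K\<^esub> f g = f (\<theta> a g) \<otimes>\<^bsub>K\<^esub> c a" if "a \<in> {0, 1}" "g \<in> carrier G" for a g
    using that conj cont_hom_closed[OF f] theta_0 by (auto simp: c_def)
  have c_mult: "c a \<otimes>\<^bsub>K\<^esub> c b = c ((a + b) mod 2)" if "a \<in> {0, 1}" "b \<in> {0, 1}" for a b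
    using that s by (auto simp: c_def)
  have "\<phi> \<in> hom S K"
  proof (rule homI)
    fix x y assume "x \<in> carrier S" "y \<in> carrier S"
    then obtain g a h b where x: "x = (g, a)" "g \<in> carrier G" "a \<in> {0, 1}"
      and y: "y = (h, b)" "h \<in> carrier G" "b \<in> {0, 1}" by (auto simp: carrier_S)
    note cl = cont_hom_closed[OF f x(2)] cont_hom_closed[OF f y(2)] cont_hom_closed[OF f theta_closed[OF x(3) y(2)]]
    show "\<phi> x \<in> carrier K" using x cl c_closed by (simp add: \<phi>_def)
    have "\<phi> x \<otimes>\<^bsub>K\<^esub> \<phi> y = f g \<otimes>\<^bsub>K\<^esub> (c a \<otimes>\<^bsub>K\<^esub> f h) \<otimes>\<^bsub>K\<^esub> c b"
      using x(1) y(1) cl c_closed by (simp add: \<phi>_def K.m_assoc)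
    also have "\<dots> = f g \<otimes>\<^bsub>K\<^esub> f (\<theta> a h) \<otimes>\<^bsub>K\<^esub> (c a \<otimes>\<^bsub>K\<^esub> c b)"
      unfolding c_conj[OF x(3) y(2)] using cl c_closed by (simp add: K.m_assoc)
    also have "\<dots> = \<phi> (x \<otimes>\<^bsub>S\<^esub> y)"
      using c_mult[OF x(3) y(3)] cont_hom_mult[OF f x(2) theta_closed[OF x(3) y(2)]]
      by (simp add: x(1) y(1) mult_S \<phi>_def)
    finally show "\<phi> (x \<otimes>\<^bsub>S\<^esub> y) = \<phi> x \<otimes>\<^bsub>K\<^esub> \<phi> y" by simp
  qed
  moreover have "continuous_map (topo S) (topo K) \<phi>"
    unfolding \<phi>_def[abs_def] topo_S
  proof (intro continuous_map_mult[OF K])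
    show "continuous_map (prod_topology (topo G) (discrete_topology {0, 1})) (topo K) (\<lambda>p. f (fst p))"
      by (rule continuous_map_compose[OF continuous_map_fst cont_homD(2)[OF f], unfolded o_def])
    have "continuous_map (discrete_topology {0, 1}) (topo K) c"
      using c_closed by (simp add: pro2_topspace[OF K])
    then show "continuous_map (prod_topology (topo G) (discrete_topology {0, 1})) (topo K) (\<lambda>p. c (snd p))"
      by (rule continuous_map_compose[OF continuous_map_snd, unfolded o_def])
  qed
  ultimately have "\<phi> \<in> cont_hom S K" by (simp add: cont_hom_def)
  moreover have "\<phi> (g, 0) = f g" if "g \<in> carrier G" for g
    using cont_hom_closed[OF f that] by (simp add: \<phi>_def c_def)
  moreover have "\<phi> (\<one>\<^bsub>G\<^esub>, 1) = s"
    using cont_hom_one[OF f G.is_group K.is_group] s by (simp add: \<phi>_def c_def)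
  ultimately show ?thesis by blast
qed

end

section \<open>Actions of \<open>Delta\<close> and involutive endomorphisms\<close>

text \<open>Multiplication in \<open>AutoGroup\<close> is composition restricted to the carrier. So
  0 acts as the identity there, and 1 + 1 = 0 in \<open>Delta\<close> makes
  \<open>\<delta> 1\<close> an involution.\<close>

lemma delta_action_semidirect:
  assumes \<Gamma>: "ugraph \<Gamma>" and \<delta>: "delta_action \<Gamma> z \<delta>"
  shows "delta_semidirect (raag \<Gamma>) \<delta>"
proof
  let ?G = "raag \<Gamma>"
  show "pro2_group ?G" by (rule pro2_raag[OF \<Gamma>])
  then interpret G: group ?G by (rule pro2_group_is_group)
  \<comment> \<open>\<open>Delta\<close> takes its operations from
    \<open>integer_mod_group 2\<close> but is a different record, so the group axioms are
    transferred by unfolding.\<close>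
  have D: "group Delta"
    using group_integer_mod_group[of 2] unfolding Delta_def
    by (simp add: group_def monoid_def group_axioms_def Units_def)
  interpret d: group_hom Delta "AutoGroup ?G" \<delta>
    using \<delta> D G.AutoGroup by (simp add: group_hom_def group_hom_axioms_def delta_action_def)
  show 0: "\<delta> 0 x = x" if "x \<in> carrier ?G" for x
    using d.hom_one that by (simp add: one_Delta AutoGroup_def BijGroup_def)
  have auto: "\<delta> 1 \<in> auto ?G" using d.hom_closed[of 1] by (simp add: carrier_Delta AutoGroup_def)
  then show "\<delta> 1 \<in> cont_hom ?G ?G"
    using \<delta> by (simp add: cont_hom_def auto_def delta_action_def carrier_Delta)
  have "\<delta> (1 \<otimes>\<^bsub>Delta\<^esub> 1) = \<delta> 1 \<otimes>\<^bsub>AutoGroup ?G\<^esub> \<delta> 1" by (rule d.hom_mult) (simp_all add: carrier_Delta)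
  then have "\<delta> 0 = compose (carrier ?G) (\<delta> 1) (\<delta> 1)"
    using auto by (simp add: mult_Delta AutoGroup_def BijGroup_def auto_def)
  then show "\<delta> 1 (\<delta> 1 x) = x" if "x \<in> carrier ?G" for x
    using 0[OF that] that by (simp add: compose_def)
qed

text \<open>Members of \<open>auto\<close> are extensional, which is why the maps are restricted to
  the carrier. Being its own inverse, \<sigma> is bijective there.\<close>

lemma delta_actionI:
  assumes \<Gamma>: "ugraph \<Gamma>" and z: "\<And>i. i \<in> {1..nverts \<Gamma>} \<Longrightarrow> z i \<in> carrier (raag \<Gamma>)"
    and \<sigma>: "\<sigma> \<in> cont_hom (raag \<Gamma>) (raag \<Gamma>)" and inv: "\<And>x. x \<in> carrier (raag \<Gamma>) \<Longrightarrow> \<sigma> (\<sigma> x) = x"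
    and gen: "\<And>i. i \<in> {1..nverts \<Gamma>} \<Longrightarrow> \<sigma> (raag_gen \<Gamma> i) =
      inv\<^bsub>raag \<Gamma>\<^esub> (z i) \<otimes>\<^bsub>raag \<Gamma>\<^esub> inv\<^bsub>raag \<Gamma>\<^esub> (raag_gen \<Gamma> i) \<otimes>\<^bsub>raag \<Gamma>\<^esub> z i"
  shows "delta_action \<Gamma> z (\<lambda>s. restrict (if s = 0 then id else \<sigma>) (carrier (raag \<Gamma>)))"
proof -
  let ?G = "raag \<Gamma>"
  interpret G: group ?G by (rule pro2_group_is_group[OF pro2_raag[OF \<Gamma>]])
  note top = pro2_topspace[OF pro2_raag[OF \<Gamma>]]
  define \<delta> where "\<delta> s = restrict (if s = (0::int) then id else \<sigma>) (carrier ?G)" for s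
  have s_cl: "\<sigma> x \<in> carrier ?G" if "x \<in> carrier ?G" for x using cont_hom_closed[OF \<sigma> that] .
  have "bij_betw \<sigma> (carrier ?G) (carrier ?G)"
    by (rule bij_betw_byWitness[of _ \<sigma>]) (use inv s_cl in auto)
  then have "bij_betw (\<delta> s) (carrier ?G) (carrier ?G)" for s
    using bij_betw_id[of "carrier ?G"] by (auto simp: \<delta>_def cong: bij_betw_cong)
  moreover have "\<delta> s \<in> hom ?G ?G" for s
    using s_cl cont_hom_mult[OF \<sigma>] by (intro homI) (auto simp: \<delta>_def)
  ultimately have auto: "\<delta> s \<in> auto ?G" for s
    by (simp add: auto_def Bij_def) (simp add: \<delta>_def)
  have "\<delta> \<in> hom Delta (AutoGroup ?G)"
  proof (rule homI)
    show "\<delta> s \<in> carrier (AutoGroup ?G)" for s using auto by (simp add: AutoGroup_def)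
    fix s t assume "s \<in> carrier Delta" "t \<in> carrier Delta"
    then have "\<delta> (s \<otimes>\<^bsub>Delta\<^esub> t) = compose (carrier ?G) (\<delta> s) (\<delta> t)"
      using s_cl inv by (auto simp: carrier_Delta mult_Delta \<delta>_def compose_def intro!: restrict_ext)
    then show "\<delta> (s \<otimes>\<^bsub>Delta\<^esub> t) = \<delta> s \<otimes>\<^bsub>AutoGroup ?G\<^esub> \<delta> t"
      using auto[of s] auto[of t] by (simp add: AutoGroup_def BijGroup_def auto_def)
  qed
  moreover have "continuous_map (topo ?G) (topo ?G) (\<delta> s)" for s
    by (rule continuous_map_eq[of _ _ "if s = 0 then id else \<sigma>"])
      (use cont_homD(2)[OF \<sigma>] in \<open>auto simp: \<delta>_def top\<close>)
  moreover have "\<delta> 1 (raag_gen \<Gamma> i) =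
      inv\<^bsub>?G\<^esub> (z i) \<otimes>\<^bsub>?G\<^esub> inv\<^bsub>?G\<^esub> (raag_gen \<Gamma> i) \<otimes>\<^bsub>?G\<^esub> z i" if "i \<in> {1..nverts \<Gamma>}" for i
    using gen[OF that] raag_gen_closed[OF \<Gamma> that] by (simp add: \<delta>_def)
  ultimately show ?thesis unfolding \<delta>_def[abs_def, symmetric] using z by (simp add: delta_action_def)
qed

section \<open>Coproducts\<close>

lemma ugraph_union:
  assumes "ugraph \<Gamma>" "ugraph \<Gamma>'"
  shows "ugraph (graph_union \<Gamma> \<Gamma>')"
  unfolding ugraph_def
proof
  fix e assume "e \<in> edges (graph_union \<Gamma> \<Gamma>')"
  then consider "e \<in> edges \<Gamma>" | e' where "e' \<in> edges \<Gamma>'" "e = (\<lambda>j. nverts \<Gamma> + j) ` e'"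
    by (auto simp: graph_union_def)
  then show "e \<subseteq> {1..nverts (graph_union \<Gamma> \<Gamma>')} \<and> card e = 2"
  proof cases
    case 1
    then show ?thesis using assms(1) by (fastforce simp: ugraph_def graph_union_def)
  next
    case 2
    then have "e' \<subseteq> {1..nverts \<Gamma>'}" "card e' = 2" using assms(2) by (auto simp: ugraph_def)
    then show ?thesis using 2(2) by (auto simp: graph_union_def card_image)
  qed
qed

lemma ugraph_point_graph: "ugraph point_graph"
  by (simp add: ugraph_def point_graph_def)

lemma conj_cont_hom:
  assumes G: "pro2_group G" and c: "c \<in> carrier G"
  shows "(\<lambda>x. c \<otimes>\<^bsub>G\<^esub> x \<otimes>\<^bsub>G\<^esub> inv\<^bsub>G\<^esub> c) \<in> cont_hom G G"
proof -
  interpret group G using G by (rule pro2_group_is_group)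
  have "(\<lambda>x. c \<otimes>\<^bsub>G\<^esub> x \<otimes>\<^bsub>G\<^esub> inv\<^bsub>G\<^esub> c) \<in> hom G G"
    using c by (intro homI) (auto simp: m_assoc inv_mult_cancel)
  moreover have "continuous_map (topo G) (topo G) (\<lambda>x. c \<otimes>\<^bsub>G\<^esub> x \<otimes>\<^bsub>G\<^esub> inv\<^bsub>G\<^esub> c)"
    using c by (intro continuous_map_mult[OF G]) (auto simp: pro2_topspace[OF G])
  ultimately show ?thesis by (simp add: cont_hom_def)
qed

lemma id_cont_hom: "(\<lambda>x. x) \<in> cont_hom G G"
  by (auto simp: cont_hom_def intro!: homI)

section \<open>The RAAG of the disjoint union with an added vertex\<close>

locale two_delta_raags =
  fixes \<Gamma>\<^sub>1 \<Gamma>\<^sub>2 :: graph and z\<^sub>1 z\<^sub>2 :: "nat \<Rightarrow> raag_elt" and \<delta>\<^sub>1 \<delta>\<^sub>2 :: "int \<Rightarrow> raag_elt \<Rightarrow> raag_elt"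
  assumes ug1: "ugraph \<Gamma>\<^sub>1" and ug2: "ugraph \<Gamma>\<^sub>2"
    and action1: "delta_action \<Gamma>\<^sub>1 z\<^sub>1 \<delta>\<^sub>1" and action2: "delta_action \<Gamma>\<^sub>2 z\<^sub>2 \<delta>\<^sub>2"
begin

abbreviation "d\<^sub>1 \<equiv> nverts \<Gamma>\<^sub>1"
abbreviation "d\<^sub>2 \<equiv> nverts \<Gamma>\<^sub>2"
abbreviation "\<Gamma>' \<equiv> graph_union (graph_union \<Gamma>\<^sub>1 \<Gamma>\<^sub>2) point_graph"
abbreviation "G \<equiv> raag \<Gamma>'"
abbreviation "x \<equiv> raag_gen \<Gamma>'"
definition "\<zeta> = x (d\<^sub>1 + d\<^sub>2 + 1)"

lemma ug': "ugraph \<Gamma>'"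
  by (simp add: ug1 ug2 ugraph_union ugraph_point_graph)

lemma nverts_\<Gamma>': "nverts \<Gamma>' = d\<^sub>1 + d\<^sub>2 + 1"
  by (simp add: graph_union_def point_graph_def)

lemma edges_\<Gamma>': "edges \<Gamma>' = edges \<Gamma>\<^sub>1 \<union> (\<lambda>e. (\<lambda>j. d\<^sub>1 + j) ` e) ` edges \<Gamma>\<^sub>2"
  by (simp add: graph_union_def point_graph_def)

text \<open>The added vertex is isolated and so occurs in neither case. As the shift by
  \<open>d\<^sub>1\<close> is injective, k and l recover the whole original edge of the second
  graph.\<close>

lemma edge_cases:
  assumes "{i, j} \<in> edges \<Gamma>'"
  obtains "{i, j} \<in> edges \<Gamma>\<^sub>1"
  | k l where "{k, l} \<in> edges \<Gamma>\<^sub>2" "i = d\<^sub>1 + k" "j = d\<^sub>1 + l"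
proof -
  have "{i, j} \<in> edges \<Gamma>\<^sub>1 \<or> (\<exists>k l. {k, l} \<in> edges \<Gamma>\<^sub>2 \<and> i = d\<^sub>1 + k \<and> j = d\<^sub>1 + l)"
  proof (cases "{i, j} \<in> edges \<Gamma>\<^sub>1")
    case False
    then obtain e where e: "e \<in> edges \<Gamma>\<^sub>2" "{i, j} = (\<lambda>j. d\<^sub>1 + j) ` e"
      using assms edges_\<Gamma>' by auto
    then obtain k l where kl: "k \<in> e" "l \<in> e" "i = d\<^sub>1 + k" "j = d\<^sub>1 + l" by (metis imageE insertI1 insertI2)
    have "e = {k, l}"
    proof
      show "{k, l} \<subseteq> e" using kl by simp
      show "e \<subseteq> {k, l}"
      proof
        fix m assume "m \<in> e"
        then have "d\<^sub>1 + m \<in> {i, j}" unfolding e(2) by (rule imageI)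
        then show "m \<in> {k, l}" using kl(3,4) by auto
      qed
    qed
    then show ?thesis using e(1) kl by blast
  qed simp
  then show thesis using that by blast
qed

sublocale G: group G
  by (rule pro2_group_is_group[OF pro2_raag[OF ug']])

lemma x_closed: "i \<in> {1..d\<^sub>1 + d\<^sub>2 + 1} \<Longrightarrow> x i \<in> carrier G"
  using raag_gen_closed[OF ug'] nverts_\<Gamma>' by simp

lemma zeta_closed: "\<zeta> \<in> carrier G"
  unfolding \<zeta>_def by (rule x_closed) simp

text \<open>The map is picked once from the universal property so that later definitions can refer
  to it. By \<open>raag_hom_eq\<close> its values on the carrier do not depend on the
  choice.\<close>

definition \<epsilon>\<^sub>1 :: "raag_elt \<Rightarrow> raag_elt" where
  "\<epsilon>\<^sub>1 = (SOME e. e \<in> cont_hom (raag \<Gamma>\<^sub>1) G \<and> (\<forall>j\<in>{1..d\<^sub>1}. e (raag_gen \<Gamma>\<^sub>1 j) = x j))"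

definition \<epsilon>\<^sub>2 :: "raag_elt \<Rightarrow> raag_elt" where
  "\<epsilon>\<^sub>2 = (SOME e. e \<in> cont_hom (raag \<Gamma>\<^sub>2) G \<and> (\<forall>j\<in>{1..d\<^sub>2}. e (raag_gen \<Gamma>\<^sub>2 j) = x (d\<^sub>1 + j)))"

lemma \<epsilon>\<^sub>1: "\<epsilon>\<^sub>1 \<in> cont_hom (raag \<Gamma>\<^sub>1) G" and \<epsilon>\<^sub>1_gen: "j \<in> {1..d\<^sub>1} \<Longrightarrow> \<epsilon>\<^sub>1 (raag_gen \<Gamma>\<^sub>1 j) = x j"
proof -
  have "x i \<otimes>\<^bsub>G\<^esub> x j = x j \<otimes>\<^bsub>G\<^esub> x i" if "{i, j} \<in> edges \<Gamma>\<^sub>1" for i j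
    using that by (intro raag_gen_commute[OF ug']) (simp add: edges_\<Gamma>')
  then have "\<exists>e\<in>cont_hom (raag \<Gamma>\<^sub>1) G. \<forall>j\<in>{1..d\<^sub>1}. e (raag_gen \<Gamma>\<^sub>1 j) = x j"
    by (intro raag_universal[OF ug1 pro2_raag[OF ug']] x_closed) auto
  then have "\<exists>e. e \<in> cont_hom (raag \<Gamma>\<^sub>1) G \<and> (\<forall>j\<in>{1..d\<^sub>1}. e (raag_gen \<Gamma>\<^sub>1 j) = x j)" by blast
  from someI_ex[OF this]
  show "\<epsilon>\<^sub>1 \<in> cont_hom (raag \<Gamma>\<^sub>1) G" "j \<in> {1..d\<^sub>1} \<Longrightarrow> \<epsilon>\<^sub>1 (raag_gen \<Gamma>\<^sub>1 j) = x j"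
    unfolding \<epsilon>\<^sub>1_def by blast+
qed

lemma \<epsilon>\<^sub>2: "\<epsilon>\<^sub>2 \<in> cont_hom (raag \<Gamma>\<^sub>2) G" and \<epsilon>\<^sub>2_gen: "j \<in> {1..d\<^sub>2} \<Longrightarrow> \<epsilon>\<^sub>2 (raag_gen \<Gamma>\<^sub>2 j) = x (d\<^sub>1 + j)"
proof -
  have "x (d\<^sub>1 + i) \<otimes>\<^bsub>G\<^esub> x (d\<^sub>1 + j) = x (d\<^sub>1 + j) \<otimes>\<^bsub>G\<^esub> x (d\<^sub>1 + i)" if e: "{i, j} \<in> edges \<Gamma>\<^sub>2" for i j
  proof (rule raag_gen_commute[OF ug'])
    have "{d\<^sub>1 + i, d\<^sub>1 + j} = (\<lambda>j. d\<^sub>1 + j) ` {i, j}" by simp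
    then show "{d\<^sub>1 + i, d\<^sub>1 + j} \<in> edges \<Gamma>'" unfolding edges_\<Gamma>' using e by blast
  qed
  then have "\<exists>e\<in>cont_hom (raag \<Gamma>\<^sub>2) G. \<forall>j\<in>{1..d\<^sub>2}. e (raag_gen \<Gamma>\<^sub>2 j) = x (d\<^sub>1 + j)"
    by (intro raag_universal[OF ug2 pro2_raag[OF ug']] x_closed) auto
  then have "\<exists>e. e \<in> cont_hom (raag \<Gamma>\<^sub>2) G \<and> (\<forall>j\<in>{1..d\<^sub>2}. e (raag_gen \<Gamma>\<^sub>2 j) = x (d\<^sub>1 + j))" by blast
  from someI_ex[OF this]
  show "\<epsilon>\<^sub>2 \<in> cont_hom (raag \<Gamma>\<^sub>2) G" "j \<in> {1..d\<^sub>2} \<Longrightarrow> \<epsilon>\<^sub>2 (raag_gen \<Gamma>\<^sub>2 j) = x (d\<^sub>1 + j)"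
    unfolding \<epsilon>\<^sub>2_def by blast+
qed

text \<open>Uniqueness and existence for the coproduct of the two RAAGs and the procyclic group generated
  by \<open>\<zeta>\<close>.\<close>

lemma G_hom_eq:
  assumes K: "group K" "Hausdorff_space (topo K)" and f: "f \<in> cont_hom G K" and g: "g \<in> cont_hom G K"
    and eq1: "\<And>y. y \<in> carrier (raag \<Gamma>\<^sub>1) \<Longrightarrow> f (\<epsilon>\<^sub>1 y) = g (\<epsilon>\<^sub>1 y)"
    and eq2: "\<And>y. y \<in> carrier (raag \<Gamma>\<^sub>2) \<Longrightarrow> f (\<epsilon>\<^sub>2 y) = g (\<epsilon>\<^sub>2 y)"
    and eq0: "f \<zeta> = g \<zeta>" and y: "y \<in> carrier G"
  shows "f y = g y"
proof (rule raag_hom_eq[OF ug' K f g _ y])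
  fix i assume "i \<in> {1..nverts \<Gamma>'}"
  then consider "i \<in> {1..d\<^sub>1}" | j where "j \<in> {1..d\<^sub>2}" "i = d\<^sub>1 + j" | "i = d\<^sub>1 + d\<^sub>2 + 1"
  proof -
    have "i \<in> {1..d\<^sub>1} \<or> (i - d\<^sub>1 \<in> {1..d\<^sub>2} \<and> i = d\<^sub>1 + (i - d\<^sub>1)) \<or> i = d\<^sub>1 + d\<^sub>2 + 1"
      using \<open>i \<in> {1..nverts \<Gamma>'}\<close> unfolding nverts_\<Gamma>' by auto
    then show thesis using that by blast
  qed
  then show "f (x i) = g (x i)"
  proof cases
    case 1
    then show ?thesis using eq1[OF raag_gen_closed[OF ug1 1]] \<epsilon>\<^sub>1_gen[OF 1] by simp
  next
    case 2
    then show ?thesis using eq2[OF raag_gen_closed[OF ug2 2(1)]] \<epsilon>\<^sub>2_gen[OF 2(1)] by simp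
  next
    case 3
    show ?thesis unfolding 3 using eq0 unfolding \<zeta>_def .
  qed
qed

lemma G_universal:
  assumes K: "pro2_group K" and f1: "f\<^sub>1 \<in> cont_hom (raag \<Gamma>\<^sub>1) K" and f2: "f\<^sub>2 \<in> cont_hom (raag \<Gamma>\<^sub>2) K"
    and c: "c \<in> carrier K"
  shows "\<exists>\<phi>\<in>cont_hom G K. (\<forall>y\<in>carrier (raag \<Gamma>\<^sub>1). \<phi> (\<epsilon>\<^sub>1 y) = f\<^sub>1 y) \<and>
    (\<forall>y\<in>carrier (raag \<Gamma>\<^sub>2). \<phi> (\<epsilon>\<^sub>2 y) = f\<^sub>2 y) \<and> \<phi> \<zeta> = c"
proof -
  \<comment> \<open>The three branches are the three blocks of vertices, the middle one shifted back
    by \<open>d\<^sub>1\<close>. Edges lie inside the first or inside the second block, so c is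
    subject to no relation.\<close>
  define k where "k i = (if i \<le> d\<^sub>1 then f\<^sub>1 (raag_gen \<Gamma>\<^sub>1 i)
    else if i \<le> d\<^sub>1 + d\<^sub>2 then f\<^sub>2 (raag_gen \<Gamma>\<^sub>2 (i - d\<^sub>1)) else c)" for i
  have k1: "k i = f\<^sub>1 (raag_gen \<Gamma>\<^sub>1 i)" if "i \<in> {1..d\<^sub>1}" for i using that by (simp add: k_def)
  have k2: "k (d\<^sub>1 + i) = f\<^sub>2 (raag_gen \<Gamma>\<^sub>2 i)" if "i \<in> {1..d\<^sub>2}" for i using that by (simp add: k_def)
  have "\<exists>\<phi>\<in>cont_hom G K. \<forall>i\<in>{1..nverts \<Gamma>'}. \<phi> (x i) = k i"
  proof (rule raag_universal[OF ug' K])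
    fix i assume "i \<in> {1..nverts \<Gamma>'}"
    then have "i \<in> {1..d\<^sub>1 + d\<^sub>2 + 1}" by (simp add: nverts_\<Gamma>')
    then consider "i \<in> {1..d\<^sub>1}" | "\<not> i \<le> d\<^sub>1" "i - d\<^sub>1 \<in> {1..d\<^sub>2}" | "\<not> i \<le> d\<^sub>1 + d\<^sub>2" by fastforce
    then show "k i \<in> carrier K"
    proof cases
      case 1
      then show ?thesis using cont_hom_closed[OF f1 raag_gen_closed[OF ug1 1]] by (simp add: k1)
    next
      case 2
      then show ?thesis using cont_hom_closed[OF f2 raag_gen_closed[OF ug2 2(2)]] c by (simp add: k_def)
    next
      case 3
      then show ?thesis using c by (simp add: k_def)
    qed
  next
    fix i j assume "{i, j} \<in> edges \<Gamma>'"
    then show "k i \<otimes>\<^bsub>K\<^esub> k j = k j \<otimes>\<^bsub>K\<^esub> k i"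
    proof (cases rule: edge_cases)
      case 1
      note ij = ugraph_edge[OF ug1 1]
      note cl = raag_gen_closed[OF ug1 ij(1)] raag_gen_closed[OF ug1 ij(2)]
      show ?thesis
        unfolding k1[OF ij(1)] k1[OF ij(2)]
        using cont_hom_mult[OF f1 cl] cont_hom_mult[OF f1 cl(2,1)] raag_gen_commute[OF ug1 1] by simp
    next
      case (2 m l)
      note ij = ugraph_edge[OF ug2 2(1)]
      note cl = raag_gen_closed[OF ug2 ij(1)] raag_gen_closed[OF ug2 ij(2)]
      show ?thesis
        unfolding 2(2,3) k2[OF ij(1)] k2[OF ij(2)]
        using cont_hom_mult[OF f2 cl] cont_hom_mult[OF f2 cl(2,1)] raag_gen_commute[OF ug2 2(1)] by simp
    qed
  qed
  then obtain \<phi> where \<phi>: "\<phi> \<in> cont_hom G K" and \<phi>x: "\<And>i. i \<in> {1..nverts \<Gamma>'} \<Longrightarrow> \<phi> (x i) = k i" by blast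
  have "\<phi> (\<epsilon>\<^sub>1 y) = f\<^sub>1 y" if "y \<in> carrier (raag \<Gamma>\<^sub>1)" for y
  proof (rule raag_hom_eq[OF ug1 pro2_group_is_group[OF K] pro2_Hausdorff[OF K] cont_hom_compose[OF \<epsilon>\<^sub>1 \<phi>] f1 _ that])
    fix i assume i: "i \<in> {1..d\<^sub>1}"
    then have "i \<in> {1..nverts \<Gamma>'}" by (simp add: nverts_\<Gamma>')
    from \<phi>x[OF this] show "\<phi> (\<epsilon>\<^sub>1 (raag_gen \<Gamma>\<^sub>1 i)) = f\<^sub>1 (raag_gen \<Gamma>\<^sub>1 i)" by (simp only: \<epsilon>\<^sub>1_gen[OF i] k1[OF i])
  qed
  moreover have "\<phi> (\<epsilon>\<^sub>2 y) = f\<^sub>2 y" if "y \<in> carrier (raag \<Gamma>\<^sub>2)" for y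
  proof (rule raag_hom_eq[OF ug2 pro2_group_is_group[OF K] pro2_Hausdorff[OF K] cont_hom_compose[OF \<epsilon>\<^sub>2 \<phi>] f2 _ that])
    fix i assume i: "i \<in> {1..d\<^sub>2}"
    then have "d\<^sub>1 + i \<in> {1..nverts \<Gamma>'}" by (simp add: nverts_\<Gamma>')
    from \<phi>x[OF this] show "\<phi> (\<epsilon>\<^sub>2 (raag_gen \<Gamma>\<^sub>2 i)) = f\<^sub>2 (raag_gen \<Gamma>\<^sub>2 i)" by (simp only: \<epsilon>\<^sub>2_gen[OF i] k2[OF i])
  qed
  moreover have "\<phi> \<zeta> = c" using \<phi>x[of "d\<^sub>1 + d\<^sub>2 + 1"] by (simp add: \<zeta>_def nverts_\<Gamma>' k_def)
  ultimately show ?thesis using \<phi> by blast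
qed

section \<open>The involution on the new RAAG and its vector\<close>

sublocale S1: delta_semidirect "raag \<Gamma>\<^sub>1" \<delta>\<^sub>1
  using delta_action_semidirect[OF ug1 action1] .

sublocale S2: delta_semidirect "raag \<Gamma>\<^sub>2" \<delta>\<^sub>2
  using delta_action_semidirect[OF ug2 action2] .

lemma \<epsilon>\<^sub>1_closed: "y \<in> carrier (raag \<Gamma>\<^sub>1) \<Longrightarrow> \<epsilon>\<^sub>1 y \<in> carrier G"
  by (rule cont_hom_closed[OF \<epsilon>\<^sub>1])

lemma \<epsilon>\<^sub>2_closed: "y \<in> carrier (raag \<Gamma>\<^sub>2) \<Longrightarrow> \<epsilon>\<^sub>2 y \<in> carrier G"
  by (rule cont_hom_closed[OF \<epsilon>\<^sub>2])

definition \<sigma> :: "raag_elt \<Rightarrow> raag_elt" where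
  "\<sigma> = (SOME s. s \<in> cont_hom G G \<and> (\<forall>y\<in>carrier (raag \<Gamma>\<^sub>1). s (\<epsilon>\<^sub>1 y) = \<epsilon>\<^sub>1 (\<delta>\<^sub>1 1 y)) \<and>
    (\<forall>y\<in>carrier (raag \<Gamma>\<^sub>2). s (\<epsilon>\<^sub>2 y) = \<zeta> \<otimes>\<^bsub>G\<^esub> \<epsilon>\<^sub>2 (\<delta>\<^sub>2 1 y) \<otimes>\<^bsub>G\<^esub> inv\<^bsub>G\<^esub> \<zeta>) \<and> s \<zeta> = inv\<^bsub>G\<^esub> \<zeta>)"

lemma
  shows \<sigma>: "\<sigma> \<in> cont_hom G G"
    and \<sigma>_1: "y \<in> carrier (raag \<Gamma>\<^sub>1) \<Longrightarrow> \<sigma> (\<epsilon>\<^sub>1 y) = \<epsilon>\<^sub>1 (\<delta>\<^sub>1 1 y)"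
    and \<sigma>_2: "y \<in> carrier (raag \<Gamma>\<^sub>2) \<Longrightarrow> \<sigma> (\<epsilon>\<^sub>2 y) = \<zeta> \<otimes>\<^bsub>G\<^esub> \<epsilon>\<^sub>2 (\<delta>\<^sub>2 1 y) \<otimes>\<^bsub>G\<^esub> inv\<^bsub>G\<^esub> \<zeta>"
    and \<sigma>_zeta: "\<sigma> \<zeta> = inv\<^bsub>G\<^esub> \<zeta>"
proof -
  have "\<exists>s\<in>cont_hom G G. (\<forall>y\<in>carrier (raag \<Gamma>\<^sub>1). s (\<epsilon>\<^sub>1 y) = \<epsilon>\<^sub>1 (\<delta>\<^sub>1 1 y)) \<and>
      (\<forall>y\<in>carrier (raag \<Gamma>\<^sub>2). s (\<epsilon>\<^sub>2 y) = \<zeta> \<otimes>\<^bsub>G\<^esub> \<epsilon>\<^sub>2 (\<delta>\<^sub>2 1 y) \<otimes>\<^bsub>G\<^esub> inv\<^bsub>G\<^esub> \<zeta>) \<and> s \<zeta> = inv\<^bsub>G\<^esub> \<zeta>"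
    by (rule G_universal[OF pro2_raag[OF ug'] cont_hom_compose[OF S1.theta_1 \<epsilon>\<^sub>1]
          cont_hom_compose[OF cont_hom_compose[OF S2.theta_1 \<epsilon>\<^sub>2] conj_cont_hom[OF pro2_raag[OF ug'] zeta_closed]]
          G.inv_closed[OF zeta_closed]])
  then have "\<exists>s. s \<in> cont_hom G G \<and> (\<forall>y\<in>carrier (raag \<Gamma>\<^sub>1). s (\<epsilon>\<^sub>1 y) = \<epsilon>\<^sub>1 (\<delta>\<^sub>1 1 y)) \<and>
    (\<forall>y\<in>carrier (raag \<Gamma>\<^sub>2). s (\<epsilon>\<^sub>2 y) = \<zeta> \<otimes>\<^bsub>G\<^esub> \<epsilon>\<^sub>2 (\<delta>\<^sub>2 1 y) \<otimes>\<^bsub>G\<^esub> inv\<^bsub>G\<^esub> \<zeta>) \<and> s \<zeta> = inv\<^bsub>G\<^esub> \<zeta>"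
    by blast
  from someI_ex[OF this]
  show "\<sigma> \<in> cont_hom G G" "y \<in> carrier (raag \<Gamma>\<^sub>1) \<Longrightarrow> \<sigma> (\<epsilon>\<^sub>1 y) = \<epsilon>\<^sub>1 (\<delta>\<^sub>1 1 y)"
    "y \<in> carrier (raag \<Gamma>\<^sub>2) \<Longrightarrow> \<sigma> (\<epsilon>\<^sub>2 y) = \<zeta> \<otimes>\<^bsub>G\<^esub> \<epsilon>\<^sub>2 (\<delta>\<^sub>2 1 y) \<otimes>\<^bsub>G\<^esub> inv\<^bsub>G\<^esub> \<zeta>" "\<sigma> \<zeta> = inv\<^bsub>G\<^esub> \<zeta>"
    unfolding \<sigma>_def by blast+
qed

lemma \<sigma>_inv: "y \<in> carrier G \<Longrightarrow> \<sigma> (inv\<^bsub>G\<^esub> y) = inv\<^bsub>G\<^esub> (\<sigma> y)"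
  by (rule cont_hom_inv[OF \<sigma> G.is_group G.is_group])

text \<open>By \<open>G_hom_eq\<close> only the two factors and \<zeta> have to be examined. On the
  second factor the conjugations by \<zeta> and by \<sigma> \<zeta> = \<zeta>^-1 cancel, which
  leaves the square of the given involution.\<close>

lemma \<sigma>_\<sigma>:
  assumes "y \<in> carrier G"
  shows "\<sigma> (\<sigma> y) = y"
proof (rule G_hom_eq[OF G.is_group pro2_Hausdorff[OF pro2_raag[OF ug']] cont_hom_compose[OF \<sigma> \<sigma>] id_cont_hom _ _ _ assms])
  fix y assume y: "y \<in> carrier (raag \<Gamma>\<^sub>1)"
  show "\<sigma> (\<sigma> (\<epsilon>\<^sub>1 y)) = \<epsilon>\<^sub>1 y"
    using \<sigma>_1[OF y] \<sigma>_1[OF cont_hom_closed[OF S1.theta_1 y]] S1.theta_1_1[OF y] by simp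
next
  fix y assume y: "y \<in> carrier (raag \<Gamma>\<^sub>2)"
  note y' = cont_hom_closed[OF S2.theta_1 y]
  note cl = zeta_closed G.inv_closed[OF zeta_closed] \<epsilon>\<^sub>2_closed[OF y] \<epsilon>\<^sub>2_closed[OF y']
  have "\<sigma> (\<sigma> (\<epsilon>\<^sub>2 y)) = \<sigma> \<zeta> \<otimes>\<^bsub>G\<^esub> \<sigma> (\<epsilon>\<^sub>2 (\<delta>\<^sub>2 1 y)) \<otimes>\<^bsub>G\<^esub> \<sigma> (inv\<^bsub>G\<^esub> \<zeta>)"
    unfolding \<sigma>_2[OF y] using cl by (simp only: cont_hom_mult[OF \<sigma>] G.m_closed)
  also have "\<dots> = inv\<^bsub>G\<^esub> \<zeta> \<otimes>\<^bsub>G\<^esub> (\<zeta> \<otimes>\<^bsub>G\<^esub> \<epsilon>\<^sub>2 y \<otimes>\<^bsub>G\<^esub> inv\<^bsub>G\<^esub> \<zeta>) \<otimes>\<^bsub>G\<^esub> \<zeta>"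
    using \<sigma>_2[OF y'] S2.theta_1_1[OF y] \<sigma>_inv[OF zeta_closed] \<sigma>_zeta cl by simp
  also have "\<dots> = \<epsilon>\<^sub>2 y" using cl by (simp add: G.m_assoc G.inv_mult_cancel)
  finally show "\<sigma> (\<sigma> (\<epsilon>\<^sub>2 y)) = \<epsilon>\<^sub>2 y" .
next
  show "\<sigma> (\<sigma> \<zeta>) = \<zeta>" using \<sigma>_inv[OF zeta_closed] \<sigma>_zeta zeta_closed by simp
qed

definition z' :: "nat \<Rightarrow> raag_elt" where
  "z' i = (if i \<le> d\<^sub>1 then \<epsilon>\<^sub>1 (z\<^sub>1 i) else if i \<le> d\<^sub>1 + d\<^sub>2 then \<epsilon>\<^sub>2 (z\<^sub>2 (i - d\<^sub>1)) \<otimes>\<^bsub>G\<^esub> inv\<^bsub>G\<^esub> \<zeta> else \<one>\<^bsub>G\<^esub>)"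

lemma
  shows z'_1: "j \<in> {1..d\<^sub>1} \<Longrightarrow> z' j = \<epsilon>\<^sub>1 (z\<^sub>1 j)"
    and z'_2: "j \<in> {1..d\<^sub>2} \<Longrightarrow> z' (d\<^sub>1 + j) = \<epsilon>\<^sub>2 (z\<^sub>2 j) \<otimes>\<^bsub>G\<^esub> inv\<^bsub>G\<^esub> \<zeta>"
    and z'_0: "z' (d\<^sub>1 + d\<^sub>2 + 1) = \<one>\<^bsub>G\<^esub>"
  by (simp_all add: z'_def)

definition \<delta>' :: "int \<Rightarrow> raag_elt \<Rightarrow> raag_elt" where
  "\<delta>' s = restrict (if s = 0 then id else \<sigma>) (carrier G)"

lemma delta_action': "delta_action \<Gamma>' z' \<delta>'"
  unfolding \<delta>'_def[abs_def]
proof (rule delta_actionI[OF ug' _ \<sigma> \<sigma>_\<sigma>])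
  have z1: "z\<^sub>1 j \<in> carrier (raag \<Gamma>\<^sub>1)"
    and act1: "\<delta>\<^sub>1 1 (raag_gen \<Gamma>\<^sub>1 j) = inv\<^bsub>raag \<Gamma>\<^sub>1\<^esub> (z\<^sub>1 j) \<otimes>\<^bsub>raag \<Gamma>\<^sub>1\<^esub> inv\<^bsub>raag \<Gamma>\<^sub>1\<^esub> (raag_gen \<Gamma>\<^sub>1 j) \<otimes>\<^bsub>raag \<Gamma>\<^sub>1\<^esub> z\<^sub>1 j"
    if "j \<in> {1..d\<^sub>1}" for j
    using action1 that by (simp_all add: delta_action_def)
  have z2: "z\<^sub>2 j \<in> carrier (raag \<Gamma>\<^sub>2)"
    and act2: "\<delta>\<^sub>2 1 (raag_gen \<Gamma>\<^sub>2 j) = inv\<^bsub>raag \<Gamma>\<^sub>2\<^esub> (z\<^sub>2 j) \<otimes>\<^bsub>raag \<Gamma>\<^sub>2\<^esub> inv\<^bsub>raag \<Gamma>\<^sub>2\<^esub> (raag_gen \<Gamma>\<^sub>2 j) \<otimes>\<^bsub>raag \<Gamma>\<^sub>2\<^esub> z\<^sub>2 j"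
    if "j \<in> {1..d\<^sub>2}" for j
    using action2 that by (simp_all add: delta_action_def)
  interpret e1: group_hom "raag \<Gamma>\<^sub>1" G \<epsilon>\<^sub>1
    by (rule cont_hom_group_hom[OF \<epsilon>\<^sub>1 S1.G.is_group G.is_group])
  interpret e2: group_hom "raag \<Gamma>\<^sub>2" G \<epsilon>\<^sub>2
    by (rule cont_hom_group_hom[OF \<epsilon>\<^sub>2 S2.G.is_group G.is_group])
  fix i assume i: "i \<in> {1..nverts \<Gamma>'}"
  then have "i \<in> {1..d\<^sub>1} \<or> (i - d\<^sub>1 \<in> {1..d\<^sub>2} \<and> i = d\<^sub>1 + (i - d\<^sub>1)) \<or> i = d\<^sub>1 + d\<^sub>2 + 1"
    unfolding nverts_\<Gamma>' by auto
  then consider "i \<in> {1..d\<^sub>1}" | j where "j \<in> {1..d\<^sub>2}" "i = d\<^sub>1 + j" | "i = d\<^sub>1 + d\<^sub>2 + 1" by blast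
  then have "z' i \<in> carrier G \<and> \<sigma> (x i) = inv\<^bsub>G\<^esub> (z' i) \<otimes>\<^bsub>G\<^esub> inv\<^bsub>G\<^esub> (x i) \<otimes>\<^bsub>G\<^esub> z' i"
  proof cases
    case 1
    note g = raag_gen_closed[OF ug1 1] and zi = z1[OF 1]
    show ?thesis
      using \<sigma>_1[OF g] g zi unfolding z'_1[OF 1] \<epsilon>\<^sub>1_gen[OF 1, symmetric] act1[OF 1] by simp
  next
    case 2
    note g = raag_gen_closed[OF ug2 2(1)] and zi = z2[OF 2(1)]
    show ?thesis
      using \<sigma>_2[OF g] g zi zeta_closed
      unfolding 2(2) z'_2[OF 2(1)] \<epsilon>\<^sub>2_gen[OF 2(1), symmetric] act2[OF 2(1)]
      by (simp add: G.inv_mult_group G.m_assoc)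
  next
    case 3
    show ?thesis unfolding 3 z'_0 \<zeta>_def[symmetric] \<sigma>_zeta using zeta_closed by simp
  qed
  then show "z' i \<in> carrier G" "\<sigma> (x i) = inv\<^bsub>G\<^esub> (z' i) \<otimes>\<^bsub>G\<^esub> inv\<^bsub>G\<^esub> (x i) \<otimes>\<^bsub>G\<^esub> z' i" by blast+
qed

sublocale S': delta_semidirect G \<delta>'
  using delta_action_semidirect[OF ug' delta_action'] .

lemma \<delta>'_1: "y \<in> carrier G \<Longrightarrow> \<delta>' 1 y = \<sigma> y"
  by (simp add: \<delta>'_def)

text \<open>This pair stands for the second involution t: as s = (1, 1) inverts \<zeta>, one has t =
  s \<zeta> = \<zeta>^-1 s. Its square is \<zeta>^-1 \<sigma>(\<zeta>^-1) = \<zeta>^-1 \<zeta> =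
  1.\<close>

lemma zeta_involution:
  "(inv\<^bsub>G\<^esub> \<zeta>, 1) \<in> carrier S'.S" "(inv\<^bsub>G\<^esub> \<zeta>, 1) \<otimes>\<^bsub>S'.S\<^esub> (inv\<^bsub>G\<^esub> \<zeta>, 1) = \<one>\<^bsub>S'.S\<^esub>"
  using zeta_closed by (simp_all add: S'.carrier_S S'.mult_S S'.one_S \<delta>'_1 \<sigma>_inv \<sigma>_zeta)

section \<open>The two factors inside the new semidirect product and its universal property\<close>

definition \<iota>\<^sub>1 :: "raag_elt \<times> int \<Rightarrow> raag_elt \<times> int" where
  "\<iota>\<^sub>1 = (SOME f. f \<in> cont_hom S1.S S'.S \<and> (\<forall>g\<in>carrier (raag \<Gamma>\<^sub>1). f (g, 0) = (\<epsilon>\<^sub>1 g, 0)) \<and>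
    f (\<one>\<^bsub>raag \<Gamma>\<^sub>1\<^esub>, 1) = (\<one>\<^bsub>G\<^esub>, 1))"

definition \<iota>\<^sub>2 :: "raag_elt \<times> int \<Rightarrow> raag_elt \<times> int" where
  "\<iota>\<^sub>2 = (SOME f. f \<in> cont_hom S2.S S'.S \<and> (\<forall>g\<in>carrier (raag \<Gamma>\<^sub>2). f (g, 0) = (\<epsilon>\<^sub>2 g, 0)) \<and>
    f (\<one>\<^bsub>raag \<Gamma>\<^sub>2\<^esub>, 1) = (inv\<^bsub>G\<^esub> \<zeta>, 1))"

lemma
  shows \<iota>\<^sub>1: "\<iota>\<^sub>1 \<in> cont_hom S1.S S'.S"
    and \<iota>\<^sub>1_embed: "g \<in> carrier (raag \<Gamma>\<^sub>1) \<Longrightarrow> \<iota>\<^sub>1 (g, 0) = (\<epsilon>\<^sub>1 g, 0)"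
    and \<iota>\<^sub>1_involution: "\<iota>\<^sub>1 (\<one>\<^bsub>raag \<Gamma>\<^sub>1\<^esub>, 1) = (\<one>\<^bsub>G\<^esub>, 1)"
proof -
  have "\<exists>f\<in>cont_hom S1.S S'.S. (\<forall>g\<in>carrier (raag \<Gamma>\<^sub>1). f (g, 0) = (\<epsilon>\<^sub>1 g, 0)) \<and>
      f (\<one>\<^bsub>raag \<Gamma>\<^sub>1\<^esub>, 1) = (\<one>\<^bsub>G\<^esub>, 1)"
  proof (rule S1.semidirect_universal[OF S'.pro2_S cont_hom_compose[OF \<epsilon>\<^sub>1 S'.embed_cont_hom] S'.involution_S])
    fix g assume g: "g \<in> carrier (raag \<Gamma>\<^sub>1)"
    show "(\<one>\<^bsub>G\<^esub>, 1) \<otimes>\<^bsub>S'.S\<^esub> (\<epsilon>\<^sub>1 g, 0) = (\<epsilon>\<^sub>1 (\<delta>\<^sub>1 1 g), 0) \<otimes>\<^bsub>S'.S\<^esub> (\<one>\<^bsub>G\<^esub>, 1)"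
      using S'.involution_conj[OF \<epsilon>\<^sub>1_closed[OF g]] \<delta>'_1[OF \<epsilon>\<^sub>1_closed[OF g]] \<sigma>_1[OF g] by simp
  qed
  then have "\<exists>f. f \<in> cont_hom S1.S S'.S \<and> (\<forall>g\<in>carrier (raag \<Gamma>\<^sub>1). f (g, 0) = (\<epsilon>\<^sub>1 g, 0)) \<and>
      f (\<one>\<^bsub>raag \<Gamma>\<^sub>1\<^esub>, 1) = (\<one>\<^bsub>G\<^esub>, 1)" by blast
  from someI_ex[OF this]
  show "\<iota>\<^sub>1 \<in> cont_hom S1.S S'.S" "g \<in> carrier (raag \<Gamma>\<^sub>1) \<Longrightarrow> \<iota>\<^sub>1 (g, 0) = (\<epsilon>\<^sub>1 g, 0)"
    "\<iota>\<^sub>1 (\<one>\<^bsub>raag \<Gamma>\<^sub>1\<^esub>, 1) = (\<one>\<^bsub>G\<^esub>, 1)"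
    unfolding \<iota>\<^sub>1_def by blast+
qed

lemma
  shows \<iota>\<^sub>2: "\<iota>\<^sub>2 \<in> cont_hom S2.S S'.S"
    and \<iota>\<^sub>2_embed: "g \<in> carrier (raag \<Gamma>\<^sub>2) \<Longrightarrow> \<iota>\<^sub>2 (g, 0) = (\<epsilon>\<^sub>2 g, 0)"
    and \<iota>\<^sub>2_involution: "\<iota>\<^sub>2 (\<one>\<^bsub>raag \<Gamma>\<^sub>2\<^esub>, 1) = (inv\<^bsub>G\<^esub> \<zeta>, 1)"
proof -
  have "\<exists>f\<in>cont_hom S2.S S'.S. (\<forall>g\<in>carrier (raag \<Gamma>\<^sub>2). f (g, 0) = (\<epsilon>\<^sub>2 g, 0)) \<and>
      f (\<one>\<^bsub>raag \<Gamma>\<^sub>2\<^esub>, 1) = (inv\<^bsub>G\<^esub> \<zeta>, 1)"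
  proof (rule S2.semidirect_universal[OF S'.pro2_S cont_hom_compose[OF \<epsilon>\<^sub>2 S'.embed_cont_hom] zeta_involution])
    fix g assume g: "g \<in> carrier (raag \<Gamma>\<^sub>2)"
    note cl = \<epsilon>\<^sub>2_closed[OF g] \<epsilon>\<^sub>2_closed[OF cont_hom_closed[OF S2.theta_1 g]] zeta_closed
    \<comment> \<open>The factor \<zeta>^-1 of t undoes the conjugation by \<zeta> in \<sigma>, so t
      acts on the second RAAG as \<open>\<delta>\<^sub>2\<close> prescribes.\<close>
    have "inv\<^bsub>G\<^esub> \<zeta> \<otimes>\<^bsub>G\<^esub> \<sigma> (\<epsilon>\<^sub>2 g) = \<epsilon>\<^sub>2 (\<delta>\<^sub>2 1 g) \<otimes>\<^bsub>G\<^esub> inv\<^bsub>G\<^esub> \<zeta>"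
      unfolding \<sigma>_2[OF g] using cl by (simp add: G.m_assoc G.inv_mult_cancel)
    then show "(inv\<^bsub>G\<^esub> \<zeta>, 1) \<otimes>\<^bsub>S'.S\<^esub> (\<epsilon>\<^sub>2 g, 0) = (\<epsilon>\<^sub>2 (\<delta>\<^sub>2 1 g), 0) \<otimes>\<^bsub>S'.S\<^esub> (inv\<^bsub>G\<^esub> \<zeta>, 1)"
      using cl by (simp add: S'.mult_S \<delta>'_1 S'.theta_0)
  qed
  then have "\<exists>f. f \<in> cont_hom S2.S S'.S \<and> (\<forall>g\<in>carrier (raag \<Gamma>\<^sub>2). f (g, 0) = (\<epsilon>\<^sub>2 g, 0)) \<and>
      f (\<one>\<^bsub>raag \<Gamma>\<^sub>2\<^esub>, 1) = (inv\<^bsub>G\<^esub> \<zeta>, 1)" by blast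
  from someI_ex[OF this]
  show "\<iota>\<^sub>2 \<in> cont_hom S2.S S'.S" "g \<in> carrier (raag \<Gamma>\<^sub>2) \<Longrightarrow> \<iota>\<^sub>2 (g, 0) = (\<epsilon>\<^sub>2 g, 0)"
    "\<iota>\<^sub>2 (\<one>\<^bsub>raag \<Gamma>\<^sub>2\<^esub>, 1) = (inv\<^bsub>G\<^esub> \<zeta>, 1)"
    unfolding \<iota>\<^sub>2_def by blast+
qed

text \<open>The product is (1, 1) (\<zeta>^-1, 1) = (\<sigma>(\<zeta>^-1), 0), and \<sigma> inverts
  \<zeta>. Besides identifying \<zeta>, this places it in the subgroup generated by the two
  factors.\<close>

lemma zeta_eq: "(\<zeta>, 0) = \<iota>\<^sub>1 (\<one>\<^bsub>raag \<Gamma>\<^sub>1\<^esub>, 1) \<otimes>\<^bsub>S'.S\<^esub> \<iota>\<^sub>2 (\<one>\<^bsub>raag \<Gamma>\<^sub>2\<^esub>, 1)"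
  using zeta_closed by (simp add: \<iota>\<^sub>1_involution \<iota>\<^sub>2_involution S'.mult_S \<delta>'_1 \<sigma>_inv \<sigma>_zeta)

text \<open>The images of the factors contain both RAAGs and the involution s, and by
  \<open>zeta_eq\<close> their product contains \<zeta>; together these generate the group
  topologically.\<close>

lemma S'_hom_eq:
  assumes K: "pro2_group K" and \<phi>: "\<phi> \<in> cont_hom S'.S K" and \<psi>: "\<psi> \<in> cont_hom S'.S K"
    and 1: "\<And>g. g \<in> carrier S1.S \<Longrightarrow> \<phi> (\<iota>\<^sub>1 g) = \<psi> (\<iota>\<^sub>1 g)"
    and 2: "\<And>g. g \<in> carrier S2.S \<Longrightarrow> \<phi> (\<iota>\<^sub>2 g) = \<psi> (\<iota>\<^sub>2 g)"
    and p: "p \<in> carrier S'.S"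
  shows "\<phi> p = \<psi> p"
proof (rule S'.semidirect_hom_eq[OF cont_homD(1)[OF \<phi>] cont_homD(1)[OF \<psi>] _ _ p])
  show "\<phi> (\<one>\<^bsub>G\<^esub>, 1) = \<psi> (\<one>\<^bsub>G\<^esub>, 1)" using 1[OF S1.involution_S(1)] by (simp only: \<iota>\<^sub>1_involution)
  fix g assume g: "g \<in> carrier G"
  show "\<phi> (g, 0) = \<psi> (g, 0)"
  proof (rule G_hom_eq[OF pro2_group_is_group[OF K] pro2_Hausdorff[OF K] cont_hom_compose[OF S'.embed_cont_hom \<phi>]
        cont_hom_compose[OF S'.embed_cont_hom \<psi>] _ _ _ g])
    show "\<phi> (\<epsilon>\<^sub>1 y, 0) = \<psi> (\<epsilon>\<^sub>1 y, 0)" if y: "y \<in> carrier (raag \<Gamma>\<^sub>1)" for y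
      using 1[of "(y, 0)"] y by (simp add: \<iota>\<^sub>1_embed S1.carrier_S)
    show "\<phi> (\<epsilon>\<^sub>2 y, 0) = \<psi> (\<epsilon>\<^sub>2 y, 0)" if y: "y \<in> carrier (raag \<Gamma>\<^sub>2)" for y
      using 2[of "(y, 0)"] y by (simp add: \<iota>\<^sub>2_embed S2.carrier_S)
    show "\<phi> (\<zeta>, 0) = \<psi> (\<zeta>, 0)"
      unfolding zeta_eq
      using 1[OF S1.involution_S(1)] 2[OF S2.involution_S(1)]
        cont_hom_mult[OF \<phi> cont_hom_closed[OF \<iota>\<^sub>1 S1.involution_S(1)] cont_hom_closed[OF \<iota>\<^sub>2 S2.involution_S(1)]]
        cont_hom_mult[OF \<psi> cont_hom_closed[OF \<iota>\<^sub>1 S1.involution_S(1)] cont_hom_closed[OF \<iota>\<^sub>2 S2.involution_S(1)]]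
      by simp
  qed
qed

text \<open>Let a and b be the images of s and t in K. The RAAG is mapped with \<zeta> going to the
  product of a and b, and this extends to the semidirect product with s going to a once \<sigma> is
  shown to become conjugation by a. Both sides of that condition are continuous homomorphisms on G,
  so it is tested on the two factors and on \<zeta>.\<close>

lemma S'_universal:
  assumes K: "pro2_group K" and f1: "f\<^sub>1 \<in> cont_hom S1.S K" and f2: "f\<^sub>2 \<in> cont_hom S2.S K"
  shows "\<exists>\<phi>\<in>cont_hom S'.S K. (\<forall>g\<in>carrier S1.S. \<phi> (\<iota>\<^sub>1 g) = f\<^sub>1 g) \<and> (\<forall>g\<in>carrier S2.S. \<phi> (\<iota>\<^sub>2 g) = f\<^sub>2 g)"
proof -
  interpret K: group K using K by (rule pro2_group_is_group)
  define a where "a = f\<^sub>1 (\<one>\<^bsub>raag \<Gamma>\<^sub>1\<^esub>, 1)"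
  define b where "b = f\<^sub>2 (\<one>\<^bsub>raag \<Gamma>\<^sub>2\<^esub>, 1)"
  have a: "a \<in> carrier K" unfolding a_def by (rule cont_hom_closed[OF f1 S1.involution_S(1)])
  have b: "b \<in> carrier K" unfolding b_def by (rule cont_hom_closed[OF f2 S2.involution_S(1)])
  have aa: "a \<otimes>\<^bsub>K\<^esub> a = \<one>\<^bsub>K\<^esub>"
    unfolding a_def cont_hom_mult[OF f1 S1.involution_S(1) S1.involution_S(1), symmetric] S1.involution_S(2)
    by (rule cont_hom_one[OF f1 S1.group_S K.is_group])
  have bb: "b \<otimes>\<^bsub>K\<^esub> b = \<one>\<^bsub>K\<^esub>"
    unfolding b_def cont_hom_mult[OF f2 S2.involution_S(1) S2.involution_S(1), symmetric] S2.involution_S(2)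
    by (rule cont_hom_one[OF f2 S2.group_S K.is_group])
  have inv_a: "inv\<^bsub>K\<^esub> a = a" and inv_b: "inv\<^bsub>K\<^esub> b = b"
    using aa bb a b by (simp_all add: K.inv_equality)
  have g1: "(\<lambda>g. f\<^sub>1 (g, 0)) \<in> cont_hom (raag \<Gamma>\<^sub>1) K" by (rule cont_hom_compose[OF S1.embed_cont_hom f1])
  have g2: "(\<lambda>g. f\<^sub>2 (g, 0)) \<in> cont_hom (raag \<Gamma>\<^sub>2) K" by (rule cont_hom_compose[OF S2.embed_cont_hom f2])
  have conj1: "a \<otimes>\<^bsub>K\<^esub> f\<^sub>1 (g, 0) \<otimes>\<^bsub>K\<^esub> a = f\<^sub>1 (\<delta>\<^sub>1 1 g, 0)" if g: "g \<in> carrier (raag \<Gamma>\<^sub>1)" for g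
  proof -
    note g' = S1.theta_closed[of 1, OF _ g]
    have m: "(g, 0) \<in> carrier S1.S" "(\<delta>\<^sub>1 1 g, 0) \<in> carrier S1.S" using g g' by (simp_all add: S1.carrier_S)
    have "a \<otimes>\<^bsub>K\<^esub> f\<^sub>1 (g, 0) = f\<^sub>1 (\<delta>\<^sub>1 1 g, 0) \<otimes>\<^bsub>K\<^esub> a"
      unfolding a_def cont_hom_mult[OF f1 S1.involution_S(1) m(1), symmetric]
        cont_hom_mult[OF f1 m(2) S1.involution_S(1), symmetric] S1.involution_conj[OF g] ..
    then show ?thesis using aa a cont_hom_closed[OF f1 m(2)] by (simp add: K.m_assoc)
  qed
  have conj2: "b \<otimes>\<^bsub>K\<^esub> f\<^sub>2 (g, 0) \<otimes>\<^bsub>K\<^esub> b = f\<^sub>2 (\<delta>\<^sub>2 1 g, 0)" if g: "g \<in> carrier (raag \<Gamma>\<^sub>2)" for g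
  proof -
    note g' = S2.theta_closed[of 1, OF _ g]
    have m: "(g, 0) \<in> carrier S2.S" "(\<delta>\<^sub>2 1 g, 0) \<in> carrier S2.S" using g g' by (simp_all add: S2.carrier_S)
    have "b \<otimes>\<^bsub>K\<^esub> f\<^sub>2 (g, 0) = f\<^sub>2 (\<delta>\<^sub>2 1 g, 0) \<otimes>\<^bsub>K\<^esub> b"
      unfolding b_def cont_hom_mult[OF f2 S2.involution_S(1) m(1), symmetric]
        cont_hom_mult[OF f2 m(2) S2.involution_S(1), symmetric] S2.involution_conj[OF g] ..
    then show ?thesis using bb b cont_hom_closed[OF f2 m(2)] by (simp add: K.m_assoc)
  qed
  obtain \<phi> where \<phi>: "\<phi> \<in> cont_hom G K" and \<phi>1: "\<And>g. g \<in> carrier (raag \<Gamma>\<^sub>1) \<Longrightarrow> \<phi> (\<epsilon>\<^sub>1 g) = f\<^sub>1 (g, 0)"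
    and \<phi>2: "\<And>g. g \<in> carrier (raag \<Gamma>\<^sub>2) \<Longrightarrow> \<phi> (\<epsilon>\<^sub>2 g) = f\<^sub>2 (g, 0)" and \<phi>0: "\<phi> \<zeta> = a \<otimes>\<^bsub>K\<^esub> b"
    using G_universal[OF K g1 g2 K.m_closed[OF a b]] by blast
  have \<phi>_inv_zeta: "\<phi> (inv\<^bsub>G\<^esub> \<zeta>) = b \<otimes>\<^bsub>K\<^esub> a"
    using cont_hom_inv[OF \<phi> G.is_group K.is_group zeta_closed] \<phi>0 a b inv_a inv_b by (simp add: K.inv_mult_group)
  have conj: "\<phi> (\<sigma> g) = a \<otimes>\<^bsub>K\<^esub> \<phi> g \<otimes>\<^bsub>K\<^esub> inv\<^bsub>K\<^esub> a" if g: "g \<in> carrier G" for g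
  proof (rule G_hom_eq[OF K.is_group pro2_Hausdorff[OF K] cont_hom_compose[OF \<sigma> \<phi>]
        cont_hom_compose[OF \<phi> conj_cont_hom[OF K a]] _ _ _ g])
    show "\<phi> (\<sigma> (\<epsilon>\<^sub>1 y)) = a \<otimes>\<^bsub>K\<^esub> \<phi> (\<epsilon>\<^sub>1 y) \<otimes>\<^bsub>K\<^esub> inv\<^bsub>K\<^esub> a" if y: "y \<in> carrier (raag \<Gamma>\<^sub>1)" for y
      using \<sigma>_1[OF y] \<phi>1[OF y] \<phi>1[OF cont_hom_closed[OF S1.theta_1 y]] conj1[OF y] inv_a by simp
    show "\<phi> (\<sigma> (\<epsilon>\<^sub>2 y)) = a \<otimes>\<^bsub>K\<^esub> \<phi> (\<epsilon>\<^sub>2 y) \<otimes>\<^bsub>K\<^esub> inv\<^bsub>K\<^esub> a" if y: "y \<in> carrier (raag \<Gamma>\<^sub>2)" for y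
    proof -
      note y' = cont_hom_closed[OF S2.theta_1 y]
      have fy: "f\<^sub>2 (y, 0) \<in> carrier K" by (rule cont_hom_closed[OF g2 y])
      \<comment> \<open>After substitution the four factors b cancel in pairs, and conjugation by
        the involution a remains.\<close>
      have "\<phi> (\<sigma> (\<epsilon>\<^sub>2 y)) = \<phi> \<zeta> \<otimes>\<^bsub>K\<^esub> \<phi> (\<epsilon>\<^sub>2 (\<delta>\<^sub>2 1 y)) \<otimes>\<^bsub>K\<^esub> \<phi> (inv\<^bsub>G\<^esub> \<zeta>)"
        unfolding \<sigma>_2[OF y] using zeta_closed \<epsilon>\<^sub>2_closed[OF y']
        by (simp only: cont_hom_mult[OF \<phi>] G.m_closed G.inv_closed)
      also have "\<dots> = a \<otimes>\<^bsub>K\<^esub> b \<otimes>\<^bsub>K\<^esub> (b \<otimes>\<^bsub>K\<^esub> f\<^sub>2 (y, 0) \<otimes>\<^bsub>K\<^esub> b) \<otimes>\<^bsub>K\<^esub> (b \<otimes>\<^bsub>K\<^esub> a)"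
        by (simp only: \<phi>0 \<phi>_inv_zeta \<phi>2[OF y'] conj2[OF y])
      also have "\<dots> = a \<otimes>\<^bsub>K\<^esub> (b \<otimes>\<^bsub>K\<^esub> b) \<otimes>\<^bsub>K\<^esub> f\<^sub>2 (y, 0) \<otimes>\<^bsub>K\<^esub> (b \<otimes>\<^bsub>K\<^esub> b) \<otimes>\<^bsub>K\<^esub> a"
        using a b fy by (simp only: K.m_assoc K.m_closed)
      also have "\<dots> = a \<otimes>\<^bsub>K\<^esub> \<phi> (\<epsilon>\<^sub>2 y) \<otimes>\<^bsub>K\<^esub> inv\<^bsub>K\<^esub> a"
        using a fy by (simp add: bb inv_a \<phi>2[OF y])
      finally show ?thesis .
    qed
    \<comment> \<open>For \<zeta> the condition says that conjugation by a inverts the product of a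
      and b, as happens for any two involutions.\<close>
    have "a \<otimes>\<^bsub>K\<^esub> (a \<otimes>\<^bsub>K\<^esub> b) \<otimes>\<^bsub>K\<^esub> a = (a \<otimes>\<^bsub>K\<^esub> a) \<otimes>\<^bsub>K\<^esub> b \<otimes>\<^bsub>K\<^esub> a"
      using a b by (simp only: K.m_assoc K.m_closed)
    also have "\<dots> = b \<otimes>\<^bsub>K\<^esub> a" using b by (simp add: aa)
    finally show "\<phi> (\<sigma> \<zeta>) = a \<otimes>\<^bsub>K\<^esub> \<phi> \<zeta> \<otimes>\<^bsub>K\<^esub> inv\<^bsub>K\<^esub> a"
      by (simp only: \<sigma>_zeta \<phi>_inv_zeta \<phi>0 inv_a)
  qed
  have "\<exists>\<Phi>\<in>cont_hom S'.S K. (\<forall>g\<in>carrier G. \<Phi> (g, 0) = \<phi> g) \<and> \<Phi> (\<one>\<^bsub>G\<^esub>, 1) = a"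
  proof (rule S'.semidirect_universal[OF K \<phi> a aa])
    fix g assume g: "g \<in> carrier G"
    show "a \<otimes>\<^bsub>K\<^esub> \<phi> g = \<phi> (\<delta>' 1 g) \<otimes>\<^bsub>K\<^esub> a"
      unfolding \<delta>'_1[OF g] conj[OF g] inv_a using a cont_hom_closed[OF \<phi> g] aa by (simp add: K.m_assoc)
  qed
  then obtain \<Phi> where \<Phi>: "\<Phi> \<in> cont_hom S'.S K" and \<Phi>0: "\<And>g. g \<in> carrier G \<Longrightarrow> \<Phi> (g, 0) = \<phi> g"
    and \<Phi>1: "\<Phi> (\<one>\<^bsub>G\<^esub>, 1) = a" by blast
  have "\<Phi> (\<iota>\<^sub>1 g) = f\<^sub>1 g" if g: "g \<in> carrier S1.S" for g
  proof (rule S1.semidirect_hom_eq[OF cont_homD(1)[OF cont_hom_compose[OF \<iota>\<^sub>1 \<Phi>]] cont_homD(1)[OF f1] _ _ g])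
    show "\<Phi> (\<iota>\<^sub>1 (y, 0)) = f\<^sub>1 (y, 0)" if y: "y \<in> carrier (raag \<Gamma>\<^sub>1)" for y
      unfolding \<iota>\<^sub>1_embed[OF y] \<Phi>0[OF \<epsilon>\<^sub>1_closed[OF y]] by (rule \<phi>1[OF y])
    show "\<Phi> (\<iota>\<^sub>1 (\<one>\<^bsub>raag \<Gamma>\<^sub>1\<^esub>, 1)) = f\<^sub>1 (\<one>\<^bsub>raag \<Gamma>\<^sub>1\<^esub>, 1)"
      unfolding \<iota>\<^sub>1_involution \<Phi>1 a_def ..
  qed
  moreover have "\<Phi> (\<iota>\<^sub>2 g) = f\<^sub>2 g" if g: "g \<in> carrier S2.S" for g
  proof (rule S2.semidirect_hom_eq[OF cont_homD(1)[OF cont_hom_compose[OF \<iota>\<^sub>2 \<Phi>]] cont_homD(1)[OF f2] _ _ g])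
    show "\<Phi> (\<iota>\<^sub>2 (y, 0)) = f\<^sub>2 (y, 0)" if y: "y \<in> carrier (raag \<Gamma>\<^sub>2)" for y
      unfolding \<iota>\<^sub>2_embed[OF y] \<Phi>0[OF \<epsilon>\<^sub>2_closed[OF y]] by (rule \<phi>2[OF y])
    have m: "(inv\<^bsub>G\<^esub> \<zeta>, 0) \<in> carrier S'.S" using zeta_closed by (simp add: S'.carrier_S)
    \<comment> \<open>The pair splits as \<zeta>^-1 times s. The values are b a and a, so t is sent
      to b.\<close>
    have "\<Phi> (inv\<^bsub>G\<^esub> \<zeta>, 1) = \<Phi> (inv\<^bsub>G\<^esub> \<zeta>, 0) \<otimes>\<^bsub>K\<^esub> \<Phi> (\<one>\<^bsub>G\<^esub>, 1)"
      unfolding S'.decompose_S[OF G.inv_closed[OF zeta_closed], symmetric]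
      by (rule cont_hom_mult[OF \<Phi> m S'.involution_S(1)])
    also have "\<dots> = b \<otimes>\<^bsub>K\<^esub> a \<otimes>\<^bsub>K\<^esub> a"
      by (simp only: \<Phi>0[OF G.inv_closed[OF zeta_closed]] \<phi>_inv_zeta \<Phi>1)
    also have "\<dots> = b" using a b aa by (simp add: K.m_assoc)
    finally show "\<Phi> (\<iota>\<^sub>2 (\<one>\<^bsub>raag \<Gamma>\<^sub>2\<^esub>, 1)) = f\<^sub>2 (\<one>\<^bsub>raag \<Gamma>\<^sub>2\<^esub>, 1)"
      unfolding \<iota>\<^sub>2_involution b_def .
  qed
  ultimately show ?thesis using \<Phi> by blast
qed

text \<open>The family A is prescribed only at 1 and 2, so that the statement fits both a family
  indexed like the given data and one pieced together in an induction. Passing to the restriction of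
  the map meets the demand for extensional maps in \<open>is_pro2_coproduct\<close>.\<close>

lemma coproduct:
  assumes A: "A 1 = delta_raag \<Gamma>\<^sub>1 \<delta>\<^sub>1" "A 2 = delta_raag \<Gamma>\<^sub>2 \<delta>\<^sub>2"
  shows "is_pro2_coproduct TYPE('k) {1, 2 :: nat} A (\<lambda>i. if i = 1 then \<iota>\<^sub>1 else \<iota>\<^sub>2) (delta_raag \<Gamma>' \<delta>')"
  unfolding is_pro2_coproduct_def
proof (intro conjI allI impI)
  show "\<forall>i\<in>{1, 2}. pro2_group (A i)" using S1.pro2_S S2.pro2_S A by simp
  show "pro2_group S'.S" by (rule S'.pro2_S)
  show "\<forall>i\<in>{1, 2}. (if i = 1 then \<iota>\<^sub>1 else \<iota>\<^sub>2) \<in> cont_hom (A i) S'.S" using \<iota>\<^sub>1 \<iota>\<^sub>2 A by simp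
  fix K :: "'k topgroup" and f
  assume "pro2_group K \<and> (\<forall>i\<in>{1, 2}. f i \<in> cont_hom (A i) K)"
  then have K: "pro2_group K" and f1: "f 1 \<in> cont_hom S1.S K" and f2: "f 2 \<in> cont_hom S2.S K" using A by simp_all
  obtain \<phi> where \<phi>: "\<phi> \<in> cont_hom S'.S K" and \<phi>1: "\<And>g. g \<in> carrier S1.S \<Longrightarrow> \<phi> (\<iota>\<^sub>1 g) = f 1 g"
    and \<phi>2: "\<And>g. g \<in> carrier S2.S \<Longrightarrow> \<phi> (\<iota>\<^sub>2 g) = f 2 g"
    using S'_universal[OF K f1 f2] by blast
  show "\<exists>!\<phi>. \<phi> \<in> cont_hom S'.S K \<and> \<phi> \<in> extensional (carrier S'.S) \<and>
      (\<forall>i\<in>{1, 2}. \<forall>g\<in>carrier (A i). \<phi> ((if i = 1 then \<iota>\<^sub>1 else \<iota>\<^sub>2) g) = f i g)"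
  proof (rule ex1I[of _ "restrict \<phi> (carrier S'.S)"], intro conjI)
    show "restrict \<phi> (carrier S'.S) \<in> cont_hom S'.S K"
      by (rule cont_hom_cong[OF S'.group_S pro2_topspace[OF S'.pro2_S] \<phi>]) simp
    show "\<forall>i\<in>{1, 2}. \<forall>g\<in>carrier (A i).
        restrict \<phi> (carrier S'.S) ((if i = 1 then \<iota>\<^sub>1 else \<iota>\<^sub>2) g) = f i g"
      using \<phi>1 \<phi>2 cont_hom_closed[OF \<iota>\<^sub>1] cont_hom_closed[OF \<iota>\<^sub>2] A by simp
  next
    fix \<psi> assume \<psi>: "\<psi> \<in> cont_hom S'.S K \<and> \<psi> \<in> extensional (carrier S'.S) \<and>
      (\<forall>i\<in>{1, 2}. \<forall>g\<in>carrier (A i). \<psi> ((if i = 1 then \<iota>\<^sub>1 else \<iota>\<^sub>2) g) = f i g)"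
    show "\<psi> = restrict \<phi> (carrier S'.S)"
    proof (rule extensionalityI)
      show "\<psi> \<in> extensional (carrier S'.S)" using \<psi> by blast
      fix p assume p: "p \<in> carrier S'.S"
      have "\<psi> p = \<phi> p"
        by (rule S'_hom_eq[OF K _ \<phi> _ _ p]) (use \<psi> \<phi>1 \<phi>2 A in simp_all)
      then show "\<psi> p = restrict \<phi> (carrier S'.S) p" using p by simp
    qed simp
  qed simp
qed

end

section \<open>Finite coproducts from binary ones\<close>

lemma pro2_coproduct_single:
  assumes "pro2_group (A i)"
  shows "is_pro2_coproduct TYPE('k) {i} A (\<lambda>_ x. x) (A i)"
  unfolding is_pro2_coproduct_def
proof (intro conjI allI impI)
  show "\<forall>i\<in>{i}. pro2_group (A i)" "pro2_group (A i)" "\<forall>j\<in>{i}. (\<lambda>x. x) \<in> cont_hom (A j) (A i)"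
    using assms id_cont_hom by auto
  fix K :: "'k topgroup" and f assume "pro2_group K \<and> (\<forall>i\<in>{i}. f i \<in> cont_hom (A i) K)"
  then have f: "f i \<in> cont_hom (A i) K" by simp
  show "\<exists>!\<phi>. \<phi> \<in> cont_hom (A i) K \<and> \<phi> \<in> extensional (carrier (A i)) \<and> (\<forall>i\<in>{i}. \<forall>g\<in>carrier (A i). \<phi> g = f i g)"
  proof (rule ex1I[of _ "restrict (f i) (carrier (A i))"])
    show "restrict (f i) (carrier (A i)) \<in> cont_hom (A i) K \<and>
        restrict (f i) (carrier (A i)) \<in> extensional (carrier (A i)) \<and>
        (\<forall>i'\<in>{i}. \<forall>g\<in>carrier (A i'). restrict (f i) (carrier (A i)) g = f i' g)"
      using cont_hom_cong[OF pro2_group_is_group[OF assms] pro2_topspace[OF assms] f, of "restrict (f i) (carrier (A i))"]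
      by simp
  qed (auto intro: extensionalityI)
qed

text \<open>This is associativity of coproducts: for a map from D, the condition given by the binary
  diagram is equivalent to the one given by all n + 1 factors, so unique existence carries over. The
  partial coproduct C has the element type of the factors and can therefore be a member of the
  family B.\<close>

lemma pro2_coproduct_Suc:
  assumes C: "is_pro2_coproduct TYPE('k) {1..n} A \<iota> C"
    and D: "is_pro2_coproduct TYPE('k) {1, 2 :: nat} B \<kappa> D" and B: "B 1 = C" "B 2 = A (Suc n)"
  shows "is_pro2_coproduct TYPE('k) {1..Suc n} A (\<lambda>i x. if i = Suc n then \<kappa> 2 x else \<kappa> 1 (\<iota> i x)) D"
  unfolding is_pro2_coproduct_def
proof (intro conjI allI impI)
  have C': "pro2_group C" "\<And>i. i \<in> {1..n} \<Longrightarrow> pro2_group (A i)" "\<And>i. i \<in> {1..n} \<Longrightarrow> \<iota> i \<in> cont_hom (A i) C"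
    using C by (simp_all add: is_pro2_coproduct_def)
  have D': "pro2_group (A (Suc n))" "\<kappa> 1 \<in> cont_hom C D" "\<kappa> 2 \<in> cont_hom (A (Suc n)) D"
    using D B by (simp_all add: is_pro2_coproduct_def)
  show "\<forall>i\<in>{1..Suc n}. pro2_group (A i)" using C'(2) D'(1) by (auto simp: le_Suc_eq)
  show "pro2_group D" using D by (simp add: is_pro2_coproduct_def)
  show "\<forall>i\<in>{1..Suc n}. (\<lambda>x. if i = Suc n then \<kappa> 2 x else \<kappa> 1 (\<iota> i x)) \<in> cont_hom (A i) D"
    using D'(3) cont_hom_compose[OF C'(3) D'(2)] by (auto simp: le_Suc_eq)
  fix K :: "'k topgroup" and f assume Kf: "pro2_group K \<and> (\<forall>i\<in>{1..Suc n}. f i \<in> cont_hom (A i) K)"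
  let ?P = "\<lambda>\<phi>. \<phi> \<in> cont_hom C K \<and> \<phi> \<in> extensional (carrier C) \<and> (\<forall>i\<in>{1..n}. \<forall>g\<in>carrier (A i). \<phi> (\<iota> i g) = f i g)"
  have "\<exists>!\<phi>. ?P \<phi>" using C Kf by (simp add: is_pro2_coproduct_def)
  then obtain \<phi> where \<phi>: "?P \<phi>" and \<phi>_unique: "\<And>\<psi>. ?P \<psi> \<Longrightarrow> \<psi> = \<phi>" by blast
  \<comment> \<open>On C the binary diagram receives the map that the first n factors already
    determine.\<close>
  define h where "h i = (if i = 1 then \<phi> else f (Suc n))" for i :: nat
  let ?R = "\<lambda>\<phi>. \<phi> \<in> cont_hom D K \<and> \<phi> \<in> extensional (carrier D) \<and> (\<forall>i\<in>{1, 2}. \<forall>g\<in>carrier (B i). \<phi> (\<kappa> i g) = h i g)"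
  have "pro2_group K \<and> (\<forall>i\<in>{1, 2}. h i \<in> cont_hom (B i) K)" using Kf \<phi> B by (simp add: h_def)
  then have ex1: "\<exists>!\<phi>. ?R \<phi>" using D unfolding is_pro2_coproduct_def by blast
  have "?R \<psi> \<longleftrightarrow> \<psi> \<in> cont_hom D K \<and> \<psi> \<in> extensional (carrier D) \<and> (\<forall>i\<in>{1..Suc n}. \<forall>g\<in>carrier (A i).
      \<psi> (if i = Suc n then \<kappa> 2 g else \<kappa> 1 (\<iota> i g)) = f i g)" (is "_ \<longleftrightarrow> ?T \<psi>") for \<psi>
  proof
    assume R: "?R \<psi>"
    then have 1: "\<psi> (\<kappa> 1 g) = \<phi> g" if "g \<in> carrier C" for g using that B by (simp add: h_def)
    have 2: "\<psi> (\<kappa> 2 g) = f (Suc n) g" if "g \<in> carrier (A (Suc n))" for g using R that B by (simp add: h_def)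
    have "\<psi> (\<kappa> 1 (\<iota> i g)) = f i g" if "i \<in> {1..n}" "g \<in> carrier (A i)" for i g
      using 1[OF cont_hom_closed[OF C'(3) that(2)]] that \<phi> by simp
    then have "\<psi> (if i = Suc n then \<kappa> 2 g else \<kappa> 1 (\<iota> i g)) = f i g"
      if "i \<in> {1..Suc n}" "g \<in> carrier (A i)" for i g
      using 2 that by (cases "i = Suc n") auto
    then show "?T \<psi>" using R by blast
  next
    assume T: "?T \<psi>"
    then have \<psi>: "\<psi> \<in> cont_hom D K"
      and T_eq: "\<And>i g. i \<in> {1..Suc n} \<Longrightarrow> g \<in> carrier (A i) \<Longrightarrow>
        \<psi> (if i = Suc n then \<kappa> 2 g else \<kappa> 1 (\<iota> i g)) = f i g" by blast+
    \<comment> \<open>Restriction makes the composite extensional, so the uniqueness clause for C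
      identifies it with \<phi>.\<close>
    let ?\<psi> = "restrict (\<lambda>g. \<psi> (\<kappa> 1 g)) (carrier C)"
    have "?\<psi> \<in> cont_hom C K"
      by (rule cont_hom_cong[OF pro2_group_is_group[OF C'(1)] pro2_topspace[OF C'(1)] cont_hom_compose[OF D'(2) \<psi>]]) simp
    moreover have "?\<psi> (\<iota> i g) = f i g" if "i \<in> {1..n}" "g \<in> carrier (A i)" for i g
    proof -
      have "\<psi> (if i = Suc n then \<kappa> 2 g else \<kappa> 1 (\<iota> i g)) = f i g" using T_eq[of i g] that by simp
      then show ?thesis using that cont_hom_closed[OF C'(3) that(2)] by simp
    qed
    ultimately have "?\<psi> = \<phi>" by (intro \<phi>_unique) simp
    then have "\<psi> (\<kappa> 1 g) = \<phi> g" if "g \<in> carrier C" for g using that by (metis restrict_apply')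
    moreover have "\<psi> (\<kappa> 2 g) = f (Suc n) g" if "g \<in> carrier (A (Suc n))" for g
    proof -
      have "\<psi> (if Suc n = Suc n then \<kappa> 2 g else \<kappa> 1 (\<iota> (Suc n) g)) = f (Suc n) g"
        using T_eq[of "Suc n" g] that by simp
      then show ?thesis by simp
    qed
    ultimately show "?R \<psi>" using T B by (simp add: h_def)
  qed
  then show "\<exists>!\<phi>. \<phi> \<in> cont_hom D K \<and> \<phi> \<in> extensional (carrier D) \<and> (\<forall>i\<in>{1..Suc n}. \<forall>g\<in>carrier (A i).
      \<phi> (if i = Suc n then \<kappa> 2 g else \<kappa> 1 (\<iota> i g)) = f i g)"
    using ex1 by simp
qed

theorem theorem2p13:
  shows
    "(\<forall>(n::nat) \<Gamma> z \<delta>.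
        n \<ge> 1 \<and> (\<forall>i\<in>{1..n}. ugraph (\<Gamma> i) \<and> delta_action (\<Gamma> i) (z i) (\<delta> i)) \<longrightarrow>
        (\<exists>\<Gamma>' z' \<delta>' \<iota>. ugraph \<Gamma>' \<and> delta_action \<Gamma>' z' \<delta>' \<and>
           is_pro2_coproduct TYPE('k) {1..n} (\<lambda>i. delta_raag (\<Gamma> i) (\<delta> i)) \<iota> (delta_raag \<Gamma>' \<delta>')))
     \<and>
     (\<forall>\<Gamma> z \<delta>.
        (\<forall>i\<in>{1, 2::nat}. ugraph (\<Gamma> i) \<and> delta_action (\<Gamma> i) (z i) (\<delta> i)) \<longrightarrow>
        (let d\<^sub>1 = nverts (\<Gamma> 1);
             d\<^sub>2 = nverts (\<Gamma> 2);
             \<Gamma>' = graph_union (graph_union (\<Gamma> 1) (\<Gamma> 2)) point_graph;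
             G = raag \<Gamma>';
             x = raag_gen \<Gamma>';
             \<zeta> = x (d\<^sub>1 + d\<^sub>2 + 1)
         in ugraph \<Gamma>' \<and>
            (\<exists>\<epsilon> z' \<delta>' \<iota>.
               (\<forall>i\<in>{1, 2}. \<epsilon> i \<in> cont_hom (raag (\<Gamma> i)) G) \<and>
               (\<forall>j\<in>{1..d\<^sub>1}. \<epsilon> 1 (raag_gen (\<Gamma> 1) j) = x j) \<and>
               (\<forall>j\<in>{1..d\<^sub>2}. \<epsilon> 2 (raag_gen (\<Gamma> 2) j) = x (d\<^sub>1 + j)) \<and>
               (\<forall>j\<in>{1..d\<^sub>1}. z' j = \<epsilon> 1 (z 1 j)) \<and>
               (\<forall>j\<in>{1..d\<^sub>2}. z' (d\<^sub>1 + j) = \<epsilon> 2 (z 2 j) \<otimes>\<^bsub>G\<^esub> inv\<^bsub>G\<^esub> \<zeta>) \<and>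
               z' (d\<^sub>1 + d\<^sub>2 + 1) = \<one>\<^bsub>G\<^esub> \<and>
               delta_action \<Gamma>' z' \<delta>' \<and>
               is_pro2_coproduct TYPE('k) {1, 2} (\<lambda>i. delta_raag (\<Gamma> i) (\<delta> i)) \<iota> (delta_raag \<Gamma>' \<delta>') \<and>
               (\<forall>i\<in>{1, 2}. \<forall>g\<in>carrier (raag (\<Gamma> i)). \<iota> i (g, \<one>\<^bsub>Delta\<^esub>) = (\<epsilon> i g, \<one>\<^bsub>Delta\<^esub>)) \<and>
               \<iota> 1 (\<one>\<^bsub>raag (\<Gamma> 1)\<^esub>, Delta_gen) = (\<one>\<^bsub>G\<^esub>, Delta_gen) \<and>
               (\<zeta>, \<one>\<^bsub>Delta\<^esub>) =
                 \<iota> 1 (\<one>\<^bsub>raag (\<Gamma> 1)\<^esub>, Delta_gen) \<otimes>\<^bsub>delta_raag \<Gamma>' \<delta>'\<^esub> \<iota> 2 (\<one>\<^bsub>raag (\<Gamma> 2)\<^esub>, Delta_gen))))"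
proof (intro conjI allI impI, goal_cases)
  case (1 n \<Gamma> z \<delta>)
  then show ?case
  proof (induction n)
    case 0
    then show ?case by simp
  next
    case (Suc n)
    show ?case
    proof (cases "n = 0")
      case True
      then have 1: "ugraph (\<Gamma> 1)" "delta_action (\<Gamma> 1) (z 1) (\<delta> 1)" using Suc.prems by simp_all
      interpret S: delta_semidirect "raag (\<Gamma> 1)" "\<delta> 1" by (rule delta_action_semidirect[OF 1])
      have eq: "{1..Suc n} = {1}" using True by simp
      \<comment> \<open>The induction effectively starts with one factor, which is its own
        coproduct.\<close>
      have "is_pro2_coproduct TYPE('k) {1..Suc n} (\<lambda>i. delta_raag (\<Gamma> i) (\<delta> i)) (\<lambda>_ x. x) (delta_raag (\<Gamma> 1) (\<delta> 1))"
        unfolding eq by (rule pro2_coproduct_single[of "\<lambda>i. delta_raag (\<Gamma> i) (\<delta> i)"]) (rule S.pro2_S)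
      then show ?thesis using 1 by blast
    next
      case False
      have "1 \<le> n \<and> (\<forall>i\<in>{1..n}. ugraph (\<Gamma> i) \<and> delta_action (\<Gamma> i) (z i) (\<delta> i))"
        using Suc.prems False by simp
      then obtain \<Gamma>' z' \<delta>' \<iota> where IH: "ugraph \<Gamma>'" "delta_action \<Gamma>' z' \<delta>'"
        "is_pro2_coproduct TYPE('k) {1..n} (\<lambda>i. delta_raag (\<Gamma> i) (\<delta> i)) \<iota> (delta_raag \<Gamma>' \<delta>')"
        using Suc.IH by blast
      \<comment> \<open>The group obtained from the first n factors becomes the first factor of the
        binary construction, so each step adds one further isolated vertex.\<close>
      interpret two_delta_raags \<Gamma>' "\<Gamma> (Suc n)" z' "z (Suc n)" \<delta>' "\<delta> (Suc n)"
        using IH(1,2) Suc.prems by unfold_locales auto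
      let ?\<kappa> = "\<lambda>i :: nat. if i = 1 then \<iota>\<^sub>1 else \<iota>\<^sub>2"
      have "is_pro2_coproduct TYPE('k) {1, 2}
          (\<lambda>i. if i = 1 then delta_raag \<Gamma>' \<delta>' else delta_raag (\<Gamma> (Suc n)) (\<delta> (Suc n))) ?\<kappa> S'.S"
        by (rule coproduct) simp_all
      then have "is_pro2_coproduct TYPE('k) {1..Suc n} (\<lambda>i. delta_raag (\<Gamma> i) (\<delta> i))
          (\<lambda>i x. if i = Suc n then ?\<kappa> 2 x else ?\<kappa> 1 (\<iota> i x)) S'.S"
        by (rule pro2_coproduct_Suc[OF IH(3)]) simp_all
      then show ?thesis using ug' delta_action' by blast
    qed
  qed
next
  case (2 \<Gamma> z \<delta>)
  interpret two_delta_raags "\<Gamma> 1" "\<Gamma> 2" "z 1" "z 2" "\<delta> 1" "\<delta> 2"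
    using 2 by unfold_locales auto
  have "is_pro2_coproduct TYPE('k) {1, 2} (\<lambda>i. delta_raag (\<Gamma> i) (\<delta> i)) (\<lambda>i. if i = 1 then \<iota>\<^sub>1 else \<iota>\<^sub>2) S'.S"
    by (rule coproduct) simp_all
  then show ?case
    unfolding Let_def \<zeta>_def[symmetric] one_Delta
    using ug' delta_action' \<epsilon>\<^sub>1 \<epsilon>\<^sub>2 \<epsilon>\<^sub>1_gen \<epsilon>\<^sub>2_gen z'_1 z'_2 z'_0[folded \<zeta>_def] \<iota>\<^sub>1_embed \<iota>\<^sub>2_embed \<iota>\<^sub>1_involution zeta_eq
    by (intro conjI exI[of _ "\<lambda>i. if i = 1 then \<epsilon>\<^sub>1 else \<epsilon>\<^sub>2"] exI[of _ z'] exI[of _ \<delta>']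
        exI[of _ "\<lambda>i. if i = 1 then \<iota>\<^sub>1 else \<iota>\<^sub>2"]) simp_all
qed

end
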